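(* Let $(X,d)$ be a Riemannian manifold, let $\phi^t$ be a discrete or continuous-time flow on $X$, and let $M\subset X$ be an isolated compact $\phi^t$-invariant set which is not a repeller, with normal bundle $V$. Let $\psi:N\to A$ be a diffeomorphism between some open neighborhood $N$ of the null section $Z$ of $V$ and some open neighborhood $A$ of $M$. If $M=\psi(Z)$ and $\psi^{-1}\phi^t\psi$ is the restriction to $N$ of a linear flow $\Phi^t$ of $V$, then $$\lambda(\phi^t,\psi(v))=\lambda_L(\Phi^t,v),$$ for all Lyapunov regular $v\in S$, where $S$ is the stable set of the null section of $V$ with respect to $\Phi^t$, and $$\Lambda(\phi^t,M)=\Lambda_L(\Phi^t,S).$$ Furthermore, $\Lambda(\phi^t,M)$ is not empty.
   Context: **Metric spectrum.** $X$ is compact and $d$ is its Riemannian distance. For a flow $\phi^t$ ($t\in\mathbb R$ or $t\in\mathbb Z$) on a compact metric space $(X,d)$ and an isolated compact $\phi^t$-invariant set $M\subset X$, the stable set is $\mathrm{st}(M)=\{x\in X:\omega(x)\subset M\}$, where $\omega(x)$ is the omega-limit set. The condition that $M$ is not a repeller is said to be equivalent to $\mathrm{st}(M)$ being non-empty. A point $x\in\mathrm{st}(M)$ is metric regular if the limit $\lambda(\phi^t,x)=\lim_{t\to\infty}\frac1t\log d(\phi^t(x),M)$ exists (the metric exponent), and the metric spectrum is $\Lambda(\phi^t,M)=\{\lambda(\phi^t,x):x\text{ is metric regular}\}$. **Lyapunov spectrum.** $V$ is regarded as a normed vector bundle with norm $|\cdot|$. For a linear flow $\Phi^t$ of a normed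 vector bundle $(V,|\cdot|)$, a vector $v\in V$ is Lyapunov regular if the limit $\lambda_L(\Phi^t,v)=\lim_{t\to\infty}\frac1t\log|\Phi^tv|$ exists (the Lyapunov exponent). With $S$ the stable set of the null section of $V$ (the vectors whose $\Phi^t$-orbit tends to the null section as $t\to\infty$), the stable Lyapunov spectrum is $\Lambda_L(\Phi^t,S)=\{\lambda_L(\Phi^t,v):v\in S\text{ and }v\text{ is Lyapunov regular}\}$. **Meaning of $\psi(v)$.** For $v\in S$ not in $N$, $\psi(v)$ is understood through the conjugation: for $s>0$ with $\Phi^sv\in N$, $\psi(v)$ is the point with $\phi^s(\psi(v))=\psi(\Phi^sv)$. Exponents do not change along orbits. *)

theory Defs
  imports "HOL-Analysis.Analysis"
begin

primrec Ck_on :: "nat \<Rightarrow> 'a::real_normed_vector set \<Rightarrow> ('a \<Rightarrow> 'b::real_normed_vector) \<Rightarrow> bool" where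
  "Ck_on 0 S f \<longleftrightarrow> continuous_on S f"
| "Ck_on (Suc k) S f \<longleftrightarrow>
     (\<forall>x\<in>S. f differentiable (at x)) \<and> (\<forall>v. Ck_on k S (\<lambda>x. frechet_derivative f (at x) v))"

text \<open>Only used for open \<open>S\<close>; smooth means \<open>C\<^sup>\<infinity>\<close>.\<close>

definition smooth_on :: "'a::real_normed_vector set \<Rightarrow> ('a \<Rightarrow> 'b::real_normed_vector) \<Rightarrow> bool" where
  "smooth_on S f \<longleftrightarrow> (\<forall>k. Ck_on k S f)"

text \<open>A chart is a domain together with a coordinate map, whose values off the domain are
  irrelevant. A manifold is given by an atlas on the set of points covered by its charts, and it
  carries the topology for which the charts are homeomorphisms onto open sets.\<close>

type_synonym ('p, 'e) chart = "'p set \<times> ('p \<Rightarrow> 'e)"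

definition smooth_atlas :: "('p, 'e::euclidean_space) chart set \<Rightarrow> bool" where
  "smooth_atlas P \<longleftrightarrow>
     (\<forall>(U, f)\<in>P. inj_on f U \<and> open (f ` U)) \<and>
     (\<forall>(U, f)\<in>P. \<forall>(U', f')\<in>P.
        open (f ` (U \<inter> U')) \<and> smooth_on (f ` (U \<inter> U')) (f' \<circ> inv_into U f))"

definition manifold_topology :: "('p, 'e::euclidean_space) chart set \<Rightarrow> 'p topology" where
  "manifold_topology P =
     topology (\<lambda>W. W \<subseteq> \<Union>(fst ` P) \<and> (\<forall>(U, f)\<in>P. open (f ` (W \<inter> U))))"

lemma openin_manifold_topology:
  assumes "smooth_atlas P"
  shows "openin (manifold_topology P) W \<longleftrightarrow>
           W \<subseteq> \<Union>(fst ` P) \<and> (\<forall>(U, f)\<in>P. open (f ` (W \<inter> U)))"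
proof -
  let ?O = "\<lambda>W. W \<subseteq> \<Union>(fst ` P) \<and> (\<forall>(U, f)\<in>P. open (f ` (W \<inter> U)))"
  have "?O (S \<inter> T)" if "?O S" "?O T" for S T
  proof -
    have "open (f ` (S \<inter> T \<inter> U))" if "(U, f) \<in> P" for U f
    proof -
      have "inj_on f U"
        using assms \<open>(U, f) \<in> P\<close> by (auto simp: smooth_atlas_def)
      then have "f ` (S \<inter> T \<inter> U) = f ` (S \<inter> U) \<inter> f ` (T \<inter> U)"
        by (auto simp: inj_on_def)
      then show ?thesis
        using \<open>?O S\<close> \<open>?O T\<close> \<open>(U, f) \<in> P\<close> by auto
    qed
    then show ?thesis using \<open>?O S\<close> by auto
  qed
  moreover have "?O (\<Union>\<K>)" if "\<forall>K\<in>\<K>. ?O K" for \<K>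
  proof -
    have "open (f ` (\<Union>\<K> \<inter> U))" if "(U, f) \<in> P" for U f
    proof -
      have "f ` (\<Union>\<K> \<inter> U) = (\<Union>K\<in>\<K>. f ` (K \<inter> U))"
        by blast
      moreover have "open \<dots>"
        using \<open>\<forall>K\<in>\<K>. ?O K\<close> \<open>(U, f) \<in> P\<close> by (intro open_UN) auto
      ultimately show ?thesis by simp
    qed
    then show ?thesis using that by auto
  qed
  ultimately have "istopology ?O"
    unfolding istopology_def by meson
  then show ?thesis
    by (simp add: manifold_topology_def)
qed

definition smooth_manifold :: "('p, 'e::euclidean_space) chart set \<Rightarrow> bool" where
  "smooth_manifold P \<longleftrightarrow>
     smooth_atlas P \<and> Hausdorff_space (manifold_topology P) \<and> second_countable (manifold_topology P)"

abbreviation points :: "('p, 'e::euclidean_space) chart set \<Rightarrow> 'p set" where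
  "points P \<equiv> topspace (manifold_topology P)"

text \<open>Smoothness of a map defined on an arbitrary subset of a manifold: near each point of the
  subset, it is in charts the restriction of a smooth map defined on an open set.\<close>

definition smooth_map_on ::
    "('p, 'a::euclidean_space) chart set \<Rightarrow> ('q, 'b::euclidean_space) chart set \<Rightarrow> 'p set \<Rightarrow> ('p \<Rightarrow> 'q) \<Rightarrow> bool" where
  "smooth_map_on P Q S h \<longleftrightarrow>
     (\<forall>p\<in>S. \<exists>(U, f)\<in>P. \<exists>(U', f')\<in>Q. p \<in> U \<and> h p \<in> U' \<and>
        (\<exists>W H. open W \<and> f p \<in> W \<and> smooth_on W H \<and>
          (\<forall>q\<in>S \<inter> U. f q \<in> W \<longrightarrow> h q \<in> U' \<and> f' (h q) = H (f q))))"

definition diffeomorphism_between ::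
    "('p, 'a::euclidean_space) chart set \<Rightarrow> ('q, 'b::euclidean_space) chart set \<Rightarrow>
     'p set \<Rightarrow> 'q set \<Rightarrow> ('p \<Rightarrow> 'q) \<Rightarrow> bool" where
  "diffeomorphism_between P Q N A h \<longleftrightarrow>
     bij_betw h N A \<and> smooth_map_on P Q N h \<and> smooth_map_on Q P A (inv_into N h)"

text \<open>A tangent vector at \<open>p\<close> assigns to each chart around \<open>p\<close> its coordinate vector in that chart,
  and these are related by the derivatives of the transition maps. To make equality of tangent
  vectors meaningful, the value is \<open>0\<close> for all other arguments. Vector operations are pointwise.\<close>

type_synonym ('p, 'e) tvec = "('p, 'e) chart \<Rightarrow> 'e"

definition tangent_space :: "('p, 'e::euclidean_space) chart set \<Rightarrow> 'p \<Rightarrow> ('p, 'e) tvec set" where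
  "tangent_space P p =
     {\<xi>. (\<forall>c. \<not> (c \<in> P \<and> p \<in> fst c) \<longrightarrow> \<xi> c = 0) \<and>
         (\<forall>(U, f)\<in>P. \<forall>(U', f')\<in>P. p \<in> U \<inter> U' \<longrightarrow>
            \<xi> (U', f') = frechet_derivative (f' \<circ> inv_into U f) (at (f p)) (\<xi> (U, f)))}"

definition tangent_atlas ::
    "('p, 'e::euclidean_space) chart set \<Rightarrow> ('p \<times> ('p, 'e) tvec, 'e \<times> 'e) chart set" where
  "tangent_atlas P =
     (\<lambda>(U, f). (Sigma U (tangent_space P), \<lambda>(p, \<xi>). (f p, \<xi> (U, f)))) ` P"

definition velocity ::
    "('p, 'e::euclidean_space) chart set \<Rightarrow> (real \<Rightarrow> 'p) \<Rightarrow> real set \<Rightarrow> real \<Rightarrow> ('p, 'e) tvec" where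
  "velocity P \<gamma> I t =
     (\<lambda>c. if c \<in> P \<and> \<gamma> t \<in> fst c then vector_derivative (snd c \<circ> \<gamma>) (at t within I) else 0)"

definition riemannian_metric ::
    "('p, 'e::euclidean_space) chart set \<Rightarrow> ('p \<Rightarrow> ('p, 'e) tvec \<Rightarrow> ('p, 'e) tvec \<Rightarrow> real) \<Rightarrow> bool" where
  "riemannian_metric P g \<longleftrightarrow>
     (\<forall>p\<in>points P. \<forall>\<xi>\<in>tangent_space P p. \<forall>\<eta>\<in>tangent_space P p.
        g p \<xi> \<eta> = g p \<eta> \<xi> \<and>
        (\<xi> \<noteq> (\<lambda>_. 0) \<longrightarrow> 0 < g p \<xi> \<xi>) \<and>
        (\<forall>\<zeta>\<in>tangent_space P p. \<forall>a b.
           g p (\<lambda>c. a *\<^sub>R \<xi> c + b *\<^sub>R \<eta> c) \<zeta> = a * g p \<xi> \<zeta> + b * g p \<eta> \<zeta>)) \<and>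
     (\<forall>(U, f)\<in>P. \<exists>G. (\<forall>u w. smooth_on (f ` U) (\<lambda>y. G y u w)) \<and>
        (\<forall>p\<in>U. \<forall>\<xi>\<in>tangent_space P p. \<forall>\<eta>\<in>tangent_space P p.
           g p \<xi> \<eta> = G (f p) (\<xi> (U, f)) (\<eta> (U, f))))"

text \<open>\<open>K\<close> is the finite set of break points; between them the curve is \<open>C\<^sup>1\<close> up to the ends.\<close>

definition piecewise_C1_curve :: "('p, 'e::euclidean_space) chart set \<Rightarrow> (real \<Rightarrow> 'p) \<Rightarrow> bool" where
  "piecewise_C1_curve P \<gamma> \<longleftrightarrow>
     pathin (manifold_topology P) \<gamma> \<and>
     (\<exists>K. finite K \<and>
       (\<forall>(U, f)\<in>P. \<forall>s t. 0 \<le> s \<and> s < t \<and> t \<le> 1 \<and> {s<..<t} \<inter> K = {} \<and> \<gamma> ` {s..t} \<subseteq> U \<longrightarrow>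
         (\<exists>D. continuous_on {s..t} D \<and>
           (\<forall>r\<in>{s..t}. (f \<circ> \<gamma> has_vector_derivative D r) (at r within {s..t})))))"

definition curve_length ::
    "('p, 'e::euclidean_space) chart set \<Rightarrow> ('p \<Rightarrow> ('p, 'e) tvec \<Rightarrow> ('p, 'e) tvec \<Rightarrow> real) \<Rightarrow>
     (real \<Rightarrow> 'p) \<Rightarrow> ennreal" where
  "curve_length P g \<gamma> =
     (\<integral>\<^sup>+ t\<in>{0..1}. ennreal (sqrt (g (\<gamma> t) (velocity P \<gamma> {0..1} t) (velocity P \<gamma> {0..1} t))) \<partial>lborel)"

text \<open>The distance is \<open>\<infinity>\<close> between different components, so that connectedness need not be assumed.\<close>

definition riemannian_dist ::
    "('p, 'e::euclidean_space) chart set \<Rightarrow> ('p \<Rightarrow> ('p, 'e) tvec \<Rightarrow> ('p, 'e) tvec \<Rightarrow> real) \<Rightarrow>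
     'p \<Rightarrow> 'p \<Rightarrow> ennreal" where
  "riemannian_dist P g x y =
     (INF \<gamma>\<in>{\<gamma>. piecewise_C1_curve P \<gamma> \<and> \<gamma> 0 = x \<and> \<gamma> 1 = y}. curve_length P g \<gamma>)"

definition dist_to_set :: "('p \<Rightarrow> 'p \<Rightarrow> ennreal) \<Rightarrow> 'p \<Rightarrow> 'p set \<Rightarrow> ennreal" where
  "dist_to_set d x M = (INF m\<in>M. d x m)"

text \<open>The dimension of the slices \<open>L\<close> may differ between components of \<open>M\<close>.\<close>

definition embedded_submanifold :: "('p, 'e::euclidean_space) chart set \<Rightarrow> 'p set \<Rightarrow> bool" where
  "embedded_submanifold P M \<longleftrightarrow> M \<subseteq> points P \<and>
     (\<forall>p\<in>M. \<exists>(U, f)\<in>P. p \<in> U \<and>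
       (\<exists>W h L. open W \<and> f p \<in> W \<and> W \<subseteq> f ` U \<and>
          inj_on h W \<and> open (h ` W) \<and> smooth_on W h \<and> smooth_on (h ` W) (inv_into W h) \<and>
          subspace (L :: 'e set) \<and> h ` (W \<inter> f ` (M \<inter> U)) = h ` W \<inter> L))"

definition submanifold_tangent_space ::
    "('p, 'e::euclidean_space) chart set \<Rightarrow> 'p set \<Rightarrow> 'p \<Rightarrow> ('p, 'e) tvec set" where
  "submanifold_tangent_space P M p =
     {velocity P \<gamma> UNIV 0 |\<gamma>. \<gamma> 0 = p \<and>
        (\<exists>e>0. \<exists>(U, f)\<in>P. \<gamma> ` {-e<..<e} \<subseteq> M \<inter> U \<and> smooth_on {-e<..<e} (f \<circ> \<gamma>))}"

definition normal_bundle ::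
    "('p, 'e::euclidean_space) chart set \<Rightarrow> ('p \<Rightarrow> ('p, 'e) tvec \<Rightarrow> ('p, 'e) tvec \<Rightarrow> real) \<Rightarrow>
     'p set \<Rightarrow> ('p \<times> ('p, 'e) tvec) set" where
  "normal_bundle P g M =
     {(p, \<xi>). p \<in> M \<and> \<xi> \<in> tangent_space P p \<and> (\<forall>\<eta>\<in>submanifold_tangent_space P M p. g p \<xi> \<eta> = 0)}"

definition normal_bundle_topology ::
    "('p, 'e::euclidean_space) chart set \<Rightarrow> ('p \<Rightarrow> ('p, 'e) tvec \<Rightarrow> ('p, 'e) tvec \<Rightarrow> real) \<Rightarrow>
     'p set \<Rightarrow> ('p \<times> ('p, 'e) tvec) topology" where
  "normal_bundle_topology P g M =
     subtopology (manifold_topology (tangent_atlas P)) (normal_bundle P g M)"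

definition null_section :: "'p set \<Rightarrow> ('p \<times> ('p, 'e::euclidean_space) tvec) set" where
  "null_section M = (\<lambda>p. (p, \<lambda>_. 0)) ` M"

definition bundle_norm ::
    "('p \<times> ('p, 'e::euclidean_space) tvec) topology \<Rightarrow> ('p \<times> ('p, 'e) tvec \<Rightarrow> real) \<Rightarrow> bool" where
  "bundle_norm V nm \<longleftrightarrow>
     continuous_map V euclideanreal nm \<and>
     (\<forall>p \<xi>. (p, \<xi>) \<in> topspace V \<longrightarrow>
        0 \<le> nm (p, \<xi>) \<and> (nm (p, \<xi>) = 0 \<longleftrightarrow> \<xi> = (\<lambda>_. 0)) \<and>
        (\<forall>a. nm (p, \<lambda>c. a *\<^sub>R \<xi> c) = \<bar>a\<bar> * nm (p, \<xi>)) \<and>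
        (\<forall>\<eta>. (p, \<eta>) \<in> topspace V \<longrightarrow> nm (p, \<lambda>c. \<xi> c + \<eta> c) \<le> nm (p, \<xi>) + nm (p, \<eta>)))"

text \<open>\<open>T\<close> is the group of times, either all reals or the integers.\<close>

definition is_time :: "real set \<Rightarrow> bool" where
  "is_time T \<longleftrightarrow> T = UNIV \<or> T = \<int>"

definition at_top_in :: "real set \<Rightarrow> real filter" where
  "at_top_in T = inf at_top (principal T)"

definition flow_on :: "real set \<Rightarrow> 'x topology \<Rightarrow> (real \<Rightarrow> 'x \<Rightarrow> 'x) \<Rightarrow> bool" where
  "flow_on T X \<phi> \<longleftrightarrow>
     continuous_map (prod_topology (top_of_set T) X) X (\<lambda>(t, x). \<phi> t x) \<and>
     (\<forall>x\<in>topspace X. \<phi> 0 x = x \<and> (\<forall>s\<in>T. \<forall>t\<in>T. \<phi> (s + t) x = \<phi> s (\<phi> t x)))"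

definition invariant_set :: "real set \<Rightarrow> (real \<Rightarrow> 'x \<Rightarrow> 'x) \<Rightarrow> 'x set \<Rightarrow> bool" where
  "invariant_set T \<phi> M \<longleftrightarrow> (\<forall>t\<in>T. \<phi> t ` M = M)"

definition isolated_invariant :: "real set \<Rightarrow> 'x topology \<Rightarrow> (real \<Rightarrow> 'x \<Rightarrow> 'x) \<Rightarrow> 'x set \<Rightarrow> bool" where
  "isolated_invariant T X \<phi> M \<longleftrightarrow> invariant_set T \<phi> M \<and>
     (\<exists>U. openin X U \<and> M \<subseteq> U \<and> (\<forall>x\<in>U. (\<forall>t\<in>T. \<phi> t x \<in> U) \<longrightarrow> x \<in> M))"

definition omega_limit :: "real set \<Rightarrow> 'x topology \<Rightarrow> (real \<Rightarrow> 'x \<Rightarrow> 'x) \<Rightarrow> 'x \<Rightarrow> 'x set" where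
  "omega_limit T X \<phi> x = (\<Inter>s\<in>T. X closure_of {\<phi> t x |t. t \<in> T \<and> s \<le> t})"

text \<open>A repeller is the limit set, in backward time, of one of its neighbourhoods.\<close>

definition repeller :: "real set \<Rightarrow> 'x topology \<Rightarrow> (real \<Rightarrow> 'x \<Rightarrow> 'x) \<Rightarrow> 'x set \<Rightarrow> bool" where
  "repeller T X \<phi> M \<longleftrightarrow>
     (\<exists>U. openin X U \<and> M \<subseteq> U \<and>
        (\<Inter>s\<in>T. X closure_of (\<Union>t\<in>{t\<in>T. s \<le> t}. \<phi> (- t) ` U)) = M)"

definition stable_set :: "real set \<Rightarrow> 'x topology \<Rightarrow> (real \<Rightarrow> 'x \<Rightarrow> 'x) \<Rightarrow> 'x set \<Rightarrow> 'x set" where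
  "stable_set T X \<phi> M = {x \<in> topspace X. omega_limit T X \<phi> x \<subseteq> M}"

definition linear_flow ::
    "real set \<Rightarrow> ('p \<times> ('p, 'e::euclidean_space) tvec) topology \<Rightarrow>
     (real \<Rightarrow> 'p \<times> ('p, 'e) tvec \<Rightarrow> 'p \<times> ('p, 'e) tvec) \<Rightarrow> bool" where
  "linear_flow T V \<Phi> \<longleftrightarrow> flow_on T V \<Phi> \<and>
     (\<forall>t\<in>T. \<forall>p \<xi> \<eta>. (p, \<xi>) \<in> topspace V \<and> (p, \<eta>) \<in> topspace V \<longrightarrow>
        fst (\<Phi> t (p, \<xi>)) = fst (\<Phi> t (p, \<eta>)) \<and>
        (\<forall>a b. \<Phi> t (p, \<lambda>c. a *\<^sub>R \<xi> c + b *\<^sub>R \<eta> c) =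
           (fst (\<Phi> t (p, \<xi>)), \<lambda>c. a *\<^sub>R snd (\<Phi> t (p, \<xi>)) c + b *\<^sub>R snd (\<Phi> t (p, \<eta>)) c)))"

definition null_stable_set ::
    "real set \<Rightarrow> ('p \<times> ('p, 'e::euclidean_space) tvec) topology \<Rightarrow>
     (real \<Rightarrow> 'p \<times> ('p, 'e) tvec \<Rightarrow> 'p \<times> ('p, 'e) tvec) \<Rightarrow> 'p set \<Rightarrow> ('p \<times> ('p, 'e) tvec) set" where
  "null_stable_set T V \<Phi> M =
     {v \<in> topspace V. \<forall>W. openin V W \<and> null_section M \<subseteq> W \<longrightarrow> (\<forall>\<^sub>F t in at_top_in T. \<Phi> t v \<in> W)}"

definition elog :: "ennreal \<Rightarrow> ereal" where
  "elog a = (if a = 0 then -\<infinity> else if a = \<infinity> then \<infinity> else ereal (ln (enn2real a)))"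

text \<open>Regularity demands a finite limit, so the points of \<open>M\<close> and the null vectors, whose
  logarithms are constantly \<open>-\<infinity>\<close>, are not regular.\<close>

definition has_metric_exponent ::
    "real set \<Rightarrow> ('x \<Rightarrow> 'x \<Rightarrow> ennreal) \<Rightarrow> (real \<Rightarrow> 'x \<Rightarrow> 'x) \<Rightarrow> 'x set \<Rightarrow> 'x \<Rightarrow> real \<Rightarrow> bool" where
  "has_metric_exponent T d \<phi> M x l \<longleftrightarrow>
     ((\<lambda>t. elog (dist_to_set d (\<phi> t x) M) / ereal t) \<longlongrightarrow> ereal l) (at_top_in T)"

definition metric_regular ::
    "real set \<Rightarrow> 'x topology \<Rightarrow> ('x \<Rightarrow> 'x \<Rightarrow> ennreal) \<Rightarrow> (real \<Rightarrow> 'x \<Rightarrow> 'x) \<Rightarrow> 'x set \<Rightarrow> 'x \<Rightarrow> bool" where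
  "metric_regular T X d \<phi> M x \<longleftrightarrow> x \<in> stable_set T X \<phi> M \<and> (\<exists>l. has_metric_exponent T d \<phi> M x l)"

definition metric_exponent ::
    "real set \<Rightarrow> ('x \<Rightarrow> 'x \<Rightarrow> ennreal) \<Rightarrow> (real \<Rightarrow> 'x \<Rightarrow> 'x) \<Rightarrow> 'x set \<Rightarrow> 'x \<Rightarrow> real" where
  "metric_exponent T d \<phi> M x = (THE l. has_metric_exponent T d \<phi> M x l)"

definition metric_spectrum ::
    "real set \<Rightarrow> 'x topology \<Rightarrow> ('x \<Rightarrow> 'x \<Rightarrow> ennreal) \<Rightarrow> (real \<Rightarrow> 'x \<Rightarrow> 'x) \<Rightarrow> 'x set \<Rightarrow> real set" where
  "metric_spectrum T X d \<phi> M = {metric_exponent T d \<phi> M x |x. metric_regular T X d \<phi> M x}"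

definition has_lyapunov_exponent ::
    "real set \<Rightarrow> ('v \<Rightarrow> real) \<Rightarrow> (real \<Rightarrow> 'v \<Rightarrow> 'v) \<Rightarrow> 'v \<Rightarrow> real \<Rightarrow> bool" where
  "has_lyapunov_exponent T nm \<Phi> v l \<longleftrightarrow>
     ((\<lambda>t. elog (ennreal (nm (\<Phi> t v))) / ereal t) \<longlongrightarrow> ereal l) (at_top_in T)"

definition lyapunov_regular ::
    "real set \<Rightarrow> ('v \<Rightarrow> real) \<Rightarrow> (real \<Rightarrow> 'v \<Rightarrow> 'v) \<Rightarrow> 'v \<Rightarrow> bool" where
  "lyapunov_regular T nm \<Phi> v \<longleftrightarrow> (\<exists>l. has_lyapunov_exponent T nm \<Phi> v l)"

definition lyapunov_exponent ::
    "real set \<Rightarrow> ('v \<Rightarrow> real) \<Rightarrow> (real \<Rightarrow> 'v \<Rightarrow> 'v) \<Rightarrow> 'v \<Rightarrow> real" where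
  "lyapunov_exponent T nm \<Phi> v = (THE l. has_lyapunov_exponent T nm \<Phi> v l)"

definition lyapunov_spectrum ::
    "real set \<Rightarrow> ('v \<Rightarrow> real) \<Rightarrow> (real \<Rightarrow> 'v \<Rightarrow> 'v) \<Rightarrow> 'v set \<Rightarrow> real set" where
  "lyapunov_spectrum T nm \<Phi> S = {lyapunov_exponent T nm \<Phi> v |v. v \<in> S \<and> lyapunov_regular T nm \<Phi> v}"

text \<open>Neither \<open>N\<close> nor its image under \<open>\<psi>\<close> is invariant in general: \<open>\<psi>\<close> intertwines the flows for those
  \<open>v\<close> and \<open>t\<close> for which the restriction of \<open>\<Phi>\<close> to \<open>N\<close> is defined.\<close>

definition conjugates_on ::
    "real set \<Rightarrow> (real \<Rightarrow> 'x \<Rightarrow> 'x) \<Rightarrow> (real \<Rightarrow> 'v \<Rightarrow> 'v) \<Rightarrow> 'v set \<Rightarrow> ('v \<Rightarrow> 'x) \<Rightarrow> bool" where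
  "conjugates_on T \<phi> \<Phi> N \<psi> \<longleftrightarrow>
     (\<forall>t\<in>T. \<forall>v\<in>N. \<Phi> t v \<in> N \<longrightarrow> \<phi> t (\<psi> v) = \<psi> (\<Phi> t v))"

text \<open>The extension of \<open>\<psi>\<close> from \<open>N\<close> to the stable set of the null section.\<close>

definition extended_conjugation ::
    "real set \<Rightarrow> 'x topology \<Rightarrow> (real \<Rightarrow> 'x \<Rightarrow> 'x) \<Rightarrow> (real \<Rightarrow> 'v \<Rightarrow> 'v) \<Rightarrow> 'v set \<Rightarrow> ('v \<Rightarrow> 'x) \<Rightarrow> 'v \<Rightarrow> 'x" where
  "extended_conjugation T X \<phi> \<Phi> N \<psi> v =
     (if v \<in> N then \<psi> v
      else (THE x. x \<in> topspace X \<and> (\<exists>s\<in>T. 0 < s \<and> \<Phi> s v \<in> N \<and> \<phi> s x = \<psi> (\<Phi> s v))))"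

end

(* Near its null section the bundle V is homeomorphic to the compact manifold X, so the unit sphere
   {|v| = 1} of V is compact. Isolation of M says that no nonzero orbit of the linear flow is bounded
   in both time directions, and compactness turns this into a uniform n such that every orbit doubles
   its norm within n time steps, forwards or backwards. Hence forward bounded orbits decay uniformly,
   the forward bounded unit vectors form a compact set, and the maximal growth rate on that set is
   attained exactly. If there are no nonzero forward bounded vectors, doubling always happens
   forwards, the reversed flow contracts, and M is a repeller.

   The diffeomorphism and its inverse are locally Lipschitz in charts and the metric is locally
   comparable with the Euclidean one, so c |v| <= d(psi v, M) <= C |v| near the null section. Factors
   bounded away from 0 and infinity do not affect exponents, which therefore agree along
   psi-conjugate orbits. *)
theory Submission
  imports Defs
begin

section \<open>Linear flows on normed cones\<close>

text \<open>The flow on \<open>M\<close> is arbitrary, so a given vector need not have an exponent,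
  and no invariant measure is used to find one. The way out is extremal: an upper growth rate valid
  uniformly for all vectors leaves no room for oscillation to a vector that never falls below it.
  \<open>N\<close> is in general neither invariant nor fibrewise star-shaped, and
  \<open>\<psi>\<close> intertwines the flows only between points of \<open>N\<close>. In the
  dynamical estimates a small norm guarantees membership in \<open>N\<close>. Where only the orbit
  of \<open>\<phi>\<close> is known to stay near \<open>M\<close>, it is lifted in time steps of
  length at most one, after shrinking the ball by the factor that one step can cost. The distance is
  an infimum over curves that may leave any chart. A curve that leaves a coordinate ball is long by
  a fixed amount; the others are measured by their coordinates. Discrete and continuous time are
  treated together: estimates are proved at integer times, and a bounded factor covers the remaining
  fraction.\<close>

lemma doubling_decay:
  fixes f :: "nat \<Rightarrow> real"
  assumes nonneg: "\<And>k. 0 \<le> f k" and bdd: "\<And>k. f k \<le> R"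
    and doubling: "\<And>k. n \<le> k \<Longrightarrow> 0 < f k \<Longrightarrow> \<exists>j. k \<le> j + n \<and> 2 * f k < f j"
    and initial: "\<And>k. k \<le> n \<Longrightarrow> f k \<le> B"
    and k: "m * n \<le> k"
  shows "f k \<le> B / 2 ^ m"
proof -
  have B: "0 \<le> B"
    using nonneg[of 0] initial[of 0] by linarith
  \<comment> \<open>The index \<open>j\<close> may lie on either side of \<open>k\<close>, so
    chasing doublings need not lead to an end of the orbit. Instead, each doubling halves the bound
    \<open>R\<close> for all indices at once, until the initial values take over.\<close>
  have 1: "f k \<le> max B (R / 2 ^ m)" for k m
  proof (induction m arbitrary: k)
    case 0
    then show ?case using bdd[of k] by auto
  next
    case (Suc m)
    show ?case
    proof (cases "n \<le> k \<and> 0 < f k")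
      case True
      then obtain j where "2 * f k < f j" using doubling by blast
      then have "2 * f k \<le> max B (R / 2 ^ m)" using Suc[of j] by (rule order_trans[OF less_imp_le])
      then have "f k \<le> max B (R / 2 ^ m) / 2" by (simp only: pos_le_divide_eq[of 2] zero_less_numeral mult.commute)
      also have "\<dots> \<le> max B (R / 2 ^ m / 2)" using B by (simp add: max_def)
      also have "\<dots> = max B (R / 2 ^ Suc m)" by (simp add: mult.commute)
      finally show ?thesis .
    next
      case False
      then show ?thesis using initial[of k] B by (auto simp: le_max_iff_disj)
    qed
  qed
  have 2: "f k \<le> B" for k
  proof -
    have "(\<lambda>m. max B (R * (1/2) ^ m)) \<longlonglongrightarrow> max B (R * 0)"
      by (intro tendsto_intros) auto
    then have "f k \<le> max B (R * 0)"
      by (rule LIMSEQ_le_const) (use 1[of k] in \<open>auto simp: power_one_over field_simps\<close>)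
    then show ?thesis using B by simp
  qed
  \<comment> \<open>Now \<open>B\<close> bounds every value. An index
    \<open>k \<ge> Suc m * n\<close> doubles at some \<open>j \<ge> m * n\<close>, where the bound
    already has the factor \<open>1 / 2 ^ m\<close>.\<close>
  show ?thesis using k
  proof (induction m arbitrary: k)
    case 0
    then show ?case using 2 by simp
  next
    case (Suc m)
    show ?case
    proof (cases "0 < f k")
      case True
      with Suc.prems obtain j where j: "k \<le> j + n" "2 * f k < f j"
        using doubling[of k] by auto
      then have "m * n \<le> j" using Suc.prems by simp
      then have "2 * f k \<le> B / 2 ^ m" using Suc.IH[of j] j by linarith
      then show ?thesis by (simp add: field_simps)
    next
      case False
      then show ?thesis using B by (simp add: order_trans[of "f k" 0])
    qed
  qed
qed

text \<open>Doublings hit uncontrolled indices inside windows of length \<open>n\<close>, and the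
  last one need not be \<open>k\<close>. The factor \<open>C\<close> pays once for the remaining
  stretch, not once per doubling.\<close>

lemma doubling_growth:
  fixes f :: "nat \<Rightarrow> real"
  assumes nonneg: "\<And>k. 0 \<le> f k"
    and doubling: "\<And>k. 0 < f k \<Longrightarrow> \<exists>j>k. j \<le> k + n \<and> 2 * f k < f j"
    and short: "\<And>i j. i \<le> j \<Longrightarrow> j \<le> i + n \<Longrightarrow> f i \<le> C * f j" and "1 \<le> C"
    and k: "m * n \<le> k - i" and "i \<le> k"
  shows "2 ^ m * f i \<le> C * f k"
proof -
  have 1: "f i \<le> C * f k" if "i \<le> k" for i k
  proof -
    let ?S = "{s. i \<le> s \<and> s \<le> k \<and> f i \<le> f s}"
    \<comment> \<open>\<open>s\<close> is the last index up to \<open>k\<close> with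
      \<open>f i \<le> f s\<close>. If \<open>k\<close> were more than \<open>n\<close> away,
      doubling from a positive \<open>f s\<close> would give a later such index.\<close>
    define s where "s = Max ?S"
    have fin: "finite ?S" by (rule finite_subset[of _ "{..k}"]) auto
    moreover have "?S \<noteq> {}" using that by auto
    ultimately have s: "i \<le> s" "s \<le> k" "f i \<le> f s"
      using Max_in[of ?S] by (auto simp: s_def)
    show ?thesis
    proof (cases "k \<le> s + n")
      case True
      then show ?thesis using short[of s k] s by auto
    next
      case False
      have "\<not> 0 < f s"
      proof
        assume "0 < f s"
        then obtain j where j: "j > s" "j \<le> s + n" "2 * f s < f j"
          using doubling by blast
        then have "j \<in> ?S" using False s nonneg[of s] by auto
        then have "j \<le> s" using fin by (simp add: s_def)
        then show False using j by simp
      qed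
      then have "f i \<le> 0" using s by linarith
      moreover have "0 \<le> C * f k" using nonneg[of k] \<open>1 \<le> C\<close> by auto
      ultimately show ?thesis by linarith
    qed
  qed
  show ?thesis using k \<open>i \<le> k\<close>
  proof (induction m arbitrary: i)
    case 0
    then show ?case using 1 by simp
  next
    case (Suc m)
    show ?case
    proof (cases "0 < f i")
      case True
      then obtain j where j: "j > i" "j \<le> i + n" "2 * f i < f j"
        using doubling by blast
      have n: "n + m * n \<le> k - i" using Suc.prems by simp
      have "i + n \<le> k" using n Suc.prems by linarith
      then have jk: "j \<le> k" using j by linarith
      have "m * n \<le> k - j" using n j by linarith
      then have *: "2 ^ m * f j \<le> C * f k" using Suc.IH jk by blast
      have "2 ^ Suc m * f i = 2 ^ m * (2 * f i)" by simp
      also have "\<dots> \<le> 2 ^ m * f j" using j by (intro mult_left_mono) auto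
      finally show ?thesis using * by linarith
    next
      case False
      then show ?thesis using nonneg[of i] nonneg[of k] \<open>1 \<le> C\<close> by simp
    qed
  qed
qed

section \<open>Times and flows\<close>

lemma eventually_at_top_in: "(\<forall>\<^sub>F t in at_top_in T. Q t) \<longleftrightarrow> (\<exists>s. \<forall>t\<in>T. s \<le> t \<longrightarrow> Q t)"
  by (auto simp: at_top_in_def eventually_inf_principal eventually_at_top_linorder)

lemma time_closed: "is_time T \<Longrightarrow> closed T"
  by (auto simp: is_time_def)

lemma time_of_int: "is_time T \<Longrightarrow> real_of_int k \<in> T"
  by (auto simp: is_time_def)

lemma time_of_nat: "is_time T \<Longrightarrow> real k \<in> T"
  using time_of_int[of T "int k"] by simp

lemma time_add: "is_time T \<Longrightarrow> s \<in> T \<Longrightarrow> t \<in> T \<Longrightarrow> s + t \<in> T"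
  by (auto simp: is_time_def)

lemma time_uminus: "is_time T \<Longrightarrow> t \<in> T \<Longrightarrow> - t \<in> T"
  by (auto simp: is_time_def)

lemma time_diff: "is_time T \<Longrightarrow> s \<in> T \<Longrightarrow> t \<in> T \<Longrightarrow> s - t \<in> T"
  by (auto simp: is_time_def)

lemma time_zero: "is_time T \<Longrightarrow> 0 \<in> T"
  by (auto simp: is_time_def)

lemma at_top_in_time_neq_bot: "is_time T \<Longrightarrow> at_top_in T \<noteq> bot"
  unfolding trivial_limit_def eventually_at_top_in
  by (metis linear real_nat_ceiling_ge time_of_nat)

lemma flow_in: "flow_on T X \<phi> \<Longrightarrow> t \<in> T \<Longrightarrow> x \<in> topspace X \<Longrightarrow> \<phi> t x \<in> topspace X"
  unfolding flow_on_def continuous_map_def by force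

lemma flow_add: "flow_on T X \<phi> \<Longrightarrow> s \<in> T \<Longrightarrow> t \<in> T \<Longrightarrow> x \<in> topspace X \<Longrightarrow> \<phi> (s + t) x = \<phi> s (\<phi> t x)"
  unfolding flow_on_def by blast

lemma flow_zero: "flow_on T X \<phi> \<Longrightarrow> x \<in> topspace X \<Longrightarrow> \<phi> 0 x = x"
  unfolding flow_on_def by blast

lemma flow_inverse:
  assumes "flow_on T X \<phi>" "is_time T" "t \<in> T" "x \<in> topspace X"
  shows "\<phi> (- t) (\<phi> t x) = x" "\<phi> t (\<phi> (- t) x) = x"
  using assms flow_add[of T X \<phi> "- t" t x] flow_add[of T X \<phi> t "- t" x]
  by (auto simp: time_uminus flow_zero)

lemma flow_continuous_map:
  assumes "flow_on T X \<phi>" "t \<in> T"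
  shows "continuous_map X X (\<phi> t)"
proof -
  have "continuous_map X (prod_topology (top_of_set T) X) (\<lambda>x. (t, x))"
    using assms by (auto simp: continuous_map_pairwise o_def)
  then have "continuous_map X X ((\<lambda>(t, x). \<phi> t x) \<circ> (\<lambda>x. (t, x)))"
    using assms unfolding flow_on_def by (blast intro: continuous_map_compose)
  then show ?thesis by (simp add: o_def)
qed

(* Of the linear structure of the bundle only multiplication by scalars is needed. *)
locale cone_flow =
  fixes T :: "real set" and V :: "'v topology" and nm :: "'v \<Rightarrow> real"
    and sc :: "real \<Rightarrow> 'v \<Rightarrow> 'v" and \<Phi> :: "real \<Rightarrow> 'v \<Rightarrow> 'v"
  assumes T: "is_time T" and flow: "flow_on T V \<Phi>"
    and nm_cont: "continuous_map V euclideanreal nm"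
    and nm_nonneg: "\<And>v. v \<in> topspace V \<Longrightarrow> 0 \<le> nm v"
    and sc_cont: "\<And>a. continuous_map V V (sc a)"
    and nm_sc: "\<And>a v. v \<in> topspace V \<Longrightarrow> nm (sc a v) = \<bar>a\<bar> * nm v"
    and sc_zero: "\<And>v. v \<in> topspace V \<Longrightarrow> nm v = 0 \<Longrightarrow> sc 0 v = v"
    and flow_sc: "\<And>t a v. t \<in> T \<Longrightarrow> v \<in> topspace V \<Longrightarrow> \<Phi> t (sc a v) = sc a (\<Phi> t v)"
    and compact_ball: "compactin V {v \<in> topspace V. nm v \<le> 1}"
begin

lemma sc_in: "v \<in> topspace V \<Longrightarrow> sc a v \<in> topspace V"
  using sc_cont continuous_map_image_subset_topspace by blast

lemmas Phi_in = flow_in[OF flow] and Phi_add = flow_add[OF flow] and Phi_zero = flow_zero[OF flow]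

lemma nm_Phi_nonneg: "t \<in> T \<Longrightarrow> v \<in> topspace V \<Longrightarrow> 0 \<le> nm (\<Phi> t v)"
  by (simp add: Phi_in nm_nonneg)

lemma nm_Phi_cont: "t \<in> T \<Longrightarrow> continuous_map V euclideanreal (\<lambda>v. nm (\<Phi> t v))"
  using continuous_map_compose[OF flow_continuous_map[OF flow] nm_cont] by (simp add: o_def)

lemma Phi_nat_add: "v \<in> topspace V \<Longrightarrow> \<Phi> (real (j + k)) v = \<Phi> (real j) (\<Phi> (real k) v)"
  by (simp add: Phi_add time_of_nat[OF T])

text \<open>For \<open>nm v = 0\<close> the convention \<open>1 / 0 = 0\<close> gives
  \<open>sc 0 v\<close>, so that \<open>nm_Phi_unit\<close> holds without a case
  distinction.\<close>

definition unit :: "'v \<Rightarrow> 'v" where "unit v = sc (1 / nm v) v"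

lemma unit_in: "v \<in> topspace V \<Longrightarrow> unit v \<in> topspace V"
  by (simp add: unit_def sc_in)

lemma nm_Phi_unit: "t \<in> T \<Longrightarrow> v \<in> topspace V \<Longrightarrow> nm (\<Phi> t (unit v)) = nm (\<Phi> t v) / nm v"
  by (simp add: unit_def flow_sc nm_sc Phi_in nm_nonneg)

lemma nm_unit: "v \<in> topspace V \<Longrightarrow> 0 < nm v \<Longrightarrow> nm (unit v) = 1"
  by (simp add: unit_def nm_sc)

text \<open>A vector of norm zero equals its multiple by 0, and the flow carries this to a multiple
  by 0.\<close>

lemma nm_Phi_zero: "t \<in> T \<Longrightarrow> v \<in> topspace V \<Longrightarrow> nm v = 0 \<Longrightarrow> nm (\<Phi> t v) = 0"
  by (metis Phi_in abs_zero flow_sc mult_zero_left nm_sc sc_zero)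

text \<open>The flow is jointly continuous, hence bounded on a compact set of times and the unit
  ball; homogeneity extends the bound to all vectors.\<close>

lemma nm_Phi_bound:
  obtains C where "1 \<le> C" "\<And>t v. t \<in> T \<Longrightarrow> \<bar>t\<bar> \<le> r \<Longrightarrow> v \<in> topspace V \<Longrightarrow> nm (\<Phi> t v) \<le> C * nm v"
proof -
  let ?B = "{v \<in> topspace V. nm v \<le> 1}"
  have "compact (T \<inter> {-r..r})"
    using time_closed[OF T] by (simp add: closed_Int_compact)
  then have "compactin (top_of_set T) (T \<inter> {-r..r})"
    by (simp add: compactin_subtopology)
  then have "compactin (prod_topology (top_of_set T) V) ((T \<inter> {-r..r}) \<times> ?B)"
    using compact_ball by (simp add: compactin_Times)
  moreover have "continuous_map (prod_topology (top_of_set T) V) euclideanreal (nm \<circ> (\<lambda>(t, v). \<Phi> t v))"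
    using flow nm_cont unfolding flow_on_def by (blast intro: continuous_map_compose)
  ultimately have "compactin euclideanreal ((nm \<circ> (\<lambda>(t, v). \<Phi> t v)) ` ((T \<inter> {-r..r}) \<times> ?B))"
    by (rule image_compactin)
  then have "bounded ((nm \<circ> (\<lambda>(t, v). \<Phi> t v)) ` ((T \<inter> {-r..r}) \<times> ?B))"
    by (simp add: compact_imp_bounded)
  then obtain C0 where C0: "\<And>t v. t \<in> T \<Longrightarrow> \<bar>t\<bar> \<le> r \<Longrightarrow> v \<in> ?B \<Longrightarrow> \<bar>nm (\<Phi> t v)\<bar> \<le> C0"
    unfolding bounded_iff by (fastforce simp: abs_le_iff)
  show ?thesis
  proof
    show "1 \<le> max 1 C0" by simp
    fix t v assume *: "t \<in> T" "\<bar>t\<bar> \<le> r" "v \<in> topspace V"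
    show "nm (\<Phi> t v) \<le> max 1 C0 * nm v"
    proof (cases "nm v = 0")
      case True
      then show ?thesis using * nm_Phi_zero by simp
    next
      case False
      then have "0 < nm v" using * nm_nonneg[of v] by linarith
      moreover have "nm (\<Phi> t (unit v)) \<le> C0"
        using C0[of t "unit v"] * \<open>0 < nm v\<close> by (simp add: unit_in nm_unit)
      ultimately have "nm (\<Phi> t v) \<le> C0 * nm v" using * by (simp add: nm_Phi_unit field_simps)
      also have "\<dots> \<le> max 1 C0 * nm v" using \<open>0 < nm v\<close> by (intro mult_right_mono) auto
      finally show ?thesis .
    qed
  qed
qed

lemma compact_sphere: "compactin V {v \<in> topspace V. nm v = 1}"
proof (rule closed_compactin[OF compact_ball])
  have "closedin V {v \<in> topspace V. nm v \<in> {1}}"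
    by (rule closedin_continuous_map_preimage[OF nm_cont]) simp
  then show "closedin V {v \<in> topspace V. nm v = 1}" by simp
qed auto

text \<open>Exceeding 2 is an open condition on a unit vector, so finitely many times serve the
  compact sphere, and homogeneity does the rest. \<open>J\<close> will be the integers under
  isolation and the natural numbers when there is no nonzero forward bounded vector.\<close>

lemma uniform_doubling:
  assumes J: "J \<subseteq> T"
    and dbl: "\<And>v. v \<in> topspace V \<Longrightarrow> nm v = 1 \<Longrightarrow> \<exists>t\<in>J. 2 < nm (\<Phi> t v)"
  obtains n :: nat where "1 \<le> n"
    "\<And>v. v \<in> topspace V \<Longrightarrow> 0 < nm v \<Longrightarrow> \<exists>t\<in>J. \<bar>t\<bar> \<le> real n \<and> 2 * nm v < nm (\<Phi> t v)"
proof -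
  let ?O = "\<lambda>t. {v \<in> topspace V. nm (\<Phi> t v) \<in> {2<..}}"
  have "openin V (?O t)" if "t \<in> J" for t
    by (rule openin_continuous_map_preimage[OF nm_Phi_cont]) (use that J in auto)
  moreover have "{v \<in> topspace V. nm v = 1} \<subseteq> \<Union>(?O ` J)"
  proof
    fix v assume "v \<in> {v \<in> topspace V. nm v = 1}"
    then show "v \<in> \<Union>(?O ` J)" using dbl[of v] by auto
  qed
  ultimately have "\<exists>\<F>. finite \<F> \<and> \<F> \<subseteq> ?O ` J \<and> {v \<in> topspace V. nm v = 1} \<subseteq> \<Union>\<F>"
    by (intro compactinD[OF compact_sphere]) blast+
  then obtain \<F> where \<F>: "finite \<F>" "\<F> \<subseteq> ?O ` J" "{v \<in> topspace V. nm v = 1} \<subseteq> \<Union>\<F>" by blast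
  obtain F where "F \<subseteq> J" "finite F" "\<F> = ?O ` F"
    using finite_subset_image[OF \<F>(1,2)] by blast
  with \<F>(3) have F: "finite F" "F \<subseteq> J" "{v \<in> topspace V. nm v = 1} \<subseteq> (\<Union>t\<in>F. ?O t)" by simp_all
  obtain n :: nat where n: "\<And>t. t \<in> F \<Longrightarrow> \<bar>t\<bar> \<le> n"
  proof -
    have "finite (abs ` F)" using F by simp
    then obtain m where "\<And>t. t \<in> F \<Longrightarrow> \<bar>t\<bar> \<le> m"
      using bdd_above.unfold[of "abs ` F"] bdd_above_finite by (metis imageI)
    moreover obtain n :: nat where "m \<le> real n" using real_arch_simple by blast
    ultimately have "\<And>t. t \<in> F \<Longrightarrow> \<bar>t\<bar> \<le> real n" by force
    then show thesis using that by blast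
  qed
  \<comment> \<open>\<open>Suc n\<close> secures \<open>1 \<le> n\<close>, so that a bound for times
    up to \<open>n\<close> also covers fractions of a time unit.\<close>
  show thesis
  proof (rule that[of "Suc n"])
    fix v assume v: "v \<in> topspace V" "0 < nm v"
    then have "unit v \<in> (\<Union>t\<in>F. ?O t)"
      using F(3) unit_in nm_unit by blast
    then obtain t where t: "t \<in> F" "2 < nm (\<Phi> t (unit v))" by auto
    moreover have "t \<in> T" using t F J by blast
    ultimately show "\<exists>t\<in>J. \<bar>t\<bar> \<le> real (Suc n) \<and> 2 * nm v < nm (\<Phi> t v)"
      using v F(2) n[of t] by (intro bexI[of _ t]) (auto simp: nm_Phi_unit field_simps)
  qed simp
qed

text \<open>Natural times suffice, since \<open>nm_Phi_bound\<close> controls what happens in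
  between.\<close>

definition forward_bounded :: "'v \<Rightarrow> bool" where
  "forward_bounded v \<longleftrightarrow> v \<in> topspace V \<and> (\<exists>R. \<forall>k. nm (\<Phi> (real k) v) \<le> R)"

text \<open>A unit vector whose norms at natural times never exceed 2 would be forward bounded. So
  all doublings happen in the future, and \<open>doubling_growth\<close> applies to the orbit that
  starts at \<open>\<Phi> (- t) v\<close> and ends near \<open>v\<close>.\<close>

lemma backward_contraction:
  assumes "\<And>v. forward_bounded v \<Longrightarrow> nm v = 0"
  obtains C :: real and n :: nat where "1 \<le> C" "1 \<le> n"
    "\<And>t m v. t \<in> T \<Longrightarrow> real (m * n) \<le> t \<Longrightarrow> v \<in> topspace V \<Longrightarrow> 2 ^ m * nm (\<Phi> (- t) v) \<le> C * nm v"
proof -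
  have "\<exists>t\<in>range real. 2 < nm (\<Phi> t v)" if "v \<in> topspace V" "nm v = 1" for v
  proof (rule ccontr)
    assume "\<not> ?thesis"
    then have "forward_bounded v"
      unfolding forward_bounded_def using that by (intro conjI exI[of _ 2] allI) (simp, metis not_less rangeI)
    then show False using assms[of v] that by simp
  qed
  then obtain n where n: "1 \<le> n"
    "\<And>v. v \<in> topspace V \<Longrightarrow> 0 < nm v \<Longrightarrow> \<exists>t\<in>range real. \<bar>t\<bar> \<le> real n \<and> 2 * nm v < nm (\<Phi> t v)"
    using uniform_doubling[of "range real"] time_of_nat[OF T] by blast
  obtain C where C: "1 \<le> C"
    "\<And>t v. t \<in> T \<Longrightarrow> \<bar>t\<bar> \<le> real n \<Longrightarrow> v \<in> topspace V \<Longrightarrow> nm (\<Phi> t v) \<le> C * nm v"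
    using nm_Phi_bound by blast
  have int: "2 ^ m * nm v \<le> C * nm (\<Phi> (real k) v)" if v: "v \<in> topspace V" and k: "m * n \<le> k" for v m k
  proof -
    define f where "f k = nm (\<Phi> (real k) v)" for k
    have "2 ^ m * f 0 \<le> C * f k"
    proof (rule doubling_growth[where n = n])
      show "0 \<le> f k" for k by (simp add: f_def nm_Phi_nonneg time_of_nat[OF T] v)
      show "1 \<le> C" "m * n \<le> k - 0" "0 \<le> k" using C k by auto
      show "\<exists>j>k. j \<le> k + n \<and> 2 * f k < f j" if pos: "0 < f k" for k
      proof -
        obtain i where i: "i \<le> n" "2 * f k < nm (\<Phi> (real i) (\<Phi> (real k) v))"
          using n(2)[of "\<Phi> (real k) v"] pos v Phi_in[OF time_of_nat[OF T]] by (auto simp: f_def)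
        then have "2 * f k < f (i + k)" using v by (simp only: f_def Phi_nat_add)
        moreover have "i \<noteq> 0" using calculation pos by (cases i) auto
        ultimately show ?thesis using i by (intro exI[of _ "i + k"]) auto
      qed
      show "f i \<le> C * f j" if "i \<le> j" "j \<le> i + n" for i j
      proof -
        have "nm (\<Phi> (real i - real j) (\<Phi> (real j) v)) \<le> C * nm (\<Phi> (real j) v)"
          using that v by (intro C) (auto simp: Phi_in time_diff time_of_nat T)
        moreover have "\<Phi> (real i - real j) (\<Phi> (real j) v) = \<Phi> (real i) v"
          using Phi_add[of "real i - real j" "real j" v] v by (simp add: time_diff time_of_nat T)
        ultimately show ?thesis by (simp add: f_def)
      qed
    qed
    then show ?thesis by (simp add: f_def Phi_zero v)
  qed
  \<comment> \<open>One factor \<open>C\<close> comes from \<open>doubling_growth\<close>; the other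
    covers the time \<open>real k - t\<close>, shorter than one unit and so in the range of the
    bound because \<open>1 \<le> n\<close>.\<close>
  show thesis
  proof (rule that[of "C * C" n])
    have "1 * 1 \<le> C * C" using C(1) by (intro mult_mono) auto
    then show "1 \<le> C * C" by simp
    show "1 \<le> n" by fact
    fix t m v assume t: "t \<in> T" "real (m * n) \<le> t" and v: "v \<in> topspace V"
    define k where "k = nat \<lfloor>t\<rfloor>"
    have t0: "0 \<le> t" using t(2) of_nat_0_le_iff[of "m * n"] by linarith
    have k: "m * n \<le> k" "real k \<le> t" "t - real k < 1"
      using t t0 unfolding k_def by (auto simp: le_nat_iff le_floor_iff) linarith
    have w: "\<Phi> (- t) v \<in> topspace V" using v t by (simp add: Phi_in time_uminus T)
    have "2 ^ m * nm (\<Phi> (- t) v) \<le> C * nm (\<Phi> (real k) (\<Phi> (- t) v))"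
      using int[OF w k(1)] .
    also have "\<Phi> (real k) (\<Phi> (- t) v) = \<Phi> (real k - t) v"
      using Phi_add[of "real k" "- t" v] v t by (simp add: time_uminus time_of_nat T)
    also have "nm (\<Phi> (real k - t) v) \<le> C * nm v"
      using k n(1) t v by (intro C) (auto simp: time_diff time_of_nat T)
    finally show "2 ^ m * nm (\<Phi> (- t) v) \<le> C * C * nm v"
      using C(1) by (simp add: mult.assoc)
  qed
qed

end

section \<open>Exact growth rates\<close>

(* The rate is the least uniform upper bound of the asymptotic growth. Restarting a fast growing orbit
   at the minimum of a k v - r k gives long orbit pieces on which the growth from the start never falls
   below r, and compactness an infinite one. *)
lemma exact_growth_rate:
  fixes a :: "nat \<Rightarrow> 'v \<Rightarrow> real"
  assumes K: "compactin V K" "K \<noteq> {}"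
    and closed: "\<And>k c. closedin V {v \<in> K. c \<le> a k v}"
    and S: "\<And>k v. v \<in> K \<Longrightarrow> S k v \<in> K"
    and cocycle: "\<And>j k v. v \<in> K \<Longrightarrow> a (j + k) v = a j (S k v) + a k v"
    and zero: "\<And>v. v \<in> K \<Longrightarrow> a 0 v = 0"
    and step: "\<And>v. v \<in> K \<Longrightarrow> \<bar>a 1 v\<bar> \<le> L"
  obtains v \<beta> where "v \<in> K" "(\<lambda>k. a k v / real k) \<longlonglongrightarrow> \<beta>"
proof -
  have aL: "\<bar>a k v\<bar> \<le> L * real k" if "v \<in> K" for k v
  proof (induction k)
    case 0
    then show ?case using zero that by simp
  next
    case (Suc k)
    have "a (1 + k) v = a 1 (S k v) + a k v" using cocycle that by blast
    moreover have "\<bar>a 1 (S k v)\<bar> \<le> L" using step S that by blast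
    ultimately show ?case using Suc by (simp add: algebra_simps)
  qed
  obtain v0 where "v0 \<in> K" using K by blast
  then have "0 \<le> L" using step[of v0] by linarith
  \<comment> \<open>\<open>R\<close> holds the rates that eventually bound the growth uniformly on
    \<open>K\<close>. Its infimum bounds every vector from above, so it remains to find one that
    meets it from below.\<close>
  define R where "R = {r. \<exists>n. \<forall>v\<in>K. \<forall>k\<ge>n. a k v \<le> r * real k}"
  define \<beta> where "\<beta> = Inf R"
  have "L \<in> R" unfolding R_def using aL by (auto simp: abs_le_iff)
  have R_lower: "- L \<le> r" if r: "r \<in> R" for r
  proof -
    obtain n where "\<forall>k\<ge>n. a k v0 \<le> r * real k"
      using r \<open>v0 \<in> K\<close> unfolding R_def by blast
    then have "a (Suc n) v0 \<le> r * real (Suc n)" by (auto simp del: of_nat_Suc)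
    moreover have "- (L * real (Suc n)) \<le> a (Suc n) v0" using aL[OF \<open>v0 \<in> K\<close>, of "Suc n"] by linarith
    ultimately have "(- L) * real (Suc n) \<le> r * real (Suc n)" by simp
    then show ?thesis by (rule mult_right_le_imp_le) simp
  qed
  then have bdd: "bdd_below R" by (auto simp: bdd_below_def)
  have nonempty: "\<exists>w\<in>K. \<forall>j\<le>n. real j * r \<le> a j w" if "r < \<beta>" for r and n :: nat
  proof -
    \<comment> \<open>\<open>r'\<close> is still below the infimum, hence exceeded at arbitrarily
      late times; its distance from \<open>r\<close> forces a long climb.\<close>
    define r' where "r' = (r + \<beta>) / 2"
    have r': "r < r'" "r' < \<beta>" using that by (auto simp: r'_def)
    then have "r' \<notin> R" using cInf_lower[OF _ bdd, of r'] by (auto simp: \<beta>_def)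
    \<comment> \<open>One step raises \<open>b\<close>, defined below, by at most
      \<open>L + \<bar>r\<bar>\<close>, so a rise by \<open>m * (r' - r)\<close> takes more than
      \<open>n\<close> steps.\<close>
    obtain m :: nat where m: "(L + \<bar>r\<bar>) * real n < real m * (r' - r)"
      using r' reals_Archimedean3[of "r' - r"] by auto
    have "\<exists>v\<in>K. \<exists>k\<ge>m. r' * real k < a k v"
      using \<open>r' \<notin> R\<close> unfolding R_def by (auto simp: not_le)
    then obtain v k where v: "v \<in> K" "m \<le> k" "r' * real k < a k v" by blast
    define b where "b j = a j v - r * real j" for j
    obtain k0 where k0: "k0 \<le> k" "\<And>j. j \<le> k \<Longrightarrow> b k0 \<le> b j"
      using ex_min_if_finite[of "b ` {..k}"] by (auto simp: not_less)
    have "b k0 \<le> 0" using k0(2)[of 0] zero[OF v(1)] by (simp add: b_def)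
    have long: "n \<le> k - k0"
    proof (rule ccontr)
      assume "\<not> n \<le> k - k0"
      have "a k v = a (k - k0) (S k0 v) + a k0 v"
        using cocycle[OF v(1), of "k - k0" k0] k0(1) by simp
      then have "b k = a (k - k0) (S k0 v) - r * real (k - k0) + b k0"
        using k0(1) by (simp add: b_def of_nat_diff algebra_simps)
      also have "\<dots> \<le> (L + \<bar>r\<bar>) * real (k - k0)"
        using abs_le_D1[OF aL[OF S[OF v(1)], of "k - k0" k0]] \<open>b k0 \<le> 0\<close>
          mult_right_mono[OF abs_ge_minus_self[of r], of "real (k - k0)"]
        unfolding distrib_right by linarith
      also have "\<dots> \<le> (L + \<bar>r\<bar>) * real n"
        using \<open>\<not> n \<le> k - k0\<close> \<open>0 \<le> L\<close> by (intro mult_left_mono) auto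
      finally have upper: "b k \<le> (L + \<bar>r\<bar>) * real n" .
      note m
      also have "real m * (r' - r) \<le> real k * (r' - r)" using v(2) r' by (intro mult_right_mono) auto
      also have "\<dots> < b k" using v(3) by (simp add: b_def algebra_simps)
      finally show False using upper by simp
    qed
    have "real j * r \<le> a j (S k0 v)" if "j \<le> n" for j
    proof -
      have "b k0 \<le> b (j + k0)" using k0 long that by (intro k0(2)) linarith
      moreover have "a (j + k0) v = a j (S k0 v) + a k0 v" using cocycle v(1) by blast
      ultimately show ?thesis by (simp add: b_def algebra_simps)
    qed
    then show ?thesis using S v(1) by blast
  qed
  \<comment> \<open>Horizon and slack share one index, which makes the sets nested; a common point
    satisfies every lower bound in the limit. Only lower bounds are imposed, matching the closed
    sets in \<open>closed\<close>.\<close>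
  define E where "E n = {v \<in> K. \<forall>j\<le>n. real j * (\<beta> - 1 / real (Suc n)) \<le> a j v}" for n
  have "(\<Inter>n. E n) \<noteq> {}"
  proof (rule compact_space_imp_nest)
    show "compact_space (subtopology V K)" using K(1) compact_space_subtopology by blast
    show "closedin (subtopology V K) (E n)" for n
    proof (rule closedin_subset_topspace)
      have "E n = (\<Inter>j\<in>{..n}. {v \<in> K. real j * (\<beta> - 1 / real (Suc n)) \<le> a j v})"
        by (auto simp: E_def)
      then show "closedin V (E n)" by (simp only:) (intro closedin_INT closed, auto)
    qed (auto simp: E_def)
    show "E n \<noteq> {}" for n using nonempty[of "\<beta> - 1 / real (Suc n)" n] by (auto simp: E_def)
    show "decseq E"
      unfolding decseq_def
    proof (intro allI impI subsetI)
      fix m n v assume "m \<le> n" "v \<in> E n"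
      moreover have "real j * (\<beta> - 1 / real (Suc m)) \<le> real j * (\<beta> - 1 / real (Suc n))" for j
        using \<open>m \<le> n\<close> by (intro mult_left_mono diff_left_mono divide_left_mono) auto
      ultimately show "v \<in> E m" unfolding E_def by (auto intro: order_trans)
    qed
  qed
  then obtain v where v: "\<And>n. v \<in> E n" by blast
  then have "v \<in> K" by (auto simp: E_def)
  have lower: "real j * \<beta> \<le> a j v" for j
  proof (rule LIMSEQ_le_const2)
    have "(\<lambda>n. real j * (\<beta> - 1 / real (Suc n))) \<longlonglongrightarrow> real j * (\<beta> - 0)"
      by (intro tendsto_intros) (use LIMSEQ_inverse_real_of_nat in \<open>simp add: inverse_eq_divide\<close>)
    then show "(\<lambda>n. real j * (\<beta> - 1 / real (Suc n))) \<longlonglongrightarrow> real j * \<beta>" by simp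
    show "\<exists>N. \<forall>n\<ge>N. real j * (\<beta> - 1 / real (Suc n)) \<le> a j v"
      using v by (auto simp: E_def)
  qed
  have "(\<lambda>k. a k v / real k) \<longlonglongrightarrow> \<beta>"
  proof (rule LIMSEQ_I)
    fix e :: real assume "0 < e"
    then have "Inf R < \<beta> + e" by (simp add: \<beta>_def)
    then obtain r where r: "r \<in> R" "r < \<beta> + e"
      using cInf_less_iff[OF _ bdd] \<open>L \<in> R\<close> by blast
    then obtain n where n: "\<forall>k\<ge>n. a k v \<le> r * real k"
      using \<open>v \<in> K\<close> unfolding R_def by blast
    show "\<exists>n0. \<forall>k\<ge>n0. norm (a k v / real k - \<beta>) < e"
    proof (intro exI allI impI)
      fix k assume "k \<ge> Suc n"
      then have "\<beta> \<le> a k v / real k" "a k v / real k \<le> r"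
        using lower[of k] n by (auto simp: field_simps)
      then show "norm (a k v / real k - \<beta>) < e" using r by auto
    qed
  qed
  with \<open>v \<in> K\<close> that show thesis by blast
qed

section \<open>Forward bounded vectors: uniform decay and an exact exponent\<close>

context cone_flow
begin

lemma nm_Phi_pos: "t \<in> T \<Longrightarrow> v \<in> topspace V \<Longrightarrow> 0 < nm (\<Phi> t v) \<longleftrightarrow> 0 < nm v"
  by (metis Phi_in T flow flow_inverse(1) nm_Phi_zero nm_nonneg order_le_less time_uminus)

lemma forward_bounded_Phi: "forward_bounded v \<Longrightarrow> forward_bounded (\<Phi> (real k) v)"
  unfolding forward_bounded_def by (metis Phi_in Phi_nat_add T time_of_nat)

lemma forward_bounded_unit: "forward_bounded v \<Longrightarrow> forward_bounded (unit v)"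
  unfolding forward_bounded_def
proof (elim conjE exE, intro conjI)
  fix R assume "v \<in> topspace V" "\<forall>k. nm (\<Phi> (real k) v) \<le> R"
  then show "unit v \<in> topspace V" "\<exists>R. \<forall>k. nm (\<Phi> (real k) (unit v)) \<le> R"
    by (auto simp: nm_Phi_unit unit_in time_of_nat[OF T] nm_nonneg intro!: divide_right_mono exI[of _ "R / nm v"])
qed

text \<open>Isolation gives doubling within \<open>n\<close> steps in one of the two time
  directions, and \<open>doubling_decay\<close> does not ask in which. The constants no longer
  depend on the bound of the particular orbit.\<close>

lemma forward_bounded_decay:
  assumes isolated: "\<And>v. v \<in> topspace V \<Longrightarrow> (\<exists>R. \<forall>k::int. nm (\<Phi> (real_of_int k) v) \<le> R) \<Longrightarrow> nm v = 0"
  obtains C :: real and n :: nat where "1 \<le> C" "1 \<le> n"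
    "\<And>v k m. forward_bounded v \<Longrightarrow> m * n \<le> k \<Longrightarrow> nm (\<Phi> (real k) v) \<le> C * nm v / 2 ^ m"
proof -
  have "\<exists>t\<in>range real_of_int. 2 < nm (\<Phi> t v)" if "v \<in> topspace V" "nm v = 1" for v
  proof (rule ccontr)
    assume "\<not> ?thesis"
    then have "\<forall>k::int. nm (\<Phi> (real_of_int k) v) \<le> 2" by (meson not_less rangeI)
    then show False using isolated[of v] that by auto
  qed
  then obtain n where n: "1 \<le> n"
    "\<And>v. v \<in> topspace V \<Longrightarrow> 0 < nm v \<Longrightarrow> \<exists>t\<in>range real_of_int. \<bar>t\<bar> \<le> real n \<and> 2 * nm v < nm (\<Phi> t v)"
    using uniform_doubling[of "range real_of_int"] time_of_int[OF T] by blast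
  obtain C where C: "1 \<le> C"
    "\<And>t v. t \<in> T \<Longrightarrow> \<bar>t\<bar> \<le> real n \<Longrightarrow> v \<in> topspace V \<Longrightarrow> nm (\<Phi> t v) \<le> C * nm v"
    using nm_Phi_bound by blast
  have "nm (\<Phi> (real k) v) \<le> C * nm v / 2 ^ m" if fb: "forward_bounded v" and k: "m * n \<le> k" for v k m
  proof -
    obtain R where R: "\<And>k. nm (\<Phi> (real k) v) \<le> R" and v: "v \<in> topspace V"
      using fb unfolding forward_bounded_def by blast
    show ?thesis
    proof (rule doubling_decay[where R = R and n = n and f = "\<lambda>k. nm (\<Phi> (real k) v)", OF _ R _ _ k])
      show "0 \<le> nm (\<Phi> (real k) v)" for k by (simp add: nm_Phi_nonneg time_of_nat[OF T] v)
      show "nm (\<Phi> (real k) v) \<le> C * nm v" if "k \<le> n" for k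
        using that v by (intro C) (auto simp: time_of_nat[OF T])
      show "\<exists>j. k \<le> j + n \<and> 2 * nm (\<Phi> (real k) v) < nm (\<Phi> (real j) v)"
        if k: "n \<le> k" "0 < nm (\<Phi> (real k) v)" for k
      proof -
        have w: "\<Phi> (real k) v \<in> topspace V" using v by (simp add: Phi_in time_of_nat[OF T])
        obtain i :: int where "\<bar>real_of_int i\<bar> \<le> real n" and i:
          "2 * nm (\<Phi> (real k) v) < nm (\<Phi> (real_of_int i) (\<Phi> (real k) v))"
          using n(2)[OF w k(2)] by blast
        then have i: "\<bar>i\<bar> \<le> int n"
          "2 * nm (\<Phi> (real k) v) < nm (\<Phi> (real_of_int i) (\<Phi> (real k) v))"
          by linarith+
        \<comment> \<open>\<open>n \<le> k\<close> keeps the time \<open>k + i\<close> nonnegative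
          even when the doubling lies in the past.\<close>
        have "real_of_int i + real k = real (nat (int k + i))" using i(1) k(1) by auto
        moreover have "\<Phi> (real_of_int i) (\<Phi> (real k) v) = \<Phi> (real_of_int i + real k) v"
          by (simp add: Phi_add time_of_int time_of_nat T v)
        ultimately show ?thesis using i k(1) by (intro exI[of _ "nat (int k + i)"]) (auto simp: add.commute)
      qed
    qed
  qed
  with C(1) n(1) that show thesis by blast
qed

text \<open>Rounding down moves the time by less than one unit, so the factor from
  \<open>nm_Phi_bound\<close> works in both directions. This reduces real times to natural
  ones.\<close>

lemma nm_Phi_floor:
  obtains C where "1 \<le> C"
    "\<And>t v. t \<in> T \<Longrightarrow> 0 \<le> t \<Longrightarrow> v \<in> topspace V \<Longrightarrow> nm (\<Phi> t v) \<le> C * nm (\<Phi> (real (nat \<lfloor>t\<rfloor>)) v)"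
    "\<And>t v. t \<in> T \<Longrightarrow> 0 \<le> t \<Longrightarrow> v \<in> topspace V \<Longrightarrow> nm (\<Phi> (real (nat \<lfloor>t\<rfloor>)) v) \<le> C * nm (\<Phi> t v)"
proof -
  obtain C where C: "1 \<le> C"
    "\<And>t v. t \<in> T \<Longrightarrow> \<bar>t\<bar> \<le> 1 \<Longrightarrow> v \<in> topspace V \<Longrightarrow> nm (\<Phi> t v) \<le> C * nm v"
    using nm_Phi_bound by blast
  have *: "nm (\<Phi> t v) \<le> C * nm (\<Phi> s v)" if "s \<in> T" "t \<in> T" "\<bar>t - s\<bar> \<le> 1" "v \<in> topspace V" for s t v
  proof -
    have "\<Phi> t v = \<Phi> (t - s) (\<Phi> s v)" using Phi_add[of "t - s" s v] that by (simp add: time_diff[OF T])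
    then show ?thesis using C(2)[of "t - s" "\<Phi> s v"] that by (simp add: time_diff[OF T] Phi_in)
  qed
  have "\<bar>t - real (nat \<lfloor>t\<rfloor>)\<bar> \<le> 1" if "0 \<le> t" for t using that by auto linarith
  then have "\<bar>real (nat \<lfloor>t\<rfloor>) - t\<bar> \<le> 1" "\<bar>t - real (nat \<lfloor>t\<rfloor>)\<bar> \<le> 1" if "0 \<le> t" for t
    using that by (simp_all add: abs_minus_commute)
  then show thesis
    using that[OF C(1)] * time_of_nat[OF T] by blast
qed

text \<open>Yields membership in the null stable set once small norms are known to mean closeness to
  the null section.\<close>

lemma forward_bounded_tendsto:
  assumes isolated: "\<And>v. v \<in> topspace V \<Longrightarrow> (\<exists>R. \<forall>k::int. nm (\<Phi> (real_of_int k) v) \<le> R) \<Longrightarrow> nm v = 0"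
    and v: "forward_bounded v" and "0 < e"
  shows "\<forall>\<^sub>F t in at_top_in T. nm (\<Phi> t v) < e"
proof -
  obtain C n where C: "1 \<le> C" "1 \<le> n"
    "\<And>v k m. forward_bounded v \<Longrightarrow> m * n \<le> k \<Longrightarrow> nm (\<Phi> (real k) v) \<le> C * nm v / 2 ^ m"
    using forward_bounded_decay[OF isolated] by blast
  obtain D where D: "1 \<le> D"
    "\<And>t v. t \<in> T \<Longrightarrow> 0 \<le> t \<Longrightarrow> v \<in> topspace V \<Longrightarrow> nm (\<Phi> t v) \<le> D * nm (\<Phi> (real (nat \<lfloor>t\<rfloor>)) v)"
    "\<And>t v. t \<in> T \<Longrightarrow> 0 \<le> t \<Longrightarrow> v \<in> topspace V \<Longrightarrow> nm (\<Phi> (real (nat \<lfloor>t\<rfloor>)) v) \<le> D * nm (\<Phi> t v)"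
    by (rule nm_Phi_floor, rule that)
  have vV: "v \<in> topspace V" using v by (simp add: forward_bounded_def)
  have "(\<lambda>m. D * C * nm v * (1/2) ^ m) \<longlonglongrightarrow> D * C * nm v * 0"
    by (intro tendsto_intros) auto
  then have "\<forall>\<^sub>F m in sequentially. D * C * nm v * (1/2) ^ m < e"
    using \<open>0 < e\<close> by (intro order_tendstoD(2)) auto
  then obtain m where m: "D * C * nm v * (1/2) ^ m < e"
    by (auto simp: eventually_sequentially)
  show ?thesis
    unfolding eventually_at_top_in
  proof (intro exI ballI impI)
    fix t assume t: "t \<in> T" "real (m * n) \<le> t"
    have t0: "0 \<le> t" using t(2) of_nat_0_le_iff[of "m * n"] by linarith
    have "m * n \<le> nat \<lfloor>t\<rfloor>" using t t0 by (auto simp: le_nat_iff le_floor_iff)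
    then have "nm (\<Phi> (real (nat \<lfloor>t\<rfloor>)) v) \<le> C * nm v / 2 ^ m" using C(3) v by blast
    then have "D * nm (\<Phi> (real (nat \<lfloor>t\<rfloor>)) v) \<le> D * (C * nm v / 2 ^ m)"
      using D(1) by (intro mult_left_mono) auto
    moreover have "D * (C * nm v / 2 ^ m) = D * C * nm v * (1/2) ^ m"
      by (simp add: power_one_over)
    ultimately show "nm (\<Phi> t v) < e"
      using D(2)[OF t(1) t0 vV] m by linarith
  qed
qed

lemma exponent_exists:
  assumes isolated: "\<And>v. v \<in> topspace V \<Longrightarrow> (\<exists>R. \<forall>k::int. nm (\<Phi> (real_of_int k) v) \<le> R) \<Longrightarrow> nm v = 0"
    and v0: "forward_bounded v0" "nm v0 \<noteq> 0"
  obtains v \<beta> where "forward_bounded v" "0 < nm v" "((\<lambda>t. ln (nm (\<Phi> t v)) / t) \<longlongrightarrow> \<beta>) (at_top_in T)"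
proof -
  define K where "K = {v \<in> topspace V. nm v = 1 \<and> forward_bounded v}"
  have fb_in: "forward_bounded v \<Longrightarrow> v \<in> topspace V" for v by (simp add: forward_bounded_def)
  obtain C n where C: "1 \<le> C" "1 \<le> n"
    "\<And>v k m. forward_bounded v \<Longrightarrow> m * n \<le> k \<Longrightarrow> nm (\<Phi> (real k) v) \<le> C * nm v / 2 ^ m"
    using forward_bounded_decay[OF isolated] by blast
  \<comment> \<open>Forward boundedness leaves its bound open and is not visibly a closed condition.
    The decay estimate with \<open>m = 0\<close> replaces it by one constant for all unit
    vectors.\<close>
  have fb: "forward_bounded v \<longleftrightarrow> (\<forall>k. nm (\<Phi> (real k) v) \<le> C)" if "v \<in> topspace V" "nm v = 1" for v
    using C(3)[of v 0] that by (auto simp: forward_bounded_def)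
  have closedK: "closedin V K"
  proof -
    have "K = {v \<in> topspace V. nm v \<in> {1}} \<inter> (\<Inter>k::nat. {v \<in> topspace V. nm (\<Phi> (real k) v) \<in> {..C}})"
      using fb by (auto simp: K_def)
    moreover have "closedin V {v \<in> topspace V. nm v \<in> {1}}"
      by (rule closedin_continuous_map_preimage[OF nm_cont]) simp
    moreover have "closedin V {v \<in> topspace V. nm (\<Phi> (real k) v) \<in> {..C}}" for k :: nat
      by (rule closedin_continuous_map_preimage[OF nm_Phi_cont[OF time_of_nat[OF T]]]) simp
    ultimately show ?thesis by (simp only:) (intro closedin_Int closedin_INT, auto)
  qed
  have compactK: "compactin V K"
    by (rule closed_compactin[OF compact_sphere _ closedK]) (auto simp: K_def)
  have "v0 \<in> topspace V" "0 < nm v0" using v0 fb_in nm_nonneg[of v0] by auto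
  then have "unit v0 \<in> K"
    using v0 by (simp add: K_def unit_in nm_unit forward_bounded_unit)
  have KD: "v \<in> topspace V" "nm v = 1" "forward_bounded v" if "v \<in> K" for v
    using that by (auto simp: K_def)
  have pos: "0 < nm (\<Phi> t v)" if "v \<in> K" "t \<in> T" for t v
    using nm_Phi_pos KD that by simp
  obtain L where L: "1 \<le> L"
    "\<And>t v. t \<in> T \<Longrightarrow> \<bar>t\<bar> \<le> 1 \<Longrightarrow> v \<in> topspace V \<Longrightarrow> nm (\<Phi> t v) \<le> L * nm v"
    using nm_Phi_bound by blast
  \<comment> \<open>The logarithm of the norm is an additive cocycle over the normalised time maps,
    which preserve \<open>K\<close>.\<close>
  obtain v \<beta> where v: "v \<in> K" and lim: "(\<lambda>k. ln (nm (\<Phi> (real k) v)) / real k) \<longlonglongrightarrow> \<beta>"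
  proof (rule exact_growth_rate[where K = K and V = V and L = "ln L" and S = "\<lambda>k v. unit (\<Phi> (real k) v)"
        and a = "\<lambda>k v. ln (nm (\<Phi> (real k) v))"])
    show "compactin V K" by fact
    show "K \<noteq> {}" using \<open>unit v0 \<in> K\<close> by blast
    show "closedin V {v \<in> K. c \<le> ln (nm (\<Phi> (real k) v))}" for k c
    proof -
      have "{v \<in> K. c \<le> ln (nm (\<Phi> (real k) v))} = K \<inter> {v \<in> topspace V. nm (\<Phi> (real k) v) \<in> {exp c..}}"
        using pos[OF _ time_of_nat[OF T]] KD by (auto simp: ln_ge_iff)
      moreover have "closedin V {v \<in> topspace V. nm (\<Phi> (real k) v) \<in> {exp c..}}"
        by (rule closedin_continuous_map_preimage[OF nm_Phi_cont[OF time_of_nat[OF T]]]) simp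
      ultimately show ?thesis using closedK by (simp only: closedin_Int)
    qed
    show "unit (\<Phi> (real k) v) \<in> K" if "v \<in> K" for k v
      using pos[OF that time_of_nat[OF T]] KD[OF that] forward_bounded_Phi[of v k]
      by (simp add: K_def unit_in nm_unit forward_bounded_unit fb_in)
    show "ln (nm (\<Phi> (real (j + k)) v)) = ln (nm (\<Phi> (real j) (unit (\<Phi> (real k) v)))) + ln (nm (\<Phi> (real k) v))"
      if "v \<in> K" for j k v
    proof -
      note p = pos[OF that time_of_nat[OF T]] and i = KD(1)[OF that]
      have "nm (\<Phi> (real j) (unit (\<Phi> (real k) v))) = nm (\<Phi> (real (j + k)) v) / nm (\<Phi> (real k) v)"
        using i by (simp only: nm_Phi_unit Phi_in time_of_nat[OF T] Phi_nat_add)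
      then show ?thesis using p[of "j + k"] p[of k] by (simp add: ln_div)
    qed
    show "ln (nm (\<Phi> (real 0) v)) = 0" if "v \<in> K" for v
      using KD[OF that] by (simp add: Phi_zero)
    show "\<bar>ln (nm (\<Phi> (real 1) v))\<bar> \<le> ln L" if "v \<in> K" for v
    proof -
      have 1: "(1::real) \<in> T" using time_of_nat[OF T, of 1] by simp
      note p = pos[OF that 1] and i = KD[OF that]
      have "nm (\<Phi> 1 v) \<le> L" using L(2)[OF 1 _ i(1)] i by simp
      \<comment> \<open>The norm cannot collapse in one step either, since flowing back by time 1
        costs at most the factor \<open>L\<close>.\<close>
      moreover have "nm (\<Phi> (- 1) (\<Phi> 1 v)) \<le> L * nm (\<Phi> 1 v)"
        using i 1 by (intro L(2)) (auto simp: time_uminus[OF T] Phi_in)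
      then have "1 \<le> L * nm (\<Phi> 1 v)" using flow_inverse[OF flow T 1 i(1)] i by simp
      then have "ln 1 \<le> ln (L * nm (\<Phi> 1 v))" using p by (subst ln_le_cancel_iff) auto
      then have "0 \<le> ln L + ln (nm (\<Phi> 1 v))" using p L(1) by (simp add: ln_mult)
      moreover have "ln (nm (\<Phi> 1 v)) \<le> ln L" using calculation(1) p L(1) by simp
      ultimately show ?thesis by simp
    qed
  qed
  obtain D where D: "1 \<le> D"
    "\<And>t v. t \<in> T \<Longrightarrow> 0 \<le> t \<Longrightarrow> v \<in> topspace V \<Longrightarrow> nm (\<Phi> t v) \<le> D * nm (\<Phi> (real (nat \<lfloor>t\<rfloor>)) v)"
    "\<And>t v. t \<in> T \<Longrightarrow> 0 \<le> t \<Longrightarrow> v \<in> topspace V \<Longrightarrow> nm (\<Phi> (real (nat \<lfloor>t\<rfloor>)) v) \<le> D * nm (\<Phi> t v)"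
    by (rule nm_Phi_floor, rule that)
  define k where "k t = nat \<lfloor>t\<rfloor>" for t :: real
  have top: "at_top_in T \<le> at_top" by (simp add: at_top_in_def)
  have k_lim: "filterlim k sequentially at_top"
    unfolding k_def by (rule filterlim_nat_sequentially[THEN filterlim_compose]) (rule filterlim_floor_sequentially)
  have "((\<lambda>t. real (k t) / t) \<longlongrightarrow> 1) at_top"
  proof (rule tendsto_sandwich)
    show "\<forall>\<^sub>F t in at_top. 1 - 1 / t \<le> real (k t) / t"
      using eventually_gt_at_top[of 0]
    proof eventually_elim
      case (elim t)
      then have "t - 1 \<le> real (k t)" unfolding k_def by linarith
      then have "(t - 1) / t \<le> real (k t) / t" using elim by (intro divide_right_mono) auto
      then show ?case using elim by (simp add: diff_divide_distrib)
    qed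
    show "\<forall>\<^sub>F t in at_top. real (k t) / t \<le> 1"
      using eventually_gt_at_top[of 0] by eventually_elim (auto simp: k_def)
    have "((\<lambda>t::real. 1 - inverse t) \<longlongrightarrow> 1 - 0) at_top"
      by (intro tendsto_intros tendsto_inverse_0_at_top filterlim_ident)
    then show "((\<lambda>t::real. 1 - 1 / t) \<longlongrightarrow> 1) at_top" by (simp add: inverse_eq_divide)
  qed auto
  with filterlim_compose[OF lim k_lim]
  have "((\<lambda>t. ln (nm (\<Phi> (real (k t)) v)) / real (k t) * (real (k t) / t)) \<longlongrightarrow> \<beta> * 1) at_top"
    by (rule tendsto_mult)
  then have 1: "((\<lambda>t. ln (nm (\<Phi> (real (k t)) v)) / real (k t) * (real (k t) / t)) \<longlongrightarrow> \<beta>) (at_top_in T)"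
    using top by (simp add: tendsto_mono)
  have "((\<lambda>t. ln D * inverse t) \<longlongrightarrow> ln D * 0) at_top"
    by (intro tendsto_intros tendsto_inverse_0_at_top filterlim_ident)
  then have 2: "((\<lambda>t. ln D / t) \<longlongrightarrow> 0) (at_top_in T)"
    using top by (simp add: tendsto_mono divide_inverse)
  \<comment> \<open>The logarithms at \<open>t\<close> and at its integer part differ by at most
    \<open>ln D\<close>, which division by \<open>t\<close> removes.\<close>
  have "((\<lambda>t. ln (nm (\<Phi> t v)) / t - ln (nm (\<Phi> (real (k t)) v)) / real (k t) * (real (k t) / t)) \<longlongrightarrow> 0) (at_top_in T)"
  proof (rule Lim_null_comparison[OF _ 2])
    show "\<forall>\<^sub>F t in at_top_in T. norm (ln (nm (\<Phi> t v)) / t - ln (nm (\<Phi> (real (k t)) v)) / real (k t) * (real (k t) / t)) \<le> ln D / t"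
      unfolding eventually_at_top_in
    proof (intro exI ballI impI)
      fix t :: real assume t: "t \<in> T" "1 \<le> t"
      then have "k t \<noteq> 0" unfolding k_def by auto
      define p q where "p = nm (\<Phi> t v)" and "q = nm (\<Phi> (real (k t)) v)"
      have pq: "0 < p" "0 < q" using pos[OF v] t by (auto simp: p_def q_def time_of_nat[OF T])
      have "p \<le> D * q" "q \<le> D * p" using D(2,3)[of t v] t KD[OF v] by (auto simp: k_def p_def q_def)
      then have "ln p \<le> ln (D * q)" "ln q \<le> ln (D * p)" using pq D(1) by (simp_all)
      then have "\<bar>ln p - ln q\<bar> \<le> ln D" using pq D(1) by (simp add: ln_mult)
      then have "\<bar>ln p - ln q\<bar> / t \<le> ln D / t" using t by (simp add: divide_right_mono)
      moreover have "ln p / t - ln q / real (k t) * (real (k t) / t) = (ln p - ln q) / t"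
        using \<open>k t \<noteq> 0\<close> by (simp add: diff_divide_distrib)
      ultimately show "norm (ln (nm (\<Phi> t v)) / t - ln (nm (\<Phi> (real (k t)) v)) / real (k t) * (real (k t) / t)) \<le> ln D / t"
        using t unfolding p_def[symmetric] q_def[symmetric] by simp
    qed
  qed
  from tendsto_add[OF this 1] have "((\<lambda>t. ln (nm (\<Phi> t v)) / t) \<longlongrightarrow> \<beta>) (at_top_in T)" by simp
  with KD[OF v] that show thesis by simp
qed

end

section \<open>Growth rates of comparable functions\<close>

lemma elog_ennreal: "0 < x \<Longrightarrow> elog (ennreal x) = ereal (ln x)"
  by (simp add: elog_def)

text \<open>Where \<open>b\<close> is not positive, the quotient is \<open>-\<infinity>\<close>, far
  from any finite limit; so regularity itself makes the values eventually positive.\<close>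

lemma elog_rate_pos:
  assumes b: "((\<lambda>t. elog (ennreal (b t)) / ereal t) \<longlongrightarrow> ereal l) (at_top_in T)"
  shows "\<forall>\<^sub>F t in at_top_in T. 0 < t \<and> 0 < b t"
proof -
  have "\<forall>\<^sub>F t in at_top_in T. ereal (l - 1) < elog (ennreal (b t)) / ereal t"
    using b by (rule order_tendstoD) simp
  moreover have "\<forall>\<^sub>F t in at_top_in T. 0 < t"
    unfolding eventually_at_top_in by (intro exI[of _ 1]) auto
  ultimately show ?thesis
  proof eventually_elim
    case (elim t)
    have "b t \<le> 0 \<Longrightarrow> elog (ennreal (b t)) / ereal t = - \<infinity>"
      using elim by (simp add: elog_def ennreal_neg)
    then show ?case using elim by force
  qed
qed

lemma elog_rate_iff:
  assumes "\<forall>\<^sub>F t in at_top_in T. 0 < b t"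
  shows "((\<lambda>t. elog (ennreal (b t)) / ereal t) \<longlongrightarrow> ereal l) (at_top_in T) \<longleftrightarrow>
    ((\<lambda>t. ln (b t) / t) \<longlongrightarrow> l) (at_top_in T)"
proof -
  have "\<forall>\<^sub>F t in at_top_in T. 0 < t"
    unfolding eventually_at_top_in by (intro exI[of _ 1]) auto
  with assms have "\<forall>\<^sub>F t in at_top_in T. elog (ennreal (b t)) / ereal t = ereal (ln (b t) / t)"
    by eventually_elim (simp add: elog_ennreal)
  then have "((\<lambda>t. elog (ennreal (b t)) / ereal t) \<longlongrightarrow> ereal l) (at_top_in T) \<longleftrightarrow>
      ((\<lambda>t. ereal (ln (b t) / t)) \<longlongrightarrow> ereal l) (at_top_in T)"
    by (rule tendsto_cong)
  then show ?thesis by simp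
qed

lemma elog_rate_comparable:
  fixes a b :: "real \<Rightarrow> real"
  assumes cmp: "\<forall>\<^sub>F t in at_top_in T. c * b t \<le> a t \<and> a t \<le> C * b t" and "0 < c"
    and b: "((\<lambda>t. elog (ennreal (b t)) / ereal t) \<longlongrightarrow> ereal l) (at_top_in T)"
  shows "((\<lambda>t. elog (ennreal (a t)) / ereal t) \<longlongrightarrow> ereal l) (at_top_in T)"
proof -
  have pos: "\<forall>\<^sub>F t in at_top_in T. 0 < t \<and> 0 < b t \<and> 0 < a t \<and> c * b t \<le> a t \<and> a t \<le> C * b t"
    using elog_rate_pos[OF b] cmp
  proof eventually_elim
    case (elim t)
    then have "0 < c * b t" using \<open>0 < c\<close> by simp
    then show ?case using elim by linarith
  qed
  have top: "at_top_in T \<le> at_top" by (simp add: at_top_in_def)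
  let ?K = "\<bar>ln c\<bar> + \<bar>ln C\<bar>"
  have "((\<lambda>t. ?K * inverse t) \<longlongrightarrow> ?K * 0) at_top"
    by (intro tendsto_intros tendsto_inverse_0_at_top filterlim_ident)
  then have K: "((\<lambda>t. ?K / t) \<longlongrightarrow> 0) (at_top_in T)"
    using top by (simp add: tendsto_mono divide_inverse)
  have "((\<lambda>t. ln (a t) / t - ln (b t) / t) \<longlongrightarrow> 0) (at_top_in T)"
  proof (rule Lim_null_comparison[OF _ K])
    show "\<forall>\<^sub>F t in at_top_in T. norm (ln (a t) / t - ln (b t) / t) \<le> ?K / t"
      using pos
    proof eventually_elim
      case (elim t)
      \<comment> \<open>The sign of \<open>C\<close> follows from the positive values that it
        relates.\<close>
      then have "0 < C" by (metis less_le_trans mult_pos_pos zero_less_mult_pos2)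
      have "ln (c * b t) \<le> ln (a t)" "ln (a t) \<le> ln (C * b t)"
        using elim \<open>0 < c\<close> \<open>0 < C\<close> by simp_all
      then have "\<bar>ln (a t) - ln (b t)\<bar> \<le> ?K" using elim \<open>0 < c\<close> \<open>0 < C\<close> by (simp add: ln_mult)
      then have "\<bar>ln (a t) - ln (b t)\<bar> / t \<le> ?K / t" using elim by (intro divide_right_mono) auto
      then show ?case using elim by (simp add: diff_divide_distrib[symmetric])
    qed
  qed
  moreover have "((\<lambda>t. ln (b t) / t) \<longlongrightarrow> l) (at_top_in T)"
    using b by (subst (asm) elog_rate_iff) (use pos in \<open>auto elim: eventually_mono\<close>)
  ultimately have "((\<lambda>t. ln (a t) / t) \<longlongrightarrow> l) (at_top_in T)"
    using tendsto_add by fastforce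
  then show ?thesis
    by (subst elog_rate_iff) (use pos in \<open>auto elim: eventually_mono\<close>)
qed

section \<open>Manifold topology and tangent bundle\<close>

(* Continuous instead of smooth transition maps, so that the tangent atlas qualifies without an
   investigation of the derivatives of derivatives. *)
locale topological_atlas =
  fixes P :: "('p, 'e::euclidean_space) chart set"
  assumes chart_inj: "(U, f) \<in> P \<Longrightarrow> inj_on f U"
    and chart_image: "(U, f) \<in> P \<Longrightarrow> open (f ` U)"
    and overlap_open: "(U, f) \<in> P \<Longrightarrow> (U', f') \<in> P \<Longrightarrow> open (f ` (U \<inter> U'))"
    and transition_cont: "(U, f) \<in> P \<Longrightarrow> (U', f') \<in> P \<Longrightarrow>
      continuous_on (f ` (U \<inter> U')) (f' \<circ> inv_into U f)"
begin

abbreviation X where "X \<equiv> manifold_topology P"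

text \<open>The argument of \<open>openin_manifold_topology\<close>, repeated for topological
  atlases because it must also cover the tangent atlas.\<close>

lemma openin_charts:
  "openin X W \<longleftrightarrow> W \<subseteq> \<Union>(fst ` P) \<and> (\<forall>(U, f)\<in>P. open (f ` (W \<inter> U)))"
proof -
  let ?O = "\<lambda>W. W \<subseteq> \<Union>(fst ` P) \<and> (\<forall>(U, f)\<in>P. open (f ` (W \<inter> U)))"
  have "?O (S \<inter> R)" if S: "?O S" and R: "?O R" for S R
  proof -
    have "open (f ` (S \<inter> R \<inter> U))" if c: "(U, f) \<in> P" for U f
    proof -
      have "f ` (S \<inter> R \<inter> U) = f ` (S \<inter> U) \<inter> f ` (R \<inter> U)"
        using chart_inj[OF c] by (auto simp: inj_on_def)
      then show ?thesis using S R c by auto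
    qed
    then show ?thesis using S by auto
  qed
  moreover have "?O (\<Union>\<K>)" if \<K>: "\<forall>K\<in>\<K>. ?O K" for \<K>
  proof -
    have "open (f ` (\<Union>\<K> \<inter> U))" if c: "(U, f) \<in> P" for U f
    proof -
      have "f ` (\<Union>\<K> \<inter> U) = (\<Union>K\<in>\<K>. f ` (K \<inter> U))" by blast
      moreover have "open \<dots>" using \<K> c by (intro open_UN) auto
      ultimately show ?thesis by simp
    qed
    then show ?thesis using \<K> by auto
  qed
  ultimately have "istopology ?O" unfolding istopology_def by meson
  then show ?thesis by (simp add: manifold_topology_def)
qed

lemma topspace_charts: "topspace X = \<Union>(fst ` P)"
proof
  show "topspace X \<subseteq> \<Union>(fst ` P)" using openin_charts[of "topspace X"] openin_topspace by blast
  have "open (f ` (\<Union>(fst ` P) \<inter> U))" if "(U, f) \<in> P" for U f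
  proof -
    have "\<Union>(fst ` P) \<inter> U = U" using that by force
    then show ?thesis using chart_image that by metis
  qed
  then have "openin X (\<Union>(fst ` P))" by (subst openin_charts) auto
  then show "\<Union>(fst ` P) \<subseteq> topspace X" by (rule openin_subset)
qed

lemma chart_in_topspace: "(U, f) \<in> P \<Longrightarrow> p \<in> U \<Longrightarrow> p \<in> topspace X"
  by (force simp: topspace_charts)

lemma chart_around: "p \<in> topspace X \<Longrightarrow> \<exists>U f. (U, f) \<in> P \<and> p \<in> U"
  by (force simp: topspace_charts)

lemma chart_image_openin: "openin X W \<Longrightarrow> (U, f) \<in> P \<Longrightarrow> open (f ` (W \<inter> U))"
  using openin_charts by fastforce

lemma chart_preimage_openin:
  assumes c: "(U, f) \<in> P" and "open Q"
  shows "openin X {p \<in> U. f p \<in> Q}"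
proof (subst openin_charts, intro conjI ballI)
  show "{p \<in> U. f p \<in> Q} \<subseteq> \<Union>(fst ` P)" using c by force
  fix c' assume "c' \<in> P"
  obtain U' f' where c': "c' = (U', f')" by (cases c')
  then have P': "(U', f') \<in> P" using \<open>c' \<in> P\<close> by simp
  \<comment> \<open>Seen in another chart, the set is the preimage of \<open>Q\<close> under the
    transition map, whose domain is open.\<close>
  have "f' ` ({p \<in> U. f p \<in> Q} \<inter> U') = f' ` (U' \<inter> U) \<inter> (f \<circ> inv_into U' f') -` Q"
    using chart_inj[OF P'] by (auto simp: inv_into_f_f)
  moreover have "open \<dots>"
    by (rule continuous_open_preimage[OF transition_cont[OF P' c] overlap_open[OF P' c] \<open>open Q\<close>])
  ultimately show "case c' of (U', f') \<Rightarrow> open (f' ` ({p \<in> U. f p \<in> Q} \<inter> U'))"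
    by (simp add: c')
qed

lemma chart_domain_openin: "(U, f) \<in> P \<Longrightarrow> openin X U"
  using chart_preimage_openin[of U f UNIV] by simp

lemma chart_continuous_map:
  assumes c: "(U, f) \<in> P"
  shows "continuous_map (subtopology X U) euclidean f"
proof -
  have U: "topspace (subtopology X U) = U"
    using openin_subset[OF chart_domain_openin[OF c]] by auto
  have "openin (subtopology X U) {p \<in> U. f p \<in> Q}" if "open Q" for Q
    using chart_preimage_openin[OF c that] by (auto simp: openin_subtopology_alt)
  then show ?thesis unfolding continuous_map_def U by auto
qed

lemma chart_inv_continuous_map:
  assumes c: "(U, f) \<in> P"
  shows "continuous_map (top_of_set (f ` U)) X (inv_into U f)"
proof -
  have "openin (top_of_set (f ` U)) {y \<in> f ` U. inv_into U f y \<in> W}" if "openin X W" for W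
  proof -
    have "{y \<in> f ` U. inv_into U f y \<in> W} = f ` (W \<inter> U)"
      using chart_inj[OF c] by (auto simp: inv_into_f_f)
    then show ?thesis
      using chart_image_openin[OF that c] by (auto intro: open_subset)
  qed
  then show ?thesis
    using chart_in_topspace[OF c] unfolding continuous_map_def by (auto simp: inv_into_into)
qed

end

text \<open>The local condition is that of \<open>smooth_map_on\<close> with a merely continuous
  coordinate expression, so it covers smooth maps as well as explicit maps on the tangent
  bundle.\<close>

lemma continuous_map_charts:
  fixes P :: "('p, 'a::euclidean_space) chart set" and Q :: "('q, 'b::euclidean_space) chart set"
  assumes P: "topological_atlas P" and Q: "topological_atlas Q"
    and S: "S \<subseteq> topspace (manifold_topology P)"
    and loc: "\<And>p. p \<in> S \<Longrightarrow> \<exists>U f U' f' W H. (U, f) \<in> P \<and> (U', f') \<in> Q \<and> p \<in> U \<and> h p \<in> U' \<and>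
      open W \<and> f p \<in> W \<and> continuous_on W H \<and>
      (\<forall>q\<in>S \<inter> U. f q \<in> W \<longrightarrow> h q \<in> U' \<and> f' (h q) = H (f q))"
  shows "continuous_map (subtopology (manifold_topology P) S) (manifold_topology Q) h"
proof -
  interpret P: topological_atlas P by fact
  interpret Q: topological_atlas Q by fact
  have S': "topspace (subtopology P.X S) = S" using S by auto
  have "h p \<in> topspace Q.X" if "p \<in> S" for p
    using loc[OF that] Q.chart_in_topspace by blast
  moreover have "openin (subtopology P.X S) {q \<in> S. h q \<in> R}" if R: "openin Q.X R" for R
  proof (subst openin_subopen, intro ballI)
    fix p assume "p \<in> {q \<in> S. h q \<in> R}"
    then have p: "p \<in> S" "h p \<in> R" by auto
    then obtain U f U' f' W H where c: "(U, f) \<in> P" "(U', f') \<in> Q" "p \<in> U" "h p \<in> U'"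
      and W: "open W" "f p \<in> W" "continuous_on W H"
        "\<And>q. q \<in> S \<Longrightarrow> q \<in> U \<Longrightarrow> f q \<in> W \<Longrightarrow> h q \<in> U' \<and> f' (h q) = H (f q)"
      using loc[OF p(1)] by blast
    define O' where "O' = W \<inter> H -` (f' ` (R \<inter> U'))"
    have "open O'" unfolding O'_def
      by (rule continuous_open_preimage[OF W(3,1) Q.chart_image_openin[OF R c(2)]])
    then have "openin P.X {q \<in> U. f q \<in> O'}" by (rule P.chart_preimage_openin[OF c(1)])
    then have "openin (subtopology P.X S) ({q \<in> U. f q \<in> O'} \<inter> S)"
      by (auto simp: openin_subtopology)
    moreover have "p \<in> {q \<in> U. f q \<in> O'} \<inter> S"
      using W(2,4) p c by (force simp: O'_def)
    moreover have "{q \<in> U. f q \<in> O'} \<inter> S \<subseteq> {q \<in> S. h q \<in> R}"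
    proof
      fix q assume "q \<in> {q \<in> U. f q \<in> O'} \<inter> S"
      then have q: "q \<in> S" "q \<in> U" "f q \<in> W" "H (f q) \<in> f' ` (R \<inter> U')" by (auto simp: O'_def)
      then have "h q \<in> U'" "f' (h q) \<in> f' ` (R \<inter> U')" using W(4) by auto
      then have "h q \<in> R" using Q.chart_inj[OF c(2)] by (auto simp: inj_on_def)
      then show "q \<in> {q \<in> S. h q \<in> R}" using q by simp
    qed
    ultimately show "\<exists>T. openin (subtopology P.X S) T \<and> p \<in> T \<and> T \<subseteq> {q \<in> S. h q \<in> R}" by blast
  qed
  ultimately show ?thesis unfolding continuous_map_def S' by auto
qed

section \<open>Calculus with smooth maps\<close>

lemma smooth_on_continuous: "smooth_on S f \<Longrightarrow> continuous_on S f"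
  unfolding smooth_on_def using Ck_on.simps(1) by blast

lemma smooth_on_differentiable: "smooth_on S f \<Longrightarrow> x \<in> S \<Longrightarrow> f differentiable (at x)"
  unfolding smooth_on_def using Ck_on.simps(2) by blast

lemma smooth_on_has_derivative:
  "smooth_on S f \<Longrightarrow> x \<in> S \<Longrightarrow> (f has_derivative frechet_derivative f (at x)) (at x)"
  using smooth_on_differentiable frechet_derivative_works by blast

lemma smooth_on_derivative_continuous:
  "smooth_on S f \<Longrightarrow> continuous_on S (\<lambda>x. frechet_derivative f (at x) v)"
  unfolding smooth_on_def by (metis Ck_on.simps)

text \<open>\<open>Ck_on\<close> controls the derivative for each fixed direction only. Expansion in
  a finite basis makes it continuous in point and direction together, as the compactness arguments
  require.\<close>

lemma smooth_on_derivative_jointly_continuous: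
  fixes f :: "'a::euclidean_space \<Rightarrow> 'b::real_normed_vector"
  assumes f: "smooth_on S f"
  shows "continuous_on (S \<times> UNIV) (\<lambda>(x, v). frechet_derivative f (at x) v)"
proof -
  have "continuous_on (S \<times> UNIV) (\<lambda>z. \<Sum>b\<in>Basis. (snd z \<bullet> b) *\<^sub>R frechet_derivative f (at (fst z)) b)"
  proof (intro continuous_intros)
    fix b :: 'a assume "b \<in> Basis"
    have "continuous_on (S \<times> UNIV) ((\<lambda>x. frechet_derivative f (at x) b) \<circ> (fst :: 'a \<times> 'a \<Rightarrow> 'a))"
      by (intro continuous_on_compose continuous_intros continuous_on_subset[OF smooth_on_derivative_continuous[OF f]]) auto
    then show "continuous_on (S \<times> UNIV) (\<lambda>z. frechet_derivative f (at (fst (z :: 'a \<times> 'a))) b)"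
      by (simp add: o_def)
  qed
  moreover have "frechet_derivative f (at x) v = (\<Sum>b\<in>Basis. (v \<bullet> b) *\<^sub>R frechet_derivative f (at x) b)"
    if "x \<in> S" for x v
  proof -
    have "linear (frechet_derivative f (at x))"
      using smooth_on_has_derivative[OF f that] has_derivative_linear by blast
    then have "frechet_derivative f (at x) (\<Sum>b\<in>Basis. (v \<bullet> b) *\<^sub>R b) =
        (\<Sum>b\<in>Basis. (v \<bullet> b) *\<^sub>R frechet_derivative f (at x) b)"
      by (simp add: linear_sum linear_cmul)
    then show ?thesis by (simp add: euclidean_representation)
  qed
  ultimately show ?thesis
    by (subst continuous_on_cong[OF refl]) (auto simp: split_beta)
qed

lemma smooth_atlasD:
  assumes "smooth_atlas P" and c: "(U, f) \<in> P"
  shows "inj_on f U" "open (f ` U)"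
    and "(U', f') \<in> P \<Longrightarrow> open (f ` (U \<inter> U'))"
    and "(U', f') \<in> P \<Longrightarrow> smooth_on (f ` (U \<inter> U')) (f' \<circ> inv_into U f)"
proof -
  have 1: "\<forall>(U, f)\<in>P. inj_on f U \<and> open (f ` U)"
    and 2: "\<forall>(U, f)\<in>P. \<forall>(U', f')\<in>P.
      open (f ` (U \<inter> U')) \<and> smooth_on (f ` (U \<inter> U')) (f' \<circ> inv_into U f)"
    using assms(1) unfolding smooth_atlas_def by blast+
  show "inj_on f U" "open (f ` U)" using bspec[OF 1 c] by simp_all
  assume c': "(U', f') \<in> P"
  have "\<forall>(U', f')\<in>P. open (f ` (U \<inter> U')) \<and> smooth_on (f ` (U \<inter> U')) (f' \<circ> inv_into U f)"
    using bspec[OF 2 c] by simp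
  from bspec[OF this c'] show "open (f ` (U \<inter> U'))" "smooth_on (f ` (U \<inter> U')) (f' \<circ> inv_into U f)"
    by simp_all
qed

lemma smooth_atlas_topological:
  assumes "smooth_atlas P"
  shows "topological_atlas P"
proof
  fix U f U' f' assume c: "(U, f) \<in> P"
  show "inj_on f U" "open (f ` U)" using smooth_atlasD(1,2)[OF assms c] .
  assume c': "(U', f') \<in> P"
  show "open (f ` (U \<inter> U'))" using smooth_atlasD(3)[OF assms c c'] .
  show "continuous_on (f ` (U \<inter> U')) (f' \<circ> inv_into U f)"
    using smooth_on_continuous[OF smooth_atlasD(4)[OF assms c c']] .
qed

section \<open>Tangent spaces and the topology of the tangent bundle\<close>

locale smooth_atlas_locale =
  fixes P :: "('p, 'e::euclidean_space) chart set"
  assumes smooth: "smooth_atlas P"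
begin

sublocale topological_atlas P
  by (rule smooth_atlas_topological[OF smooth])

lemma transition_smooth:
  "(U, f) \<in> P \<Longrightarrow> (U', f') \<in> P \<Longrightarrow> smooth_on (f ` (U \<inter> U')) (f' \<circ> inv_into U f)"
  using smooth_atlasD(4)[OF smooth] .

abbreviation trans_deriv :: "('p, 'e) chart \<Rightarrow> ('p, 'e) chart \<Rightarrow> 'p \<Rightarrow> 'e \<Rightarrow> 'e" where
  "trans_deriv c c' p \<equiv> frechet_derivative (snd c' \<circ> inv_into (fst c) (snd c)) (at (snd c p))"

lemma trans_has_derivative:
  assumes "(U, f) \<in> P" "(U', f') \<in> P" "p \<in> U" "p \<in> U'"
  shows "((f' \<circ> inv_into U f) has_derivative trans_deriv (U, f) (U', f') p) (at (f p))"
  using smooth_on_has_derivative[OF transition_smooth[OF assms(1,2)], of "f p"] assms by auto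

lemma trans_deriv_linear:
  assumes "(U, f) \<in> P" "(U', f') \<in> P" "p \<in> U" "p \<in> U'"
  shows "linear (trans_deriv (U, f) (U', f') p)"
  using trans_has_derivative[OF assms] has_derivative_linear by blast

text \<open>The chain rule for transition maps; it makes a vector prescribed in one chart coherent
  in all others.\<close>

lemma trans_deriv_comp:
  assumes c: "(U, f) \<in> P" "(U', f') \<in> P" "(U'', f'') \<in> P" and p: "p \<in> U" "p \<in> U'" "p \<in> U''"
  shows "trans_deriv (U, f) (U'', f'') p u = trans_deriv (U', f') (U'', f'') p (trans_deriv (U, f) (U', f') p u)"
proof -
  let ?a = "f' \<circ> inv_into U f" and ?b = "f'' \<circ> inv_into U' f'"
  have "?a (f p) = f' p" using chart_inj[OF c(1)] p by simp
  then have "(?b has_derivative trans_deriv (U', f') (U'', f'') p) (at (?a (f p)))"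
    using trans_has_derivative[OF c(2,3) p(2,3)] by simp
  from diff_chain_at[OF trans_has_derivative[OF c(1,2) p(1,2)] this]
  have "(?b \<circ> ?a has_derivative trans_deriv (U', f') (U'', f'') p \<circ> trans_deriv (U, f) (U', f') p) (at (f p))" .
  then have "(f'' \<circ> inv_into U f has_derivative trans_deriv (U', f') (U'', f'') p \<circ> trans_deriv (U, f) (U', f') p) (at (f p))"
  proof (rule has_derivative_transform_within_open)
    show "open (f ` (U \<inter> U'))" using overlap_open[OF c(1,2)] .
    show "f p \<in> f ` (U \<inter> U')" using p by blast
    fix y assume "y \<in> f ` (U \<inter> U')"
    then show "(?b \<circ> ?a) y = (f'' \<circ> inv_into U f) y"
      using chart_inj[OF c(1)] chart_inj[OF c(2)] by auto
  qed
  from frechet_derivative_at[OF this] show ?thesis by (simp add: fun_eq_iff)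
qed

lemma trans_deriv_self:
  assumes c: "(U, f) \<in> P" and p: "p \<in> U"
  shows "trans_deriv (U, f) (U, f) p u = u"
proof -
  have "((\<lambda>y. y) has_derivative (\<lambda>y. y)) (at (f p))" by (rule has_derivative_ident)
  then have "((f \<circ> inv_into U f) has_derivative (\<lambda>y. y)) (at (f p))"
    by (rule has_derivative_transform_within_open[OF _ chart_image[OF c]])
      (use p chart_inj[OF c] in auto)
  from fun_cong[OF frechet_derivative_at[OF this], of u] show ?thesis by (simp only: fst_conv snd_conv)
qed

lemma tangent_space_trans:
  assumes "\<xi> \<in> tangent_space P p" "(U, f) \<in> P" "(U', f') \<in> P" "p \<in> U" "p \<in> U'"
  shows "\<xi> (U', f') = trans_deriv (U, f) (U', f') p (\<xi> (U, f))"
proof -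
  have "\<forall>(U, f)\<in>P. \<forall>(U', f')\<in>P. p \<in> U \<inter> U' \<longrightarrow>
      \<xi> (U', f') = frechet_derivative (f' \<circ> inv_into U f) (at (f p)) (\<xi> (U, f))"
    using assms(1) unfolding tangent_space_def by blast
  from bspec[OF this assms(2)] have "\<forall>(U', f')\<in>P. p \<in> U \<inter> U' \<longrightarrow>
      \<xi> (U', f') = frechet_derivative (f' \<circ> inv_into U f) (at (f p)) (\<xi> (U, f))"
    by simp
  from bspec[OF this assms(3)] show ?thesis using assms(4,5) by simp
qed

lemma tangent_space_outside: "\<xi> \<in> tangent_space P p \<Longrightarrow> \<not> (c \<in> P \<and> p \<in> fst c) \<Longrightarrow> \<xi> c = 0"
  unfolding tangent_space_def by blast

lemma tangent_space_eqI:
  assumes "\<xi> \<in> tangent_space P p" "\<eta> \<in> tangent_space P p" "(U, f) \<in> P" "p \<in> U" "\<xi> (U, f) = \<eta> (U, f)"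
  shows "\<xi> = \<eta>"
proof
  fix c show "\<xi> c = \<eta> c"
  proof (cases "c \<in> P \<and> p \<in> fst c")
    case True
    obtain U' f' where "c = (U', f')" by (cases c)
    then show ?thesis
      using True assms tangent_space_trans[of \<xi> p U f U' f'] tangent_space_trans[of \<eta> p U f U' f'] by simp
  next
    case False
    then show ?thesis using assms(1,2) tangent_space_outside by metis
  qed
qed

lemma tangent_spaceI:
  assumes "\<And>c. \<not> (c \<in> P \<and> p \<in> fst c) \<Longrightarrow> \<xi> c = 0"
    and "\<And>U f U' f'. (U, f) \<in> P \<Longrightarrow> (U', f') \<in> P \<Longrightarrow> p \<in> U \<Longrightarrow> p \<in> U' \<Longrightarrow>
      \<xi> (U', f') = trans_deriv (U, f) (U', f') p (\<xi> (U, f))"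
  shows "\<xi> \<in> tangent_space P p"
proof -
  have "\<forall>c. \<not> (c \<in> P \<and> p \<in> fst c) \<longrightarrow> \<xi> c = 0" using assms(1) by blast
  moreover have "\<forall>(U, f)\<in>P. \<forall>(U', f')\<in>P. p \<in> U \<inter> U' \<longrightarrow>
      \<xi> (U', f') = frechet_derivative (f' \<circ> inv_into U f) (at (f p)) (\<xi> (U, f))"
  proof clarify
    fix U f U' f' assume "(U, f) \<in> P" "(U', f') \<in> P" "p \<in> U" "p \<in> U'"
    then show "\<xi> (U', f') = frechet_derivative (f' \<circ> inv_into U f) (at (f p)) (\<xi> (U, f))"
      using assms(2)[of U f U' f'] by simp
  qed
  ultimately show ?thesis unfolding tangent_space_def by blast
qed

lemma tangent_space_lincomb:
  assumes "\<xi> \<in> tangent_space P p" "\<eta> \<in> tangent_space P p"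
  shows "(\<lambda>c. a *\<^sub>R \<xi> c + b *\<^sub>R \<eta> c) \<in> tangent_space P p"
proof (rule tangent_spaceI)
  fix c assume "\<not> (c \<in> P \<and> p \<in> fst c)"
  then have "\<xi> c = 0" "\<eta> c = 0" using assms tangent_space_outside by blast+
  then show "a *\<^sub>R \<xi> c + b *\<^sub>R \<eta> c = 0" by simp
next
  fix U f U' f' assume c: "(U, f) \<in> P" "(U', f') \<in> P" "p \<in> U" "p \<in> U'"
  then show "a *\<^sub>R \<xi> (U', f') + b *\<^sub>R \<eta> (U', f') =
      trans_deriv (U, f) (U', f') p (a *\<^sub>R \<xi> (U, f) + b *\<^sub>R \<eta> (U, f))"
    using tangent_space_trans[OF assms(1) c] tangent_space_trans[OF assms(2) c] trans_deriv_linear[OF c]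
    by (simp only: linear_add linear_cmul)
qed

lemma tangent_space_scale: "\<xi> \<in> tangent_space P p \<Longrightarrow> (\<lambda>c. a *\<^sub>R \<xi> c) \<in> tangent_space P p"
  using tangent_space_lincomb[of \<xi> p \<xi> a 0] by simp

lemma tangent_space_zero: "(\<lambda>_. 0) \<in> tangent_space P p"
  by (rule tangent_spaceI) (metis linear_0 trans_deriv_linear)+

text \<open>Transport \<open>u\<close> from the given chart to all others by the transition
  derivatives; \<open>trans_deriv_comp\<close> is the compatibility condition.\<close>

lemma tangent_vector_exists:
  assumes c: "(U, f) \<in> P" and p: "p \<in> U"
  obtains \<xi> where "\<xi> \<in> tangent_space P p" "\<xi> (U, f) = u"
proof -
  define \<xi> where "\<xi> c' = (if c' \<in> P \<and> p \<in> fst c' then trans_deriv (U, f) c' p u else 0)" for c'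
  have "\<xi> (U, f) = u" using trans_deriv_self[OF c p] c p by (simp add: \<xi>_def)
  moreover have "\<xi> \<in> tangent_space P p"
  proof (rule tangent_spaceI)
    fix c' assume "\<not> (c' \<in> P \<and> p \<in> fst c')"
    then show "\<xi> c' = 0" unfolding \<xi>_def by (rule if_not_P)
  next
    fix U1 f1 U2 f2 assume cP: "(U1, f1) \<in> P" "(U2, f2) \<in> P" "p \<in> U1" "p \<in> U2"
    then show "\<xi> (U2, f2) = trans_deriv (U1, f1) (U2, f2) p (\<xi> (U1, f1))"
      using trans_deriv_comp[OF c cP(1,2) p cP(3,4), of u] by (simp add: \<xi>_def)
  qed
  ultimately show thesis using that by blast
qed

definition tchart :: "'p set \<Rightarrow> ('p \<Rightarrow> 'e) \<Rightarrow> 'p \<times> ('p, 'e) tvec \<Rightarrow> 'e \<times> 'e" where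
  "tchart U f = (\<lambda>(p, \<xi>). (f p, \<xi> (U, f)))"

lemma tangent_atlas_iff:
  "(W, F) \<in> tangent_atlas P \<longleftrightarrow> (\<exists>U f. (U, f) \<in> P \<and> W = Sigma U (tangent_space P) \<and> F = tchart U f)"
proof -
  have "tangent_atlas P = (\<lambda>(U, f). (Sigma U (tangent_space P), tchart U f)) ` P"
    by (simp add: tangent_atlas_def tchart_def)
  then show ?thesis by auto
qed

lemma tchart_inj: "(U, f) \<in> P \<Longrightarrow> inj_on (tchart U f) (Sigma U (tangent_space P))"
  using chart_inj[of U f] tangent_space_eqI by (fastforce simp: inj_on_def tchart_def)

lemma tchart_image:
  assumes "(U, f) \<in> P" "W \<subseteq> U"
  shows "tchart U f ` Sigma W (tangent_space P) = f ` W \<times> UNIV"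
proof (intro equalityI subsetI)
  fix z assume "z \<in> f ` W \<times> (UNIV :: 'e set)"
  then obtain p u where pu: "z = (f p, u)" "p \<in> W" by auto
  then obtain \<xi> where "\<xi> \<in> tangent_space P p" "\<xi> (U, f) = u"
    using tangent_vector_exists[of U f p u] assms by blast
  then show "z \<in> tchart U f ` Sigma W (tangent_space P)"
    using pu by (force simp: tchart_def image_iff)
qed (auto simp: tchart_def)

lemma tangent_atlas_topological: "topological_atlas (tangent_atlas P)"
proof
  fix W W' :: "('p \<times> ('p, 'e) tvec) set" and F F' :: "'p \<times> ('p, 'e) tvec \<Rightarrow> 'e \<times> 'e"
  assume "(W, F) \<in> tangent_atlas P"
  then obtain U f where c: "(U, f) \<in> P" "W = Sigma U (tangent_space P)" "F = tchart U f"
    unfolding tangent_atlas_iff by blast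
  show "inj_on F W" using tchart_inj c by simp
  show "open (F ` W)" using tchart_image[of U f U] c chart_image[of U f] by (simp add: open_Times)
  assume "(W', F') \<in> tangent_atlas P"
  then obtain U' f' where c': "(U', f') \<in> P" "W' = Sigma U' (tangent_space P)" "F' = tchart U' f'"
    unfolding tangent_atlas_iff by blast
  have "W \<inter> W' = Sigma (U \<inter> U') (tangent_space P)" using c c' by auto
  then have im: "F ` (W \<inter> W') = f ` (U \<inter> U') \<times> UNIV" using tchart_image[of U f "U \<inter> U'"] c by simp
  then show "open (F ` (W \<inter> W'))"
    using overlap_open[OF c(1) c'(1)] by (simp add: open_Times)
  let ?t = "f' \<circ> inv_into U f"
  \<comment> \<open>A change of tangent charts pairs the transition map with its derivative, so
    joint continuity of the derivative is enough.\<close>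
  have eq: "(F' \<circ> inv_into W F) z = (?t (fst z), frechet_derivative ?t (at (fst z)) (snd z))"
    if z: "z \<in> F ` (W \<inter> W')" for z
  proof -
    obtain p \<xi> where p: "z = F (p, \<xi>)" "p \<in> U" "p \<in> U'" "\<xi> \<in> tangent_space P p"
      using z c c' by auto
    then have "inv_into W F z = (p, \<xi>)"
      using tchart_inj[OF c(1)] c by (simp add: inv_into_f_f)
    then show ?thesis
      using p tangent_space_trans[OF p(4) c(1) c'(1) p(2,3)] chart_inj[OF c(1)]
      by (simp add: c(3) c'(3) tchart_def)
  qed
  have "continuous_on (f ` (U \<inter> U') \<times> UNIV) (\<lambda>z. (?t (fst z), frechet_derivative ?t (at (fst z)) (snd z)))"
  proof (intro continuous_on_Pair)
    have "continuous_on (f ` (U \<inter> U') \<times> UNIV) (?t \<circ> (fst :: 'e \<times> 'e \<Rightarrow> 'e))"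
      by (intro continuous_on_compose continuous_intros continuous_on_subset[OF transition_cont[OF c(1) c'(1)]]) auto
    then show "continuous_on (f ` (U \<inter> U') \<times> UNIV) (\<lambda>z :: 'e \<times> 'e. ?t (fst z))" by (simp add: o_def)
    show "continuous_on (f ` (U \<inter> U') \<times> UNIV) (\<lambda>z :: 'e \<times> 'e. frechet_derivative ?t (at (fst z)) (snd z))"
      using smooth_on_derivative_jointly_continuous[OF transition_smooth[OF c(1) c'(1)]]
      by (simp add: split_beta)
  qed
  then show "continuous_on (F ` (W \<inter> W')) (F' \<circ> inv_into W F)"
    using eq by (subst continuous_on_cong[OF im]) (auto simp: im)
qed

sublocale tangent: topological_atlas "tangent_atlas P"
  by (rule tangent_atlas_topological)

lemma tchart_mem: "(U, f) \<in> P \<Longrightarrow> (Sigma U (tangent_space P), tchart U f) \<in> tangent_atlas P"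
  unfolding tangent_atlas_iff by blast

lemma tangent_topspace: "topspace tangent.X = Sigma (topspace X) (tangent_space P)"
proof -
  have "fst ` tangent_atlas P = (\<lambda>U. Sigma U (tangent_space P)) ` (fst ` P)"
    by (simp add: tangent_atlas_def image_image split_beta)
  then show ?thesis unfolding tangent.topspace_charts topspace_charts by auto
qed

lemma tangent_fst_continuous: "continuous_map tangent.X X fst"
proof -
  have "continuous_map (subtopology tangent.X (topspace tangent.X)) X fst"
  proof (rule continuous_map_charts[OF tangent_atlas_topological topological_atlas_axioms])
    fix z assume "z \<in> topspace tangent.X"
    then obtain p \<xi> where z: "z = (p, \<xi>)" "p \<in> topspace X" "\<xi> \<in> tangent_space P p"
      unfolding tangent_topspace by blast
    then obtain U f where c: "(U, f) \<in> P" "p \<in> U" using chart_around by blast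
    have "\<forall>q\<in>topspace tangent.X \<inter> Sigma U (tangent_space P). tchart U f q \<in> UNIV \<longrightarrow>
        fst q \<in> U \<and> f (fst q) = fst (tchart U f q)"
      by (auto simp: tchart_def)
    moreover have "continuous_on UNIV (fst :: 'e \<times> 'e \<Rightarrow> 'e)"
      by (intro continuous_on_fst continuous_on_id)
    moreover have "z \<in> Sigma U (tangent_space P)" "fst z \<in> U" using c z by auto
    ultimately show "\<exists>W F U' f' O' H. (W, F) \<in> tangent_atlas P \<and> (U', f') \<in> P \<and> z \<in> W \<and> fst z \<in> U' \<and>
      open O' \<and> F z \<in> O' \<and> continuous_on O' H \<and>
      (\<forall>q\<in>topspace tangent.X \<inter> W. F q \<in> O' \<longrightarrow> fst q \<in> U' \<and> f' (fst q) = H (F q))"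
      using tchart_mem[OF c(1)] c(1)
      by (intro exI[of _ "Sigma U (tangent_space P)"] exI[of _ "tchart U f"] exI[of _ U] exI[of _ f]
          exI[of _ UNIV] exI[of _ fst] conjI) (assumption | rule open_UNIV UNIV_I)+
  qed simp
  then show ?thesis by simp
qed

lemma tangent_scale_continuous: "continuous_map tangent.X tangent.X (\<lambda>(p, \<xi>). (p, \<lambda>c. a *\<^sub>R \<xi> c))"
proof -
  let ?h = "\<lambda>(p, \<xi>). (p, \<lambda>c. a *\<^sub>R \<xi> c)"
  have "continuous_map (subtopology tangent.X (topspace tangent.X)) tangent.X ?h"
  proof (rule continuous_map_charts[OF tangent_atlas_topological tangent_atlas_topological])
    fix z assume "z \<in> topspace tangent.X"
    then obtain p \<xi> where z: "z = (p, \<xi>)" "p \<in> topspace X" "\<xi> \<in> tangent_space P p"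
      unfolding tangent_topspace by blast
    then obtain U f where c: "(U, f) \<in> P" "p \<in> U" using chart_around by blast
    have "\<forall>q\<in>topspace tangent.X \<inter> Sigma U (tangent_space P). tchart U f q \<in> UNIV \<longrightarrow>
        ?h q \<in> Sigma U (tangent_space P) \<and> tchart U f (?h q) = (\<lambda>z. (fst z, a *\<^sub>R snd z)) (tchart U f q)"
      by (auto simp: tchart_def tangent_space_scale)
    moreover have "continuous_on UNIV (\<lambda>z :: 'e \<times> 'e. (fst z, a *\<^sub>R snd z))"
      by (intro continuous_on_Pair continuous_on_fst continuous_on_scaleR continuous_on_const
          continuous_on_snd continuous_on_id)
    moreover have "z \<in> Sigma U (tangent_space P)" "?h z \<in> Sigma U (tangent_space P)"
      using c z by (auto simp: tangent_space_scale)
    ultimately show "\<exists>W F U' f' O' H. (W, F) \<in> tangent_atlas P \<and> (U', f') \<in> tangent_atlas P \<and> z \<in> W \<and> ?h z \<in> U' \<and>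
      open O' \<and> F z \<in> O' \<and> continuous_on O' H \<and>
      (\<forall>q\<in>topspace tangent.X \<inter> W. F q \<in> O' \<longrightarrow> ?h q \<in> U' \<and> f' (?h q) = H (F q))"
      using tchart_mem[OF c(1)]
      by (intro exI[of _ "Sigma U (tangent_space P)"] exI[of _ "tchart U f"] exI[of _ UNIV]
          exI[of _ "\<lambda>z. (fst z, a *\<^sub>R snd z)"] conjI) (assumption | rule open_UNIV UNIV_I)+
  qed simp
  then show ?thesis by simp
qed

text \<open>Distinct base points are separated in the base; vectors over the same point share a
  chart, where Euclidean neighbourhoods separate them. Compact sets of vectors are therefore
  closed.\<close>

lemma tangent_Hausdorff:
  assumes "Hausdorff_space X"
  shows "Hausdorff_space tangent.X"
  unfolding Hausdorff_space_def
proof (intro allI impI)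
  fix z w assume zw: "z \<in> topspace tangent.X \<and> w \<in> topspace tangent.X \<and> z \<noteq> w"
  show "\<exists>A B. openin tangent.X A \<and> openin tangent.X B \<and> z \<in> A \<and> w \<in> B \<and> disjnt A B"
  proof (cases "fst z = fst w")
    case False
    moreover have "fst z \<in> topspace X" "fst w \<in> topspace X" using zw by (auto simp: tangent_topspace)
    ultimately obtain A B where AB: "openin X A" "openin X B" "fst z \<in> A" "fst w \<in> B" "disjnt A B"
      using assms unfolding Hausdorff_space_def by blast
    have "openin tangent.X {q \<in> topspace tangent.X. fst q \<in> Q}" if "openin X Q" for Q
      by (rule openin_continuous_map_preimage[OF tangent_fst_continuous that])
    with AB zw show ?thesis
      by (intro exI[of _ "{q \<in> topspace tangent.X. fst q \<in> A}"] exI[of _ "{q \<in> topspace tangent.X. fst q \<in> B}"])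
        (auto simp: disjnt_def)
  next
    case True
    have "fst z \<in> topspace X" using zw by (auto simp: tangent_topspace)
    then obtain U f where c: "(U, f) \<in> P" "fst z \<in> U" using chart_around by blast
    let ?W = "Sigma U (tangent_space P)" and ?F = "tchart U f"
    have zw': "z \<in> ?W" "w \<in> ?W" using zw True c by (auto simp: tangent_topspace)
    then have neq: "?F z \<noteq> ?F w" using tchart_inj[OF c(1)] zw by (auto simp: inj_on_def)
    then obtain A B where AB: "open A" "open B" "?F z \<in> A" "?F w \<in> B" "A \<inter> B = {}"
      using hausdorff[OF neq] by blast
    have "openin tangent.X {q \<in> ?W. ?F q \<in> Q}" if "open Q" for Q
      by (rule tangent.chart_preimage_openin[OF tchart_mem[OF c(1)] that])
    with AB zw' show ?thesis
      by (intro exI[of _ "{q \<in> ?W. ?F q \<in> A}"] exI[of _ "{q \<in> ?W. ?F q \<in> B}"])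
        (auto simp: disjnt_def)
  qed
qed

end

lemma smooth_map_onD:
  assumes "smooth_map_on P Q S h" "p \<in> S"
  shows "\<exists>U f U' f' W H. (U, f) \<in> P \<and> (U', f') \<in> Q \<and> p \<in> U \<and> h p \<in> U' \<and>
      open W \<and> f p \<in> W \<and> smooth_on W H \<and>
      (\<forall>q\<in>S \<inter> U. f q \<in> W \<longrightarrow> h q \<in> U' \<and> f' (h q) = H (f q))"
proof -
  have "\<exists>(U, f)\<in>P. \<exists>(U', f')\<in>Q. p \<in> U \<and> h p \<in> U' \<and>
      (\<exists>W H. open W \<and> f p \<in> W \<and> smooth_on W H \<and>
        (\<forall>q\<in>S \<inter> U. f q \<in> W \<longrightarrow> h q \<in> U' \<and> f' (h q) = H (f q)))"
    by (rule bspec[OF iffD1[OF smooth_map_on_def assms(1)] assms(2)])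
  then have "\<exists>c\<in>P. \<exists>c'\<in>Q. p \<in> fst c \<and> h p \<in> fst c' \<and> (\<exists>W H. open W \<and> snd c p \<in> W \<and> smooth_on W H \<and>
      (\<forall>q\<in>S \<inter> fst c. snd c q \<in> W \<longrightarrow> h q \<in> fst c' \<and> snd c' (h q) = H (snd c q)))"
    by (simp only: case_prod_unfold)
  then obtain c c' W H where c: "c \<in> P" "c' \<in> Q" and "p \<in> fst c \<and> h p \<in> fst c' \<and> open W \<and> snd c p \<in> W \<and> smooth_on W H \<and>
      (\<forall>q\<in>S \<inter> fst c. snd c q \<in> W \<longrightarrow> h q \<in> fst c' \<and> snd c' (h q) = H (snd c q))"
    by (elim bexE exE conjE) (rule that, assumption+, intro conjI, assumption+)
  moreover have "(fst c, snd c) \<in> P" "(fst c', snd c') \<in> Q" using c by simp_all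
  ultimately show ?thesis by blast
qed

lemma smooth_map_on_continuous:
  fixes P :: "('p, 'a::euclidean_space) chart set" and Q :: "('q, 'b::euclidean_space) chart set"
  assumes P: "topological_atlas P" and Q: "topological_atlas Q" and h: "smooth_map_on P Q S h"
  shows "continuous_map (subtopology (manifold_topology P) S) (manifold_topology Q) h"
proof (rule continuous_map_charts[OF P Q])
  interpret P: topological_atlas P by fact
  show "S \<subseteq> topspace P.X"
  proof
    fix p assume "p \<in> S"
    from smooth_map_onD[OF h this] show "p \<in> topspace P.X"
      by (elim exE conjE) (rule P.chart_in_topspace)
  qed
  fix p assume "p \<in> S"
  then obtain U f U' f' W H where "(U, f) \<in> P" "(U', f') \<in> Q" "p \<in> U" "h p \<in> U'"
    "open W" "f p \<in> W" "smooth_on W H" "\<forall>q\<in>S \<inter> U. f q \<in> W \<longrightarrow> h q \<in> U' \<and> f' (h q) = H (f q)"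
    using smooth_map_onD[OF h] by force
  then show "\<exists>U f U' f' W H. (U, f) \<in> P \<and> (U', f') \<in> Q \<and> p \<in> U \<and> h p \<in> U' \<and>
      open W \<and> f p \<in> W \<and> continuous_on W H \<and>
      (\<forall>q\<in>S \<inter> U. f q \<in> W \<longrightarrow> h q \<in> U' \<and> f' (h q) = H (f q))"
    by (intro exI conjI smooth_on_continuous) assumption+
qed

section \<open>Lengths of curves in charts\<close>

context smooth_atlas_locale
begin

text \<open>A coordinate map is arbitrary off its domain, so differentiability of
  \<open>f \<circ> \<gamma>\<close> alone says little about \<open>\<gamma>\<close>;
  \<open>near\<close> keeps the curve in the chart, where the chain rule applies.\<close>

lemma chart_change_vector_derivative:
  assumes c: "(U, f) \<in> P" and c': "(U', f') \<in> P"
    and t: "t \<in> I" "\<gamma> t \<in> U" "\<gamma> t \<in> U'"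
    and near: "\<forall>\<^sub>F s in at t within I. \<gamma> s \<in> U"
    and D: "((f \<circ> \<gamma>) has_vector_derivative D) (at t within I)"
  shows "((f' \<circ> \<gamma>) has_vector_derivative trans_deriv (U, f) (U', f') (\<gamma> t) D) (at t within I)"
proof -
  let ?\<tau> = "f' \<circ> inv_into U f"
  have "((f \<circ> \<gamma>) \<longlongrightarrow> (f \<circ> \<gamma>) t) (at t within I)"
    using has_vector_derivative_continuous[OF D] by (simp add: continuous_within)
  then have "\<forall>\<^sub>F s in at t within I. (f \<circ> \<gamma>) s \<in> f ` (U \<inter> U')"
    by (rule topological_tendstoD[OF _ overlap_open[OF c c']]) (use t in auto)
  with near have near': "\<forall>\<^sub>F s in at t within I. (?\<tau> \<circ> (f \<circ> \<gamma>)) s = (f' \<circ> \<gamma>) s"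
    by eventually_elim (use chart_inj[OF c] in auto)
  have "(?\<tau> has_derivative trans_deriv (U, f) (U', f') (\<gamma> t)) (at ((f \<circ> \<gamma>) t))"
    using trans_has_derivative[OF c c' t(2,3)] by simp
  then have "((?\<tau> \<circ> (f \<circ> \<gamma>)) has_vector_derivative trans_deriv (U, f) (U', f') (\<gamma> t) D) (at t within I)"
    by (intro vector_derivative_diff_chain_within[OF D]) (rule has_derivative_at_withinI)
  then show ?thesis
    unfolding has_vector_derivative_def
    by (rule has_derivative_transform_eventually[OF _ near' _ t(1)]) (use t chart_inj[OF c] in auto)
qed

text \<open>\<open>velocity\<close> takes a \<open>vector_derivative\<close> chart by chart.
  Uniqueness of derivatives at a limit point of \<open>I\<close> and the chain rule make these
  values one tangent vector.\<close>

lemma velocity_chart: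
  assumes c: "(U, f) \<in> P" and t: "t \<in> I" "\<gamma> t \<in> U" "at t within I \<noteq> bot"
    and near: "\<forall>\<^sub>F s in at t within I. \<gamma> s \<in> U"
    and D: "((f \<circ> \<gamma>) has_vector_derivative D) (at t within I)"
  shows "velocity P \<gamma> I t \<in> tangent_space P (\<gamma> t)" "velocity P \<gamma> I t (U, f) = D"
proof -
  have *: "velocity P \<gamma> I t (U', f') = trans_deriv (U, f) (U', f') (\<gamma> t) D"
    if "(U', f') \<in> P" "\<gamma> t \<in> U'" for U' f'
    using vector_derivative_within[OF t(3) chart_change_vector_derivative[OF c that(1) t(1,2) that(2) near D]] that
    by (simp add: velocity_def)
  show "velocity P \<gamma> I t (U, f) = D" using *[OF c t(2)] trans_deriv_self[OF c t(2), of D] by simp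
  show "velocity P \<gamma> I t \<in> tangent_space P (\<gamma> t)"
  proof (rule tangent_spaceI)
    fix c' assume "\<not> (c' \<in> P \<and> \<gamma> t \<in> fst c')"
    then show "velocity P \<gamma> I t c' = 0" unfolding velocity_def by (rule if_not_P)
  next
    fix U1 f1 U2 f2 assume "(U1, f1) \<in> P" "(U2, f2) \<in> P" "\<gamma> t \<in> U1" "\<gamma> t \<in> U2"
    then show "velocity P \<gamma> I t (U2, f2) = trans_deriv (U1, f1) (U2, f2) (\<gamma> t) (velocity P \<gamma> I t (U1, f1))"
      using * trans_deriv_comp[OF c _ _ t(2)] by metis
  qed
qed

text \<open>Lifts of coordinate curves are the competitors for upper bounds of the distance. Their
  derivative in any other chart is continuous because the transition derivative is jointly
  continuous.\<close>

lemma C1_chart_curve: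
  assumes c: "(U, f) \<in> P"
    and \<sigma>: "\<And>t. t \<in> {0..1} \<Longrightarrow> \<sigma> t \<in> f ` U"
      "\<And>t. t \<in> {0..1} \<Longrightarrow> (\<sigma> has_vector_derivative \<sigma>' t) (at t within {0..1})"
    and \<sigma>': "continuous_on {0..1} \<sigma>'"
  shows "piecewise_C1_curve P (inv_into U f \<circ> \<sigma>)"
    and "t \<in> {0..1} \<Longrightarrow> velocity P (inv_into U f \<circ> \<sigma>) {0..1} t \<in> tangent_space P (inv_into U f (\<sigma> t))"
    and "t \<in> {0..1} \<Longrightarrow> velocity P (inv_into U f \<circ> \<sigma>) {0..1} t (U, f) = \<sigma>' t"
proof -
  let ?\<gamma> = "inv_into U f \<circ> \<sigma>"
  have \<gamma>U: "?\<gamma> t \<in> U" if "t \<in> {0..1}" for t using \<sigma>(1)[OF that] by (simp add: inv_into_into)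
  have f\<gamma>: "(f \<circ> ?\<gamma>) t = \<sigma> t" if "t \<in> {0..1}" for t using \<sigma>(1)[OF that] by (simp add: f_inv_into_f)
  have der: "((f \<circ> ?\<gamma>) has_vector_derivative \<sigma>' t) (at t within {0..1})" if "t \<in> {0..1}" for t
    by (rule has_vector_derivative_transform[OF that _ \<sigma>(2)[OF that]]) (use f\<gamma> in auto)
  have cont: "continuous_on {0..1} \<sigma>"
    unfolding continuous_on_eq_continuous_within
    using \<sigma>(2) has_vector_derivative_continuous by blast
  show "piecewise_C1_curve P ?\<gamma>"
    unfolding piecewise_C1_curve_def
  proof (intro conjI exI[of _ "{}"])
    have "continuous_map (top_of_set {0..1}) (top_of_set (f ` U)) \<sigma>"
      using cont \<sigma>(1) by (auto simp: continuous_map_in_subtopology)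
    then show "pathin X ?\<gamma>"
      unfolding pathin_def by (rule continuous_map_compose[OF _ chart_inv_continuous_map[OF c]])
    show "\<forall>(U', f')\<in>P. \<forall>s t. 0 \<le> s \<and> s < t \<and> t \<le> 1 \<and> {s<..<t} \<inter> {} = {} \<and> ?\<gamma> ` {s..t} \<subseteq> U' \<longrightarrow>
      (\<exists>D. continuous_on {s..t} D \<and>
        (\<forall>r\<in>{s..t}. ((f' \<circ> ?\<gamma>) has_vector_derivative D r) (at r within {s..t})))"
    proof clarify
      fix U' f' s t assume c': "(U', f') \<in> P" and st: "0 \<le> s" "s < t" "t \<le> (1::real)" "?\<gamma> ` {s..t} \<subseteq> U'"
      let ?\<tau> = "f' \<circ> inv_into U f"
      let ?D = "\<lambda>r. frechet_derivative ?\<tau> (at (\<sigma> r)) (\<sigma>' r)"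
      have sub: "{s..t} \<subseteq> {0..1}" using st by auto
      have im: "\<sigma> r \<in> f ` (U \<inter> U')" if "r \<in> {s..t}" for r
      proof -
        have "r \<in> {0..1}" using that sub by blast
        then have "?\<gamma> r \<in> U \<inter> U'" "f (?\<gamma> r) = \<sigma> r" using f\<gamma>[of r] \<gamma>U[of r] st(4) that by auto
        then show ?thesis by (metis imageI)
      qed
      have "continuous_on {s..t} ((\<lambda>(x, v). frechet_derivative ?\<tau> (at x) v) \<circ> (\<lambda>r. (\<sigma> r, \<sigma>' r)))"
      proof (rule continuous_on_compose)
        show "continuous_on {s..t} (\<lambda>r. (\<sigma> r, \<sigma>' r))"
          by (intro continuous_on_Pair continuous_on_subset[OF cont sub] continuous_on_subset[OF \<sigma>' sub])
        show "continuous_on ((\<lambda>r. (\<sigma> r, \<sigma>' r)) ` {s..t}) (\<lambda>(x, v). frechet_derivative ?\<tau> (at x) v)"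
          by (rule continuous_on_subset[OF smooth_on_derivative_jointly_continuous[OF transition_smooth[OF c c']]])
            (use im in auto)
      qed
      moreover have "((f' \<circ> ?\<gamma>) has_vector_derivative ?D r) (at r within {s..t})" if r: "r \<in> {s..t}" for r
      proof -
        have "((f' \<circ> ?\<gamma>) has_vector_derivative trans_deriv (U, f) (U', f') (?\<gamma> r) (\<sigma>' r)) (at r within {s..t})"
        proof (rule chart_change_vector_derivative[OF c c' r])
          show "?\<gamma> r \<in> U" "?\<gamma> r \<in> U'" using \<gamma>U r sub st(4) by auto
          show "\<forall>\<^sub>F x in at r within {s..t}. ?\<gamma> x \<in> U"
            using \<gamma>U sub unfolding eventually_at_filter by (intro always_eventually) auto
          show "((f \<circ> ?\<gamma>) has_vector_derivative \<sigma>' r) (at r within {s..t})"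
            using der[of r] r sub has_vector_derivative_within_subset by blast
        qed
        moreover have "f (?\<gamma> r) = \<sigma> r" using f\<gamma>[of r] r sub by auto
        ultimately show ?thesis by simp
      qed
      ultimately show "\<exists>D. continuous_on {s..t} D \<and>
        (\<forall>r\<in>{s..t}. ((f' \<circ> ?\<gamma>) has_vector_derivative D r) (at r within {s..t}))"
        by (intro exI[of _ ?D] conjI ballI) (simp_all add: o_def)
    qed
  qed simp
  assume t: "t \<in> {0..1}"
  have "\<forall>\<^sub>F x in at t within {0..1}. ?\<gamma> x \<in> U"
    using \<gamma>U unfolding eventually_at_filter by (intro always_eventually) auto
  moreover have "at t within {0..1} \<noteq> bot"
    using t by (simp add: trivial_limit_within islimpt_Icc)
  ultimately show "velocity P ?\<gamma> {0..1} t \<in> tangent_space P (inv_into U f (\<sigma> t))"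
    "velocity P ?\<gamma> {0..1} t (U, f) = \<sigma>' t"
    using velocity_chart[OF c t \<gamma>U[OF t] _ _ der[OF t]] by auto
qed

end

text \<open>No measurability of \<open>w\<close> is given, and \<open>D\<close> may blow up at the
  points of \<open>K\<close>. So the fundamental theorem is applied in the gauge integral and
  compared with a measurable minorant of \<open>w\<close>.\<close>

lemma vector_derivative_integral_le:
  fixes h :: "real \<Rightarrow> 'e::euclidean_space"
  assumes "finite K" "a \<le> b" and cont: "continuous_on {a..b} h"
    and der: "\<And>t. t \<in> {a<..<b} - K \<Longrightarrow> (h has_vector_derivative D t) (at t)"
    and D: "continuous_on ({a<..<b} - K) D"
    and le: "\<And>t. t \<in> {a<..<b} - K \<Longrightarrow> c * norm (D t) \<le> w t" and "0 \<le> c"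
  shows "ennreal (c * norm (h b - h a)) \<le> (\<integral>\<^sup>+ t\<in>{a..b}. ennreal (w t) \<partial>lborel)"
proof -
  \<comment> \<open>Testing against the direction of the displacement turns the vector estimate into
    a scalar one; when both ends agree, \<open>u = 0\<close>.\<close>
  define u where "u = sgn (h b - h a)"
  define A where "A = {a<..<b} - K"
  have A: "open A" unfolding A_def using \<open>finite K\<close> by (intro open_Diff finite_imp_closed) auto
  define k where "k t = indicator A t *\<^sub>R (c * (D t \<bullet> u))" for t
  \<comment> \<open>The positive part still lies below \<open>w\<close> on \<open>A\<close>, and it
    is measurable as a continuous function on an open set extended by zero.\<close>
  define k' where "k' t = indicator A t *\<^sub>R max 0 (c * (D t \<bullet> u))" for t
  have int: "(k has_integral ((c * (h b \<bullet> u)) - (c * (h a \<bullet> u)))) {a..b}"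
  proof (rule fundamental_theorem_of_calculus_interior_strong[OF \<open>finite K\<close> \<open>a \<le> b\<close>])
    show "((\<lambda>t. c * (h t \<bullet> u)) has_vector_derivative k t) (at t)" if t: "t \<in> {a<..<b} - K" for t
    proof -
      have "((\<lambda>t. c * (h t \<bullet> u)) has_vector_derivative c * (D t \<bullet> u)) (at t)"
        by (rule bounded_linear.has_vector_derivative[OF _ der[OF t]])
          (intro bounded_linear_const_mult bounded_linear_inner_left)
      then show ?thesis using t by (simp add: k_def A_def)
    qed
    show "continuous_on {a..b} (\<lambda>t. c * (h t \<bullet> u))" using cont by (intro continuous_intros)
  qed
  have eq: "(c * (h b \<bullet> u)) - (c * (h a \<bullet> u)) = c * norm (h b - h a)"
  proof -
    have "(h b - h a) \<bullet> u = norm (h b - h a)"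
      by (cases "h b = h a") (auto simp: u_def sgn_div_norm dot_square_norm power2_eq_square)
    then show ?thesis by (simp add: inner_diff_left flip: right_diff_distrib)
  qed
  have bound: "max 0 (c * (D t \<bullet> u)) \<le> w t" if "t \<in> A" for t
  proof -
    have "D t \<bullet> u \<le> norm (D t) * norm u" by (rule norm_cauchy_schwarz)
    also have "\<dots> \<le> norm (D t) * 1" by (intro mult_left_mono) (auto simp: u_def norm_sgn)
    finally have "c * (D t \<bullet> u) \<le> c * norm (D t)" using \<open>0 \<le> c\<close> by (intro mult_left_mono) auto
    moreover have "0 \<le> c * norm (D t)" using \<open>0 \<le> c\<close> by simp
    ultimately show ?thesis using le[of t] that by (simp add: A_def)
  qed
  have meas: "k' \<in> borel_measurable lborel"
  proof -
    have "k' \<in> borel_measurable borel"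
      unfolding k'_def
      by (rule borel_measurable_continuous_on_indicator)
        (use A D in \<open>auto simp: A_def intro!: continuous_intros\<close>)
    then show ?thesis by simp
  qed
  have k'0: "0 \<le> k' t" for t by (simp add: k'_def)
  have nn: "(\<integral>\<^sup>+ t. ennreal (k' t) \<partial>lborel) \<le> (\<integral>\<^sup>+ t\<in>{a..b}. ennreal (w t) \<partial>lborel)"
  proof (rule nn_integral_mono)
    fix t show "ennreal (k' t) \<le> ennreal (w t) * indicator {a..b} t"
    proof (cases "t \<in> A")
      case True
      then have "t \<in> {a..b}" by (auto simp: A_def)
      then show ?thesis using bound[OF True] True by (simp add: k'_def ennreal_leI)
    qed (simp add: k'_def)
  qed
  \<comment> \<open>An infinite integral of \<open>k'\<close> settles the claim. Otherwise
    \<open>k'\<close> is Lebesgue integrable and dominates \<open>k\<close>, whose gauge integral is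
    the displacement times \<open>c\<close>.\<close>
  show ?thesis
  proof (cases "(\<integral>\<^sup>+ t. ennreal (k' t) \<partial>lborel) < \<infinity>")
    case False
    then show ?thesis using nn by (simp add: not_less top.extremum_unique)
  next
    case True
    then have k': "integrable lborel k'"
      using meas k'0 by (intro integrableI_nonneg) auto
    have "((\<lambda>t. if t \<in> {a..b} then k t else 0) has_integral (c * norm (h b - h a))) UNIV"
      using int unfolding eq by (simp only: has_integral_restrict_UNIV)
    then have "c * norm (h b - h a) \<le> integral\<^sup>L lborel k'"
      by (rule has_integral_le[OF _ has_integral_integral_lborel[OF k']])
        (auto simp: k_def k'_def indicator_def)
    then have "ennreal (c * norm (h b - h a)) \<le> (\<integral>\<^sup>+ t. ennreal (k' t) \<partial>lborel)"
      using nn_integral_eq_integral[OF k'] k'0 by (simp add: ennreal_leI)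
    then show ?thesis using nn by (rule order_trans)
  qed
qed

section \<open>The Riemannian metric and lengths of curves in one chart\<close>

locale riemannian_manifold = smooth_atlas_locale P for P :: "('p, 'e::euclidean_space) chart set" +
  fixes g :: "'p \<Rightarrow> ('p, 'e) tvec \<Rightarrow> ('p, 'e) tvec \<Rightarrow> real"
  assumes metric: "riemannian_metric P g" and Hausdorff: "Hausdorff_space (manifold_topology P)"
begin

lemma metric_algebra:
  assumes "p \<in> topspace X" "\<xi> \<in> tangent_space P p" "\<eta> \<in> tangent_space P p"
  shows "g p \<xi> \<eta> = g p \<eta> \<xi>" "\<xi> \<noteq> (\<lambda>_. 0) \<Longrightarrow> 0 < g p \<xi> \<xi>"
    and "\<zeta> \<in> tangent_space P p \<Longrightarrow> g p (\<lambda>c. a *\<^sub>R \<xi> c + b *\<^sub>R \<eta> c) \<zeta> = a * g p \<xi> \<zeta> + b * g p \<eta> \<zeta>"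
proof -
  have "\<forall>p\<in>topspace X. \<forall>\<xi>\<in>tangent_space P p. \<forall>\<eta>\<in>tangent_space P p.
        g p \<xi> \<eta> = g p \<eta> \<xi> \<and> (\<xi> \<noteq> (\<lambda>_. 0) \<longrightarrow> 0 < g p \<xi> \<xi>) \<and>
        (\<forall>\<zeta>\<in>tangent_space P p. \<forall>a b.
           g p (\<lambda>c. a *\<^sub>R \<xi> c + b *\<^sub>R \<eta> c) \<zeta> = a * g p \<xi> \<zeta> + b * g p \<eta> \<zeta>)"
    using metric unfolding riemannian_metric_def by (rule conjunct1)
  from bspec[OF bspec[OF bspec[OF this assms(1)] assms(2)] assms(3)]
  show "g p \<xi> \<eta> = g p \<eta> \<xi>" "\<xi> \<noteq> (\<lambda>_. 0) \<Longrightarrow> 0 < g p \<xi> \<xi>"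
    "\<zeta> \<in> tangent_space P p \<Longrightarrow> g p (\<lambda>c. a *\<^sub>R \<xi> c + b *\<^sub>R \<eta> c) \<zeta> = a * g p \<xi> \<zeta> + b * g p \<eta> \<zeta>"
    by blast+
qed

text \<open>On unit coordinate vectors over the compact set \<open>K\<close> the metric is
  continuous and positive, hence has positive extrema; homogeneity covers all vectors.\<close>

lemma metric_chart_bounds:
  assumes c: "(U, f) \<in> P" and K: "compact K" "K \<subseteq> f ` U"
  obtains a b where "0 < a" "0 < b"
    "\<And>p \<xi>. p \<in> U \<Longrightarrow> f p \<in> K \<Longrightarrow> \<xi> \<in> tangent_space P p \<Longrightarrow> a * norm (\<xi> (U, f)) \<le> sqrt (g p \<xi> \<xi>)"
    "\<And>p \<xi>. p \<in> U \<Longrightarrow> f p \<in> K \<Longrightarrow> \<xi> \<in> tangent_space P p \<Longrightarrow> sqrt (g p \<xi> \<xi>) \<le> b * norm (\<xi> (U, f))"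
proof (cases "K = {}")
  case True
  then show thesis using that[of 1 1] by simp
next
  case False
  have "\<forall>(U, f)\<in>P. \<exists>G. (\<forall>u w. smooth_on (f ` U) (\<lambda>y. G y u w)) \<and>
        (\<forall>p\<in>U. \<forall>\<xi>\<in>tangent_space P p. \<forall>\<eta>\<in>tangent_space P p.
           g p \<xi> \<eta> = G (f p) (\<xi> (U, f)) (\<eta> (U, f)))"
    using metric unfolding riemannian_metric_def by (rule conjunct2)
  from bspec[OF this c] have "\<exists>G. (\<forall>u w. smooth_on (f ` U) (\<lambda>y. G y u w)) \<and>
        (\<forall>p\<in>U. \<forall>\<xi>\<in>tangent_space P p. \<forall>\<eta>\<in>tangent_space P p.
           g p \<xi> \<eta> = G (f p) (\<xi> (U, f)) (\<eta> (U, f)))" by simp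
  then obtain G where G: "\<And>u w. smooth_on (f ` U) (\<lambda>y. G y u w)"
    "\<And>p \<xi> \<eta>. p \<in> U \<Longrightarrow> \<xi> \<in> tangent_space P p \<Longrightarrow> \<eta> \<in> tangent_space P p \<Longrightarrow>
      g p \<xi> \<eta> = G (f p) (\<xi> (U, f)) (\<eta> (U, f))" by blast
  \<comment> \<open>\<open>G\<close> is tied to \<open>g\<close> only on coordinates of tangent
    vectors. All coordinate vectors arise in this way, so the algebra of \<open>g\<close> carries
    over to \<open>G\<close> at points of \<open>K\<close>.\<close>
  have lin: "G y (r *\<^sub>R u + s *\<^sub>R w) z = r * G y u z + s * G y w z"
    and sym: "G y u w = G y w u" and pos: "u \<noteq> 0 \<Longrightarrow> 0 < G y u u"
    if y: "y \<in> K" for y u w z r s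
  proof -
    obtain p where p: "p \<in> U" "y = f p" using y K by blast
    then have pX: "p \<in> topspace X" using c chart_in_topspace by blast
    obtain \<xi> \<eta> \<zeta> where v: "\<xi> \<in> tangent_space P p" "\<xi> (U, f) = u" "\<eta> \<in> tangent_space P p" "\<eta> (U, f) = w"
      "\<zeta> \<in> tangent_space P p" "\<zeta> (U, f) = z"
      using tangent_vector_exists[OF c p(1)] by metis
    have "g p (\<lambda>c. r *\<^sub>R \<xi> c + s *\<^sub>R \<eta> c) \<zeta> = r * g p \<xi> \<zeta> + s * g p \<eta> \<zeta>"
      by (rule metric_algebra(3)[OF pX v(1,3,5)])
    then show "G y (r *\<^sub>R u + s *\<^sub>R w) z = r * G y u z + s * G y w z"
      using G(2)[OF p(1) tangent_space_lincomb[OF v(1,3)] v(5), of r s]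
        G(2)[OF p(1) v(1,5)] G(2)[OF p(1) v(3,5)] v p by simp
    show "G y u w = G y w u"
      using metric_algebra(1)[OF pX v(1,3)] G(2)[OF p(1) v(1,3)] G(2)[OF p(1) v(3,1)] v p by simp
    assume "u \<noteq> 0"
    then have "\<xi> \<noteq> (\<lambda>_. 0)" using v by auto
    then show "0 < G y u u"
      using metric_algebra(2)[OF pX v(1,1)] G(2)[OF p(1) v(1,1)] v p by simp
  qed
  have linG: "linear (\<lambda>u. G y u z)" if "y \<in> K" for y z
    using lin[OF that, of 1 _ 1 _ z] lin[OF that, of _ _ 0 0 z] by (intro linearI) auto
  \<comment> \<open>Smoothness of \<open>G\<close> is given for fixed vectors only; the finite sum
    over its matrix entries makes joint continuity visible.\<close>
  define q where "q y u = (\<Sum>i\<in>Basis. (u \<bullet> i) * (\<Sum>j\<in>Basis. (u \<bullet> j) * G y j i))" for y u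
  have q: "G y u u = q y u" if y: "y \<in> K" for y u
  proof -
    have 1: "G y u z = (\<Sum>j\<in>Basis. (u \<bullet> j) * G y j z)" for u z
    proof -
      have "G y (\<Sum>j\<in>Basis. (u \<bullet> j) *\<^sub>R j) z = (\<Sum>j\<in>Basis. (u \<bullet> j) * G y j z)"
        by (simp add: linear_sum[OF linG[OF y]] linear_cmul[OF linG[OF y]])
      then show ?thesis by (simp add: euclidean_representation)
    qed
    have "G y u u = (\<Sum>i\<in>Basis. (u \<bullet> i) * G y i u)" by (rule 1)
    also have "\<dots> = q y u" unfolding q_def using 1[of u] sym[OF y] by simp
    finally show ?thesis .
  qed
  have "continuous_on (K \<times> sphere 0 1) (\<lambda>z. q (fst z) (snd z))"
    unfolding q_def
  proof (intro continuous_intros)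
    fix i j :: 'e
    have "continuous_on (K \<times> sphere 0 1) ((\<lambda>y. G y j i) \<circ> (fst :: 'e \<times> 'e \<Rightarrow> 'e))"
      by (intro continuous_on_compose continuous_intros
          continuous_on_subset[OF smooth_on_continuous[OF G(1)[of j i]]]) (use K in auto)
    then show "continuous_on (K \<times> sphere 0 1) (\<lambda>z. G (fst (z :: 'e \<times> 'e)) j i)" by (simp add: o_def)
  qed
  moreover have "compact (K \<times> sphere (0 :: 'e) 1)" using K by (intro compact_Times) auto
  moreover have "K \<times> sphere (0 :: 'e) 1 \<noteq> {}" using False by simp
  ultimately obtain z1 z2 where z: "z1 \<in> K \<times> sphere 0 1" "z2 \<in> K \<times> sphere 0 1"
    "\<And>z. z \<in> K \<times> sphere 0 1 \<Longrightarrow> q (fst z1) (snd z1) \<le> q (fst z) (snd z)"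
    "\<And>z. z \<in> K \<times> sphere 0 1 \<Longrightarrow> q (fst z) (snd z) \<le> q (fst z2) (snd z2)"
    using continuous_attains_inf[of "K \<times> sphere 0 1" "\<lambda>z. q (fst z) (snd z)"]
      continuous_attains_sup[of "K \<times> sphere 0 1" "\<lambda>z. q (fst z) (snd z)"] by blast
  define m1 m2 where "m1 = q (fst z1) (snd z1)" and "m2 = q (fst z2) (snd z2)"
  have m: "0 < m1" "0 < m2"
    using z(1,2) pos[of "fst z1" "snd z1"] pos[of "fst z2" "snd z2"] q norm_zero
    by (auto simp: m1_def m2_def simp del: norm_zero) (metis norm_zero zero_neq_one)+
  have bounds: "sqrt m1 * norm u \<le> sqrt (G y u u) \<and> sqrt (G y u u) \<le> sqrt m2 * norm u" if y: "y \<in> K" for y u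
  proof (cases "u = 0")
    case True
    then show ?thesis using linear_0[OF linG[OF y]] by simp
  next
    case False
    define s where "s = sgn u"
    have u: "u = norm u *\<^sub>R s" and s: "s \<in> sphere 0 1" using False by (auto simp: s_def sgn_div_norm)
    have "G y u u = norm u * G y s u" by (subst (1) u) (rule linear_cmul[OF linG[OF y], simplified])
    also have "G y s u = norm u * G y s s"
      unfolding sym[OF y, of s u] by (subst (1) u) (rule linear_cmul[OF linG[OF y], simplified])
    finally have "G y u u = (norm u)\<^sup>2 * G y s s" by (simp add: power2_eq_square)
    then have "sqrt (G y u u) = norm u * sqrt (G y s s)" by (simp add: real_sqrt_mult)
    moreover have "m1 \<le> G y s s" "G y s s \<le> m2"
      using z(3,4)[of "(y, s)"] y s q[OF y] by (auto simp: m1_def m2_def)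
    then have "norm u * sqrt m1 \<le> norm u * sqrt (G y s s)" "norm u * sqrt (G y s s) \<le> norm u * sqrt m2"
      by (intro mult_left_mono real_sqrt_le_mono; simp)+
    ultimately show ?thesis by (simp only: mult.commute)
  qed
  show thesis
  proof (rule that[of "sqrt m1" "sqrt m2"])
    show "0 < sqrt m1" "0 < sqrt m2" using m by auto
    fix p \<xi> assume *: "p \<in> U" "f p \<in> K" "\<xi> \<in> tangent_space P p"
    then show "sqrt m1 * norm (\<xi> (U, f)) \<le> sqrt (g p \<xi> \<xi>)" "sqrt (g p \<xi> \<xi>) \<le> sqrt m2 * norm (\<xi> (U, f))"
      using bounds[OF *(2)] G(2)[OF *(1,3,3)] by simp_all
  qed
qed

text \<open>Only the piece up to \<open>\<tau>\<close>, which stays in the chart, is measured; the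
  rest contributes a nonnegative amount. This form suits curves that leave the chart later.\<close>

lemma curve_length_ge_chart:
  assumes c: "(U, f) \<in> P" and \<gamma>: "piecewise_C1_curve P \<gamma>" and \<tau>: "0 \<le> \<tau>" "\<tau> \<le> 1"
    and K: "\<And>t. t \<in> {0..\<tau>} \<Longrightarrow> \<gamma> t \<in> U \<and> f (\<gamma> t) \<in> K"
    and bound: "\<And>p \<xi>. p \<in> U \<Longrightarrow> f p \<in> K \<Longrightarrow> \<xi> \<in> tangent_space P p \<Longrightarrow> a * norm (\<xi> (U, f)) \<le> sqrt (g p \<xi> \<xi>)"
    and "0 \<le> a"
  shows "ennreal (a * norm (f (\<gamma> \<tau>) - f (\<gamma> 0))) \<le> curve_length P g \<gamma>"
proof -
  let ?v = "velocity P \<gamma> {0..1}"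
  let ?w = "\<lambda>t. sqrt (g (\<gamma> t) (?v t) (?v t))"
  obtain B where B: "finite B" and pc: "\<forall>(U, f)\<in>P. \<forall>s t. 0 \<le> s \<and> s < t \<and> t \<le> 1 \<and> {s<..<t} \<inter> B = {} \<and> \<gamma> ` {s..t} \<subseteq> U \<longrightarrow>
         (\<exists>D. continuous_on {s..t} D \<and>
           (\<forall>r\<in>{s..t}. ((f \<circ> \<gamma>) has_vector_derivative D r) (at r within {s..t})))"
    and path: "pathin X \<gamma>"
    using \<gamma> unfolding piecewise_C1_curve_def by blast
  define D where "D t = vector_derivative (f \<circ> \<gamma>) (at t)" for t
  \<comment> \<open>A small interval around \<open>t\<close> avoids the break points, so the curve
    is continuously differentiable in this chart there, with derivative \<open>D\<close>.\<close>
  have near: "\<exists>s1 s2. s1 < t \<and> t < s2 \<and> {s1..s2} \<subseteq> {0<..<\<tau>} \<and> continuous_on {s1<..<s2} D \<and>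
      (\<forall>r\<in>{s1<..<s2}. ((f \<circ> \<gamma>) has_vector_derivative D r) (at r))" if t: "t \<in> {0<..<\<tau>} - B" for t
  proof -
    have "open ({0<..<\<tau>} - B)" using B by (intro open_Diff finite_imp_closed) auto
    then obtain e where e: "0 < e" "cball t e \<subseteq> {0<..<\<tau>} - B" using t open_contains_cball by blast
    define s1 s2 where "s1 = t - e" and "s2 = t + e"
    have s: "s1 < t" "t < s2" "{s1..s2} \<subseteq> {0<..<\<tau>} - B"
      using e by (auto simp: s1_def s2_def cball_eq_atLeastAtMost)
    have "s1 \<in> {s1..s2}" "s2 \<in> {s1..s2}" using s by auto
    then have "s1 \<in> {0<..<\<tau>}" "s2 \<in> {0<..<\<tau>}" using s(3) by blast+
    moreover have "\<gamma> ` {s1..s2} \<subseteq> U" using s K \<tau> by fastforce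
    moreover have "{s1<..<s2} \<inter> B = {}"
      using s(3) greaterThanLessThan_subseteq_atLeastAtMost_iff[of s1 s2 s1 s2] by blast
    ultimately obtain D' where D': "continuous_on {s1..s2} D'"
      "\<And>r. r \<in> {s1..s2} \<Longrightarrow> ((f \<circ> \<gamma>) has_vector_derivative D' r) (at r within {s1..s2})"
    proof -
      have "0 \<le> s1" "s1 < s2" "s2 \<le> 1" using \<open>s1 \<in> {0<..<\<tau>}\<close> \<open>s2 \<in> {0<..<\<tau>}\<close> s(1,2) \<tau> by auto
      moreover have "\<forall>s t. 0 \<le> s \<and> s < t \<and> t \<le> 1 \<and> {s<..<t} \<inter> B = {} \<and> \<gamma> ` {s..t} \<subseteq> U \<longrightarrow>
         (\<exists>D. continuous_on {s..t} D \<and>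
           (\<forall>r\<in>{s..t}. ((f \<circ> \<gamma>) has_vector_derivative D r) (at r within {s..t})))"
        using bspec[OF pc c] by simp
      ultimately show ?thesis using \<open>\<gamma> ` {s1..s2} \<subseteq> U\<close> \<open>{s1<..<s2} \<inter> B = {}\<close> that by blast
    qed
    have der: "((f \<circ> \<gamma>) has_vector_derivative D' r) (at r)" if "r \<in> {s1<..<s2}" for r
      using D'(2)[of r] that by (simp add: at_within_Icc_at)
    then have eq: "D r = D' r" if "r \<in> {s1<..<s2}" for r
      using that by (simp add: D_def vector_derivative_at)
    have "continuous_on {s1<..<s2} D'" by (rule continuous_on_subset[OF D'(1)]) auto
    then have "continuous_on {s1<..<s2} D" using eq by (simp cong: continuous_on_cong_simp)
    then show ?thesis using s der eq by (intro exI[of _ s1] exI[of _ s2]) auto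
  qed
  have der: "((f \<circ> \<gamma>) has_vector_derivative D t) (at t)" if "t \<in> {0<..<\<tau>} - B" for t
    using near[OF that] by fastforce
  have D: "continuous_on ({0<..<\<tau>} - B) D"
  proof (rule continuous_at_imp_continuous_on, rule ballI)
    fix t assume "t \<in> {0<..<\<tau>} - B"
    then obtain s1 s2 where "s1 < t" "t < s2" "continuous_on {s1<..<s2} D" using near by blast
    then show "isCont D t" by (simp add: continuous_on_eq_continuous_at)
  qed
  have cont: "continuous_on {0..\<tau>} (f \<circ> \<gamma>)"
  proof -
    have "continuous_map (subtopology (top_of_set {0..1}) {0..\<tau>}) (subtopology X U) \<gamma>"
      using path K unfolding pathin_def
      by (auto simp: continuous_map_in_subtopology intro: continuous_map_from_subtopology)
    then have "continuous_map (subtopology (top_of_set {0..1}) {0..\<tau>}) euclidean (f \<circ> \<gamma>)"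
      by (rule continuous_map_compose[OF _ chart_continuous_map[OF c]])
    moreover have "subtopology (top_of_set {0..1}) {0..\<tau>} = top_of_set {0..\<tau>}"
      using \<tau> by (simp add: subtopology_subtopology Int_absorb1)
    ultimately show ?thesis by simp
  qed
  have le: "a * norm (D t) \<le> ?w t" if t: "t \<in> {0<..<\<tau>} - B" for t
  proof -
    have t01: "t \<in> {0..1}" "t \<in> {0..\<tau>}" using t \<tau> by auto
    have "\<forall>\<^sub>F s in at t. s \<in> {0<..<\<tau>}"
      using t by (intro eventually_at_in_open') auto
    then have "\<forall>\<^sub>F s in at t. \<gamma> s \<in> U"
      by eventually_elim (use K in auto)
    then have 1: "\<forall>\<^sub>F s in at t within {0..1}. \<gamma> s \<in> U"
      using at_le[of "{0..1}" UNIV t] by (simp add: filter_leD)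
    have 2: "at t within {0..1} \<noteq> bot" using t01 by (simp add: trivial_limit_within islimpt_Icc)
    have v: "?v t \<in> tangent_space P (\<gamma> t)" "?v t (U, f) = D t"
      using velocity_chart[OF c t01(1) conjunct1[OF K[OF t01(2)]] 2 1
          has_vector_derivative_at_within[OF der[OF t]]] by auto
    show ?thesis using bound[of "\<gamma> t" "?v t"] v K[OF t01(2)] by simp
  qed
  have "ennreal (a * norm ((f \<circ> \<gamma>) \<tau> - (f \<circ> \<gamma>) 0)) \<le> (\<integral>\<^sup>+ t\<in>{0..\<tau>}. ennreal (?w t) \<partial>lborel)"
    using vector_derivative_integral_le[OF B \<tau>(1) cont der D le \<open>0 \<le> a\<close>] .
  also have "\<dots> \<le> curve_length P g \<gamma>"
    unfolding curve_length_def
    by (intro nn_integral_mono mult_left_mono) (use \<tau> in \<open>auto simp: indicator_def\<close>)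
  finally show ?thesis by simp
qed

end

section \<open>Riemannian distance in charts\<close>

lemma smooth_on_derivative_bound:
  fixes f :: "'a::euclidean_space \<Rightarrow> 'b::real_normed_vector"
  assumes f: "smooth_on S f" and K: "compact K" "K \<subseteq> S"
  obtains B where "0 < B" "\<And>x v. x \<in> K \<Longrightarrow> norm (frechet_derivative f (at x) v) \<le> B * norm v"
proof -
  have "continuous_on (K \<times> sphere 0 1) (\<lambda>(x, v). frechet_derivative f (at x) v)"
    by (rule continuous_on_subset[OF smooth_on_derivative_jointly_continuous[OF f]]) (use K in auto)
  moreover have "compact (K \<times> sphere (0 :: 'a) 1)" using K by (intro compact_Times) auto
  ultimately have "bounded ((\<lambda>(x, v). frechet_derivative f (at x) v) ` (K \<times> sphere 0 1))"
    using compact_continuous_image compact_imp_bounded by blast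
  then obtain B where B: "0 < B" "\<And>x v. x \<in> K \<Longrightarrow> norm v = 1 \<Longrightarrow> norm (frechet_derivative f (at x) v) \<le> B"
    unfolding bounded_pos by fastforce
  have "norm (frechet_derivative f (at x) v) \<le> B * norm v" if x: "x \<in> K" for x v
  proof (cases "v = 0")
    case True
    have "linear (frechet_derivative f (at x))"
      using smooth_on_has_derivative[OF f] x K has_derivative_linear by blast
    then show ?thesis using True linear_0 by fastforce
  next
    case False
    have lin: "linear (frechet_derivative f (at x))"
      using smooth_on_has_derivative[OF f] x K has_derivative_linear by blast
    have "norm (frechet_derivative f (at x) (sgn v)) \<le> B" using B(2)[OF x] False by (simp add: norm_sgn)
    then show ?thesis
      using False by (simp add: sgn_div_norm linear_cmul[OF lin] field_simps)
  qed
  then show thesis using that B(1) by blast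
qed

lemma smooth_on_lipschitz:
  fixes f :: "'a::euclidean_space \<Rightarrow> 'b::real_normed_vector"
  assumes f: "smooth_on S f" and K: "compact K" "K \<subseteq> S" "convex K"
  obtains L where "0 < L" "\<And>x y. x \<in> K \<Longrightarrow> y \<in> K \<Longrightarrow> norm (f x - f y) \<le> L * norm (x - y)"
proof -
  obtain B where B: "0 < B" "\<And>x v. x \<in> K \<Longrightarrow> norm (frechet_derivative f (at x) v) \<le> B * norm v"
    using smooth_on_derivative_bound[OF f K(1,2)] by blast
  have "norm (f x - f y) \<le> B * norm (x - y)" if "x \<in> K" "y \<in> K" for x y
  proof (rule differentiable_bound[OF K(3) _ _ that])
    show "(f has_derivative frechet_derivative f (at z)) (at z within K)" if "z \<in> K" for z
      using smooth_on_has_derivative[OF f, of z] K that by (auto intro: has_derivative_at_withinI)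
    show "onorm (frechet_derivative f (at z)) \<le> B" if "z \<in> K" for z
      using B(2)[OF that] by (rule onorm_le)
  qed
  then show thesis using that B(1) by blast
qed

context riemannian_manifold
begin

text \<open>The set is compact as an image of \<open>K\<close> under the inverse chart, and
  Hausdorffness makes it closed in the whole manifold, not only relative to
  \<open>U\<close>.\<close>

lemma chart_preimage_closedin:
  assumes c: "(U, f) \<in> P" and K: "compact K" "K \<subseteq> f ` U"
  shows "closedin X {p \<in> U. f p \<in> K}"
proof -
  have "compactin (top_of_set (f ` U)) K" using K by (simp add: compactin_subtopology)
  then have "compactin X (inv_into U f ` K)"
    by (rule image_compactin[OF _ chart_inv_continuous_map[OF c]])
  moreover have "inv_into U f ` K = {p \<in> U. f p \<in> K}"
  proof (intro equalityI subsetI)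
    fix p assume "p \<in> inv_into U f ` K"
    then show "p \<in> {p \<in> U. f p \<in> K}" using K(2) by (auto simp: inv_into_into f_inv_into_f subset_iff)
  next
    fix p assume "p \<in> {p \<in> U. f p \<in> K}"
    then show "p \<in> inv_into U f ` K" using chart_inj[OF c] by (intro image_eqI[of _ _ "f p"]) auto
  qed
  ultimately show ?thesis using Hausdorff compactin_imp_closedin by auto
qed

text \<open>Either the curve stays in the coordinate ball and its length controls the Euclidean
  distance of the ends, or it crosses the shell between radii \<open>r / 2\<close> and
  \<open>3 * r / 4\<close> before leaving, which already costs \<open>a * r / 4\<close>.\<close>

lemma curve_length_dichotomy:
  assumes c: "(U, f) \<in> P" and r: "0 < r" "cball y0 r \<subseteq> f ` U"
    and bound: "\<And>p \<xi>. p \<in> U \<Longrightarrow> f p \<in> cball y0 r \<Longrightarrow> \<xi> \<in> tangent_space P p \<Longrightarrow>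
      a * norm (\<xi> (U, f)) \<le> sqrt (g p \<xi> \<xi>)"
    and "0 < a" and \<gamma>: "piecewise_C1_curve P \<gamma>"
    and start: "\<gamma> 0 \<in> U" "f (\<gamma> 0) \<in> ball y0 (r / 2)"
  shows "\<gamma> 1 \<in> U \<and> f (\<gamma> 1) \<in> ball y0 r \<and> ennreal (a * norm (f (\<gamma> 1) - f (\<gamma> 0))) \<le> curve_length P g \<gamma> \<or>
    ennreal (a * r / 4) \<le> curve_length P g \<gamma>"
proof -
  define Q where "Q = {p \<in> U. f p \<in> ball y0 r}"
  have path: "continuous_map (top_of_set {0..1}) X \<gamma>"
    using \<gamma> by (simp add: piecewise_C1_curve_def pathin_def)
  have lower: "ennreal (a * norm (f (\<gamma> t) - f (\<gamma> 0))) \<le> curve_length P g \<gamma>"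
    if "0 \<le> t" "t \<le> 1" "\<And>s. s \<in> {0..t} \<Longrightarrow> \<gamma> s \<in> Q" for t
    by (rule curve_length_ge_chart[where K = "cball y0 r", OF c \<gamma> that(1,2) _ bound]) (use that(3) \<open>0 < a\<close> in \<open>auto simp: Q_def less_imp_le\<close>)
  have closed: "closed {t \<in> {0..1}. \<gamma> t \<in> C}" if "closedin X C" for C
  proof -
    have "closedin (top_of_set {0..1}) {t \<in> topspace (top_of_set {0..1}). \<gamma> t \<in> C}"
      by (rule closedin_continuous_map_preimage[OF path that])
    then show ?thesis by (simp add: closedin_closed_trans)
  qed
  show ?thesis
  proof (cases "\<forall>t\<in>{0..1}. \<gamma> t \<in> Q")
    case True
    then show ?thesis using lower[of 1] by (auto simp: Q_def)
  next
    case False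
    let ?S = "{t \<in> {0..1}. \<gamma> t \<in> topspace X - Q}"
    have "openin X Q" unfolding Q_def by (rule chart_preimage_openin[OF c]) simp
    then have "closed ?S" by (intro closed) (simp add: closedin_diff)
    moreover have "bounded ?S" by (rule bounded_subset[of "{0..1}"]) auto
    ultimately have "compact ?S" by (simp add: compact_eq_bounded_closed)
    moreover have "?S \<noteq> {}" using False path unfolding continuous_map_def by fastforce
    ultimately obtain \<tau> where \<tau>: "\<tau> \<in> ?S" "\<And>t. t \<in> ?S \<Longrightarrow> \<tau> \<le> t"
      using compact_attains_inf[of ?S] by blast
    have before: "\<gamma> s \<in> Q" if "0 \<le> s" "s < \<tau>" for s
      using \<tau>(1) \<tau>(2)[of s] that path unfolding continuous_map_def by force
    have "\<gamma> 0 \<in> Q" using start r(1) by (auto simp: Q_def)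
    then have "\<tau> \<noteq> 0" using \<tau>(1) by auto
    then have "0 < \<tau>" using \<tau>(1) by auto
    \<comment> \<open>At the exit time \<open>f (\<gamma> \<tau>)\<close> may be meaningless. But if
      all earlier points stayed within \<open>3 * r / 4\<close>, closedness of that smaller ball in
      the manifold would keep \<open>\<gamma> \<tau>\<close> inside as well.\<close>
    have "\<exists>t. 0 \<le> t \<and> t < \<tau> \<and> 3 * r / 4 < dist y0 (f (\<gamma> t))"
    proof (rule ccontr)
      assume no: "\<not> ?thesis"
      let ?C = "{p \<in> U. f p \<in> cball y0 (3 * r / 4)}"
      have sub: "cball y0 (3 * r / 4) \<subseteq> cball y0 r" using r(1) by (intro subset_cball) simp
      have "closedin X ?C" by (rule chart_preimage_closedin[OF c]) (use sub r(2) in auto)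
      then have cl: "closed {t \<in> {0..1}. \<gamma> t \<in> ?C}" by (rule closed)
      have "{0..<\<tau>} \<subseteq> {t \<in> {0..1}. \<gamma> t \<in> ?C}"
        using no before \<tau>(1) by (auto simp: Q_def not_less)
      then have "closure {0..<\<tau>} \<subseteq> {t \<in> {0..1}. \<gamma> t \<in> ?C}" using cl by (rule closure_minimal)
      then have "\<gamma> \<tau> \<in> ?C" using \<open>0 < \<tau>\<close> by (auto simp: subset_iff)
      then have "\<gamma> \<tau> \<in> Q" using r(1) by (auto simp: Q_def)
      then show False using \<tau>(1) by simp
    qed
    then obtain t where t: "0 \<le> t" "t < \<tau>" "3 * r / 4 < dist y0 (f (\<gamma> t))" by blast
    have "dist y0 (f (\<gamma> t)) \<le> dist y0 (f (\<gamma> 0)) + norm (f (\<gamma> t) - f (\<gamma> 0))"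
      by (metis dist_commute dist_norm dist_triangle)
    then have "r / 4 \<le> norm (f (\<gamma> t) - f (\<gamma> 0))" using t(3) start(2) by simp
    then have "a * (r / 4) \<le> a * norm (f (\<gamma> t) - f (\<gamma> 0))"
      using \<open>0 < a\<close> by (intro mult_left_mono) auto
    then have "ennreal (a * r / 4) \<le> ennreal (a * norm (f (\<gamma> t) - f (\<gamma> 0)))" by (intro ennreal_leI) simp
    also have "\<dots> \<le> curve_length P g \<gamma>"
      by (rule lower) (use t \<tau>(1) before in auto)
    finally show ?thesis by blast
  qed
qed

lemma riemannian_dist_ge_chart:
  assumes c: "(U, f) \<in> P" and r: "0 < r" "cball y0 r \<subseteq> f ` U"
  obtains a where "0 < a"
    "\<And>x m. x \<in> U \<Longrightarrow> f x \<in> ball y0 (r / 2) \<Longrightarrow> m \<in> U \<Longrightarrow> f m \<in> ball y0 r \<Longrightarrow>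
      ennreal (a * norm (f m - f x)) \<le> riemannian_dist P g x m"
    "\<And>x m. x \<in> U \<Longrightarrow> f x \<in> ball y0 (r / 2) \<Longrightarrow> \<not> (m \<in> U \<and> f m \<in> ball y0 r) \<Longrightarrow>
      ennreal a \<le> riemannian_dist P g x m"
proof -
  obtain a0 where a0: "0 < a0"
    "\<And>p \<xi>. p \<in> U \<Longrightarrow> f p \<in> cball y0 r \<Longrightarrow> \<xi> \<in> tangent_space P p \<Longrightarrow> a0 * norm (\<xi> (U, f)) \<le> sqrt (g p \<xi> \<xi>)"
    by (rule metric_chart_bounds[OF c compact_cball r(2)], rule that)
  \<comment> \<open>Points of the two balls have coordinates at most \<open>3 * r / 2\<close> apart,
    so the factor \<open>a0 / 6\<close> keeps the Euclidean bound below the cost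
    \<open>a0 * r / 4\<close> of leaving the ball.\<close>
  define a where "a = min (a0 / 6) (a0 * r / 4)"
  have a: "0 < a" "a \<le> a0 / 6" "a \<le> a0 * r / 4" using a0 r by (auto simp: a_def)
  have dich: "\<gamma> 1 \<in> U \<and> f (\<gamma> 1) \<in> ball y0 r \<and> ennreal (a0 * norm (f (\<gamma> 1) - f (\<gamma> 0))) \<le> curve_length P g \<gamma> \<or>
      ennreal (a0 * r / 4) \<le> curve_length P g \<gamma>"
    if "piecewise_C1_curve P \<gamma>" "\<gamma> 0 \<in> U" "f (\<gamma> 0) \<in> ball y0 (r / 2)" for \<gamma>
    by (rule curve_length_dichotomy[OF c r a0(2) a0(1) that])
  show thesis
  proof (rule that[OF a(1)])
    fix x m assume x: "x \<in> U" "f x \<in> ball y0 (r / 2)"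
    show "ennreal (a * norm (f m - f x)) \<le> riemannian_dist P g x m" if m: "m \<in> U" "f m \<in> ball y0 r"
      unfolding riemannian_dist_def
    proof (rule INF_greatest)
      fix \<gamma> assume "\<gamma> \<in> {\<gamma>. piecewise_C1_curve P \<gamma> \<and> \<gamma> 0 = x \<and> \<gamma> 1 = m}"
      then have \<gamma>: "piecewise_C1_curve P \<gamma>" "\<gamma> 0 = x" "\<gamma> 1 = m" by auto
      have "norm (f m - f x) \<le> dist y0 (f m) + dist y0 (f x)"
        by (metis dist_commute dist_norm dist_triangle)
      then have "norm (f m - f x) \<le> 3 * r / 2" using x(2) m(2) by simp
      then have "a * norm (f m - f x) \<le> (a0 / 6) * (3 * r / 2)"
        using a a0 r by (intro mult_mono) auto
      then have "a * norm (f m - f x) \<le> a0 * r / 4" by simp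
      moreover have "a * norm (f m - f x) \<le> a0 * norm (f m - f x)"
        using a a0 by (intro mult_right_mono) auto
      ultimately have "ennreal (a * norm (f m - f x)) \<le> ennreal (a0 * r / 4)"
        "ennreal (a * norm (f m - f x)) \<le> ennreal (a0 * norm (f m - f x))"
        by (simp_all only: ennreal_leI)
      then show "ennreal (a * norm (f m - f x)) \<le> curve_length P g \<gamma>"
        using dich[OF \<gamma>(1), unfolded \<gamma>(2,3), OF x] order_trans by blast
    qed
    show "ennreal a \<le> riemannian_dist P g x m" if m: "\<not> (m \<in> U \<and> f m \<in> ball y0 r)"
      unfolding riemannian_dist_def
    proof (rule INF_greatest)
      fix \<gamma> assume "\<gamma> \<in> {\<gamma>. piecewise_C1_curve P \<gamma> \<and> \<gamma> 0 = x \<and> \<gamma> 1 = m}"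
      then have \<gamma>: "piecewise_C1_curve P \<gamma>" "\<gamma> 0 = x" "\<gamma> 1 = m" by auto
      then have "ennreal (a0 * r / 4) \<le> curve_length P g \<gamma>"
        using dich[of \<gamma>] x m by auto
      then show "ennreal a \<le> curve_length P g \<gamma>"
        using ennreal_leI[OF a(3)] order_trans by blast
    qed
  qed
qed

text \<open>The infimum is at most the length of one explicit curve, whose speed never exceeds
  \<open>b * B\<close>.\<close>

lemma riemannian_dist_le_chart:
  assumes c: "(U, f) \<in> P" and K: "K \<subseteq> f ` U"
    and bound: "\<And>p \<xi>. p \<in> U \<Longrightarrow> f p \<in> K \<Longrightarrow> \<xi> \<in> tangent_space P p \<Longrightarrow>
      sqrt (g p \<xi> \<xi>) \<le> b * norm (\<xi> (U, f))"
    and "0 \<le> b"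
    and \<sigma>: "\<And>t. t \<in> {0..1} \<Longrightarrow> \<sigma> t \<in> K"
      "\<And>t. t \<in> {0..1} \<Longrightarrow> (\<sigma> has_vector_derivative \<sigma>' t) (at t within {0..1})"
      "continuous_on {0..1} \<sigma>'" "\<And>t. t \<in> {0..1} \<Longrightarrow> norm (\<sigma>' t) \<le> B"
  shows "riemannian_dist P g (inv_into U f (\<sigma> 0)) (inv_into U f (\<sigma> 1)) \<le> ennreal (b * B)"
proof -
  let ?\<gamma> = "inv_into U f \<circ> \<sigma>"
  have \<sigma>U: "\<And>t. t \<in> {0..1} \<Longrightarrow> \<sigma> t \<in> f ` U" using \<sigma>(1) K by blast
  note C = C1_chart_curve[OF c \<sigma>U \<sigma>(2,3)]
  have "riemannian_dist P g (inv_into U f (\<sigma> 0)) (inv_into U f (\<sigma> 1)) \<le> curve_length P g ?\<gamma>"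
    unfolding riemannian_dist_def by (rule INF_lower) (use C(1) in auto)
  also have "\<dots> \<le> (\<integral>\<^sup>+ t\<in>{0..1::real}. ennreal (b * B) \<partial>lborel)"
    unfolding curve_length_def
  proof (rule nn_integral_mono)
    fix t :: real
    let ?v = "velocity P ?\<gamma> {0..1} t"
    show "ennreal (sqrt (g (?\<gamma> t) ?v ?v)) * indicator {0..1} t \<le> ennreal (b * B) * indicator {0..1} t"
    proof (cases "t \<in> {0..1}")
      case True
      have "?\<gamma> t \<in> U" "f (?\<gamma> t) = \<sigma> t"
        using \<sigma>U[OF True] by (simp_all add: inv_into_into f_inv_into_f)
      then have "sqrt (g (?\<gamma> t) ?v ?v) \<le> b * norm (?v (U, f))"
        using bound[of "?\<gamma> t" ?v] C(2)[OF _ _ True] \<sigma>(1)[OF True] by simp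
      also have "\<dots> \<le> b * B"
        using C(3)[OF _ _ True] \<sigma>(4)[OF True] \<open>0 \<le> b\<close> by (simp add: mult_left_mono)
      finally show ?thesis by (intro mult_right_mono ennreal_leI) auto
    qed simp
  qed
  also have "\<dots> = ennreal (b * B)" by (simp add: nn_integral_cmult_indicator)
  finally show ?thesis .
qed

end

section \<open>The normal bundle near its null section\<close>

locale normal_conjugation = riemannian_manifold P g
  for P :: "('x, 'e::euclidean_space) chart set"
    and g :: "'x \<Rightarrow> ('x, 'e) tvec \<Rightarrow> ('x, 'e) tvec \<Rightarrow> real" +
  fixes T :: "real set" and \<phi> :: "real \<Rightarrow> 'x \<Rightarrow> 'x" and M A :: "'x set"
    and nm :: "'x \<times> ('x, 'e) tvec \<Rightarrow> real"
    and \<Phi> :: "real \<Rightarrow> 'x \<times> ('x, 'e) tvec \<Rightarrow> 'x \<times> ('x, 'e) tvec"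
    and N :: "('x \<times> ('x, 'e) tvec) set"
    and \<psi> :: "'x \<times> ('x, 'e) tvec \<Rightarrow> 'x"
  assumes compact_X: "compact_space (manifold_topology P)"
    and time: "is_time T" and flow: "flow_on T (manifold_topology P) \<phi>"
    and compact_M: "compactin (manifold_topology P) M"
    and isolated_M: "isolated_invariant T (manifold_topology P) \<phi> M"
    and norm: "bundle_norm (normal_bundle_topology P g M) nm"
    and N_openin: "openin (normal_bundle_topology P g M) N" and null_N: "null_section M \<subseteq> N"
    and A_openin: "openin (manifold_topology P) A" and M_A: "M \<subseteq> A"
    and diffeo: "diffeomorphism_between (tangent_atlas P) P N A \<psi>"
    and psi_null: "\<psi> ` null_section M = M"
    and linear: "linear_flow T (normal_bundle_topology P g M) \<Phi>"
    and conj: "conjugates_on T \<phi> \<Phi> N \<psi>"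
begin

abbreviation V where "V \<equiv> normal_bundle_topology P g M"
abbreviation NB where "NB \<equiv> normal_bundle P g M"

lemma M_subset: "M \<subseteq> topspace X"
  using compact_M compactin_subset_topspace by blast

text \<open>Needed because bilinearity of \<open>g\<close> is available on tangent vectors
  only.\<close>

lemma submanifold_tangent_space_subset: "submanifold_tangent_space P M p \<subseteq> tangent_space P p"
proof
  fix \<eta> assume "\<eta> \<in> submanifold_tangent_space P M p"
  then obtain \<gamma> e U f where \<eta>: "\<eta> = velocity P \<gamma> UNIV 0" "\<gamma> 0 = p" and e: "0 < e"
    and c: "(U, f) \<in> P" and im: "\<gamma> ` {-e<..<e} \<subseteq> M \<inter> U" and s: "smooth_on {-e<..<e} (f \<circ> \<gamma>)"
    unfolding submanifold_tangent_space_def by auto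
  have "(f \<circ> \<gamma>) differentiable (at 0)" using smooth_on_differentiable[OF s] e by simp
  then have D: "((f \<circ> \<gamma>) has_vector_derivative vector_derivative (f \<circ> \<gamma>) (at 0)) (at 0)"
    by (simp add: vector_derivative_works)
  have "\<forall>\<^sub>F t in at 0. t \<in> {-e<..<e}" using e by (intro eventually_at_in_open') auto
  then have "\<forall>\<^sub>F t in at 0. \<gamma> t \<in> U" by eventually_elim (use im in auto)
  moreover have "\<gamma> 0 \<in> U" using im e by force
  ultimately show "\<eta> \<in> tangent_space P p"
    using velocity_chart(1)[OF c _ _ _ _ D] \<eta> by simp
qed

lemma normal_bundle_iff:
  "(p, \<xi>) \<in> NB \<longleftrightarrow> p \<in> M \<and> \<xi> \<in> tangent_space P p \<and> (\<forall>\<eta>\<in>submanifold_tangent_space P M p. g p \<xi> \<eta> = 0)"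
  by (simp add: normal_bundle_def)

lemma normal_bundle_scale: "(p, \<xi>) \<in> NB \<Longrightarrow> (p, \<lambda>c. a *\<^sub>R \<xi> c) \<in> NB"
  unfolding normal_bundle_iff
proof (intro conjI ballI; elim conjE)
  assume p: "p \<in> M" and \<xi>: "\<xi> \<in> tangent_space P p"
  show "p \<in> M" by fact
  show "(\<lambda>c. a *\<^sub>R \<xi> c) \<in> tangent_space P p" using \<xi> by (rule tangent_space_scale)
  fix \<eta> assume \<eta>: "\<eta> \<in> submanifold_tangent_space P M p"
    and 0: "\<forall>\<eta>\<in>submanifold_tangent_space P M p. g p \<xi> \<eta> = 0"
  have "g p (\<lambda>c. a *\<^sub>R \<xi> c + 0 *\<^sub>R \<xi> c) \<eta> = a * g p \<xi> \<eta> + 0 * g p \<xi> \<eta>"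
    using metric_algebra(3)[OF _ \<xi> \<xi>] p M_subset \<eta> submanifold_tangent_space_subset by blast
  then show "g p (\<lambda>c. a *\<^sub>R \<xi> c) \<eta> = 0" using 0 \<eta> by simp
qed

lemma null_section_subset: "null_section M \<subseteq> NB"
proof
  fix z :: "'x \<times> ('x, 'e) tvec" assume "z \<in> null_section M"
  then obtain p where z: "z = (p, \<lambda>_. 0)" "p \<in> M" by (auto simp: null_section_def)
  have "g p (\<lambda>_. 0) \<eta> = 0" if "\<eta> \<in> submanifold_tangent_space P M p" for \<eta>
    using metric_algebra(3)[OF _ tangent_space_zero tangent_space_zero, of p \<eta> 0 0]
      z M_subset that submanifold_tangent_space_subset by auto
  then show "z \<in> NB" using z by (simp add: normal_bundle_iff tangent_space_zero)
qed

lemma NB_subset: "NB \<subseteq> topspace tangent.X"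
  using M_subset by (auto simp: normal_bundle_iff tangent_topspace)

lemma topspace_V: "topspace V = NB"
  using NB_subset by (auto simp: normal_bundle_topology_def)

lemma V_eq: "V = subtopology tangent.X NB"
  by (simp add: normal_bundle_topology_def)

lemma N_subset: "N \<subseteq> NB"
  using openin_subset[OF N_openin] topspace_V by simp

definition scale :: "real \<Rightarrow> 'x \<times> ('x, 'e) tvec \<Rightarrow> 'x \<times> ('x, 'e) tvec" where
  "scale a = (\<lambda>(p, \<xi>). (p, \<lambda>c. a *\<^sub>R \<xi> c))"

lemma scale_in: "v \<in> NB \<Longrightarrow> scale a v \<in> NB"
  using normal_bundle_scale by (auto simp: scale_def split_beta)

lemma scale_scale: "scale a (scale b v) = scale (a * b) v"
  by (simp add: scale_def split_beta)

lemma scale_1: "scale 1 v = v"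
  by (simp add: scale_def)

lemma scale_continuous: "continuous_map V V (scale a)"
  unfolding V_eq
  by (rule continuous_map_into_subtopology)
    (use tangent_scale_continuous scale_in in \<open>auto simp: scale_def intro: continuous_map_from_subtopology\<close>)

lemma norm_cont: "continuous_map V euclideanreal nm"
  using norm by (simp add: bundle_norm_def)

lemma norm_props:
  assumes "v \<in> NB"
  shows "0 \<le> nm v" "nm v = 0 \<longleftrightarrow> v \<in> null_section M" "nm (scale a v) = \<bar>a\<bar> * nm v"
proof -
  obtain p \<xi> where v: "v = (p, \<xi>)" by (cases v)
  have p: "p \<in> M" using assms v by (simp add: normal_bundle_iff)
  have "(p, \<xi>) \<in> topspace V" using assms v topspace_V by simp
  then have *: "0 \<le> nm (p, \<xi>) \<and> (nm (p, \<xi>) = 0 \<longleftrightarrow> \<xi> = (\<lambda>_. 0)) \<and> (\<forall>a. nm (p, \<lambda>c. a *\<^sub>R \<xi> c) = \<bar>a\<bar> * nm (p, \<xi>))"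
    using norm unfolding bundle_norm_def by blast
  then show "0 \<le> nm v" "nm (scale a v) = \<bar>a\<bar> * nm v" by (auto simp: v scale_def)
  have "v \<in> null_section M \<longleftrightarrow> \<xi> = (\<lambda>_. 0)" using p by (auto simp: v null_section_def)
  then show "nm v = 0 \<longleftrightarrow> v \<in> null_section M" using * v by simp
qed

lemma scale_zero: "v \<in> NB \<Longrightarrow> nm v = 0 \<Longrightarrow> scale 0 v = v"
  by (auto simp: norm_props(2) null_section_def scale_def)

lemma flow_V: "flow_on T V \<Phi>"
  using linear by (simp add: linear_flow_def)

lemma flow_scale:
  assumes "t \<in> T" "v \<in> NB"
  shows "\<Phi> t (scale a v) = scale a (\<Phi> t v)"
proof -
  obtain p \<xi> where v: "v = (p, \<xi>)" by (cases v)
  then have "(p, \<xi>) \<in> topspace V" using assms topspace_V by simp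
  then have "\<Phi> t (p, \<lambda>c. a *\<^sub>R \<xi> c + 0 *\<^sub>R \<xi> c) =
      (fst (\<Phi> t (p, \<xi>)), \<lambda>c. a *\<^sub>R snd (\<Phi> t (p, \<xi>)) c + 0 *\<^sub>R snd (\<Phi> t (p, \<xi>)) c)"
    using linear assms(1) unfolding linear_flow_def by blast
  then show ?thesis by (simp add: v scale_def split_beta)
qed

lemma V_Hausdorff: "Hausdorff_space V"
  unfolding V_eq by (intro Hausdorff_space_subtopology tangent_Hausdorff Hausdorff)

definition psi_inv :: "'x \<Rightarrow> 'x \<times> ('x, 'e) tvec" where "psi_inv = inv_into N \<psi>"

lemma psi_bij: "bij_betw \<psi> N A"
  using diffeo by (simp add: diffeomorphism_between_def)

lemma psi_smooth: "smooth_map_on (tangent_atlas P) P N \<psi>" and psi_inv_smooth: "smooth_map_on P (tangent_atlas P) A psi_inv"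
  using diffeo by (simp_all add: diffeomorphism_between_def psi_inv_def)

lemma psi_in: "v \<in> N \<Longrightarrow> \<psi> v \<in> A" and psi_inv_in: "x \<in> A \<Longrightarrow> psi_inv x \<in> N"
  and psi_inv_psi: "v \<in> N \<Longrightarrow> psi_inv (\<psi> v) = v" and psi_psi_inv: "x \<in> A \<Longrightarrow> \<psi> (psi_inv x) = x"
  using psi_bij by (auto simp: psi_inv_def bij_betw_def inv_into_into f_inv_into_f)

lemma psi_inj: "v \<in> N \<Longrightarrow> w \<in> N \<Longrightarrow> \<psi> v = \<psi> w \<Longrightarrow> v = w"
  by (metis psi_inv_psi)

lemma psi_in_M: "v \<in> N \<Longrightarrow> \<psi> v \<in> M \<longleftrightarrow> v \<in> null_section M"
  using psi_null null_N psi_inj by blast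

lemma A_subset: "A \<subseteq> topspace X"
  using openin_subset[OF A_openin] .

lemma psi_continuous: "continuous_map (subtopology V N) X \<psi>"
proof -
  have "subtopology V N = subtopology tangent.X N"
    using N_subset by (simp add: V_eq subtopology_subtopology Int_absorb1)
  then show ?thesis
    using smooth_map_on_continuous[OF tangent_atlas_topological topological_atlas_axioms psi_smooth] by simp
qed

lemma psi_inv_continuous: "continuous_map (subtopology X A) V psi_inv"
  unfolding V_eq
proof (rule continuous_map_into_subtopology)
  show "continuous_map (subtopology X A) tangent.X psi_inv"
    by (rule smooth_map_on_continuous[OF topological_atlas_axioms tangent_atlas_topological psi_inv_smooth])
  show "psi_inv \<in> topspace (subtopology X A) \<rightarrow> NB" using psi_inv_in N_subset by auto
qed

lemma psi_preimage_openin: "openin X Q \<Longrightarrow> openin V {v \<in> N. \<psi> v \<in> Q}"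
proof -
  assume "openin X Q"
  then have "openin (subtopology V N) {v \<in> topspace (subtopology V N). \<psi> v \<in> Q}"
    by (rule openin_continuous_map_preimage[OF psi_continuous])
  moreover have "topspace (subtopology V N) = N" using N_subset topspace_V by auto
  ultimately have "openin (subtopology V N) {v \<in> N. \<psi> v \<in> Q}" by (simp only:)
  then show ?thesis by (rule openin_trans_full[OF _ N_openin])
qed

lemma psi_image_openin:
  assumes "openin V W" "W \<subseteq> N"
  shows "openin X (\<psi> ` W)"
proof -
  have "openin (subtopology X A) {x \<in> topspace (subtopology X A). psi_inv x \<in> W}"
    by (rule openin_continuous_map_preimage[OF psi_inv_continuous assms(1)])
  moreover have "{x \<in> topspace (subtopology X A). psi_inv x \<in> W} = \<psi> ` W"
  proof (intro equalityI subsetI)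
    fix x assume "x \<in> {x \<in> topspace (subtopology X A). psi_inv x \<in> W}"
    then show "x \<in> \<psi> ` W" using psi_psi_inv[of x] by (metis (no_types, lifting) IntD2 imageI mem_Collect_eq topspace_subtopology)
  next
    fix x assume "x \<in> \<psi> ` W"
    then obtain v where "x = \<psi> v" "v \<in> W" by blast
    then show "x \<in> {x \<in> topspace (subtopology X A). psi_inv x \<in> W}"
      using assms(2) A_subset psi_in[of v] psi_inv_psi[of v] by auto
  qed
  ultimately show ?thesis using openin_trans_full[OF _ A_openin] by simp
qed

text \<open>Separating \<open>M\<close> from the complement of \<open>A\<close> in the compact
  Hausdorff space \<open>X\<close> leaves a compact set inside \<open>A\<close>, which
  \<open>psi_inv\<close> carries into the bundle.\<close>

lemma compact_neighbourhood:
  obtains K O' where "compactin V K" "openin V O'" "null_section M \<subseteq> O'" "O' \<subseteq> K" "K \<subseteq> N"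
proof -
  have "compactin X (topspace X - A)"
    using compact_X A_openin by (intro closedin_compact_space) (auto simp: closedin_diff)
  moreover have "disjnt M (topspace X - A)" using M_A by (auto simp: disjnt_def)
  ultimately obtain Q R where QR: "openin X Q" "openin X R" "M \<subseteq> Q" "topspace X - A \<subseteq> R" "disjnt Q R"
    using Hausdorff compact_M unfolding Hausdorff_space_compact_sets by metis
  define K where "K = topspace X - R"
  have "compactin X K" unfolding K_def using compact_X QR(2) by (intro closedin_compact_space) auto
  moreover have KA: "K \<subseteq> A" using QR(4) by (auto simp: K_def)
  ultimately have "compactin (subtopology X A) K" by (simp add: compactin_subtopology)
  then have "compactin V (psi_inv ` K)" by (rule image_compactin[OF _ psi_inv_continuous])
  moreover have "openin V {v \<in> N. \<psi> v \<in> Q}" by (rule psi_preimage_openin[OF QR(1)])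
  moreover have "null_section M \<subseteq> {v \<in> N. \<psi> v \<in> Q}" using null_N psi_null QR(3) by blast
  moreover have "{v \<in> N. \<psi> v \<in> Q} \<subseteq> psi_inv ` K"
  proof
    fix v assume "v \<in> {v \<in> N. \<psi> v \<in> Q}"
    then have "\<psi> v \<in> K" "psi_inv (\<psi> v) = v"
      using QR(5) openin_subset[OF QR(1)] by (auto simp: K_def disjnt_def psi_inv_psi)
    then show "v \<in> psi_inv ` K" by (metis imageI)
  qed
  moreover have "psi_inv ` K \<subseteq> N" using KA psi_inv_in by blast
  ultimately show thesis using that by blast
qed

lemma small_vectors_openin:
  assumes "0 < r"
  shows "openin V {v \<in> NB. nm v < r}" "null_section M \<subseteq> {v \<in> NB. nm v < r}"
proof -
  have "openin V {v \<in> topspace V. nm v \<in> {..<r}}"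
    by (rule openin_continuous_map_preimage[OF norm_cont]) simp
  then show "openin V {v \<in> NB. nm v < r}" by (simp add: topspace_V)
  show "null_section M \<subseteq> {v \<in> NB. nm v < r}"
  proof
    fix z :: "'x \<times> ('x, 'e) tvec" assume "z \<in> null_section M"
    then show "z \<in> {v \<in> NB. nm v < r}" using norm_props(2)[of z] null_section_subset assms by auto
  qed
qed

text \<open>In a bundle chart the base coordinate is constant and the fibre coordinate linear in
  \<open>s\<close>. Connectedness of the segment will rule out small vectors far from the null
  section.\<close>

lemma segment_continuous:
  assumes v: "v \<in> NB"
  shows "continuous_map euclideanreal V (\<lambda>s. scale s v)"
proof -
  obtain p \<xi> where p: "v = (p, \<xi>)" "p \<in> topspace X" "\<xi> \<in> tangent_space P p"
    using v M_subset by (cases v) (auto simp: normal_bundle_iff)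
  obtain U f where c: "(U, f) \<in> P" "p \<in> U" using chart_around p(2) by blast
  let ?W = "Sigma U (tangent_space P)" and ?F = "tchart U f"
  have "continuous_map euclideanreal (top_of_set (?F ` ?W)) (\<lambda>s. (f p, s *\<^sub>R \<xi> (U, f)))"
    using c tchart_image[OF c(1) subset_refl]
    by (auto simp: continuous_map_in_subtopology intro!: continuous_intros)
  from continuous_map_compose[OF this tangent.chart_inv_continuous_map[OF tchart_mem[OF c(1)]]]
  have "continuous_map euclideanreal tangent.X (inv_into ?W ?F \<circ> (\<lambda>s. (f p, s *\<^sub>R \<xi> (U, f))))" .
  moreover have "inv_into ?W ?F (f p, s *\<^sub>R \<xi> (U, f)) = scale s v" for s
  proof -
    have "scale s v \<in> ?W" "?F (scale s v) = (f p, s *\<^sub>R \<xi> (U, f))"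
      using p c by (auto simp: scale_def tchart_def tangent_space_scale)
    then show ?thesis using inv_into_f_f[OF tchart_inj[OF c(1)], of "scale s v"] by simp
  qed
  ultimately have "continuous_map euclideanreal tangent.X (\<lambda>s. scale s v)" by (simp add: o_def)
  then show ?thesis
    unfolding V_eq using scale_in[OF v] by (intro continuous_map_into_subtopology) auto
qed

text \<open>Small norm must force closeness to the null section, although \<open>nm\<close> is
  related to the topology by continuity alone. On the compact shell \<open>K - O'\<close> it has a
  positive minimum, and \<open>e\<close> is chosen below that.\<close>

lemma small_vectors:
  assumes W: "openin V W" "null_section M \<subseteq> W"
  obtains e where "0 < e" "{v \<in> NB. nm v \<le> e} \<subseteq> W" "compactin V {v \<in> NB. nm v \<le> e}"
proof -
  obtain K O0 where K: "compactin V K" "openin V O0" "null_section M \<subseteq> O0" "O0 \<subseteq> K" "K \<subseteq> N"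
    using compact_neighbourhood by blast
  define O' where "O' = O0 \<inter> W"
  have O': "openin V O'" "null_section M \<subseteq> O'" "O' \<subseteq> K" using K W by (auto simp: O'_def)
  have K_closed: "closedin V K" using compactin_imp_closedin[OF V_Hausdorff K(1)] .
  have "compactin V (K - O')" by (rule closed_compactin[OF K(1)]) (use K_closed O'(1) in auto)
  then have "compactin euclideanreal (nm ` (K - O'))" by (rule image_compactin[OF _ norm_cont])
  then have cmp: "compact (nm ` (K - O'))" by simp
  have pos: "0 < nm v" if "v \<in> K - O'" for v
  proof -
    have "v \<in> NB" "v \<notin> null_section M" using that K N_subset O' by auto
    then show ?thesis using norm_props(1,2)[of v] by linarith
  qed
  obtain e where e: "0 < e" "\<And>v. v \<in> K - O' \<Longrightarrow> e < nm v"
  proof (cases "K - O' = {}")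
    case True
    then show thesis by (intro that[of 1]) auto
  next
    case False
    then obtain v0 where "v0 \<in> K - O'" "\<And>v. v \<in> K - O' \<Longrightarrow> nm v0 \<le> nm v"
      using compact_attains_inf[OF cmp] by blast
    then show thesis using that[of "nm v0 / 2"] pos by fastforce
  qed
  (* The segment from 0 to v is connected and too short to meet K - O', so it cannot leave O'. *)
  have sub: "{v \<in> NB. nm v \<le> e} \<subseteq> O'"
  proof
    fix v assume "v \<in> {v \<in> NB. nm v \<le> e}"
    then have v: "v \<in> NB" "nm v \<le> e" by auto
    define S where "S = (\<lambda>s. scale s v) ` {0..1}"
    have "connectedin V S" unfolding S_def
      by (rule connectedin_continuous_map_image[OF segment_continuous[OF v(1)]]) simp
    moreover have "openin V (topspace V - K)" using K_closed by blast
    moreover have "S \<subseteq> O' \<union> (topspace V - K)"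
    proof
      fix w assume "w \<in> S"
      then obtain s where s: "0 \<le> s" "s \<le> 1" "w = scale s v" by (auto simp: S_def)
      have "nm w \<le> e"
        using s v norm_props(1)[OF v(1)] mult_left_le_one_le[of "nm v" s] by (simp add: norm_props(3))
      then have "w \<notin> K - O'" using e(2) by fastforce
      then show "w \<in> O' \<union> (topspace V - K)" using scale_in[OF v(1)] s topspace_V by auto
    qed
    moreover have "O' \<inter> (topspace V - K) \<inter> S = {}" using O'(3) by blast
    ultimately have "O' \<inter> S = {} \<or> (topspace V - K) \<inter> S = {}"
      using O'(1) unfolding connectedin by blast
    moreover have "scale 0 v \<in> O' \<inter> S"
    proof -
      have "nm (scale 0 v) = 0" using norm_props(3)[OF v(1)] by simp
      then have "scale 0 v \<in> O'" using norm_props(2)[OF scale_in[OF v(1)]] O'(2) by blast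
      then show ?thesis by (auto simp: S_def)
    qed
    moreover have "v \<in> S" unfolding S_def by (rule image_eqI[of _ _ 1]) (auto simp: scale_1)
    ultimately show "v \<in> O'" using \<open>S \<subseteq> O' \<union> (topspace V - K)\<close> by blast
  qed
  have "closedin V {v \<in> topspace V. nm v \<in> {..e}}"
    by (rule closedin_continuous_map_preimage[OF norm_cont]) simp
  then have "compactin V {v \<in> NB. nm v \<le> e}"
    using sub O'(3) by (intro closed_compactin[OF K(1)]) (auto simp: topspace_V)
  then show thesis using that[OF e(1)] sub by (auto simp: O'_def)
qed

section \<open>The linear flow on the normal bundle: isolation and repellers\<close>

sublocale cone_flow T V nm scale \<Phi>
proof
  show "is_time T" by (rule time)
  show "flow_on T V \<Phi>" by (rule flow_V)
  show "continuous_map V euclideanreal nm" by (rule norm_cont)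
  show "continuous_map V V (scale a)" for a by (rule scale_continuous)
  show "0 \<le> nm v" "nm (scale a v) = \<bar>a\<bar> * nm v" if "v \<in> topspace V" for a v
    using norm_props[of v] that topspace_V by auto
  show "scale 0 v = v" if "v \<in> topspace V" "nm v = 0" for v
    using scale_zero that topspace_V by simp
  show "\<Phi> t (scale a v) = scale a (\<Phi> t v)" if "t \<in> T" "v \<in> topspace V" for t a v
    using flow_scale that topspace_V by simp
  have "null_section M \<subseteq> topspace V" using null_section_subset topspace_V by simp
  then obtain e where e: "0 < e" "compactin V {v \<in> NB. nm v \<le> e}"
    using small_vectors[OF openin_topspace] by blast
  \<comment> \<open>A sufficiently small ball is compact by \<open>small_vectors\<close>; rescaling
    it yields the unit ball.\<close>
  have "{v \<in> topspace V. nm v \<le> 1} = scale (1 / e) ` {v \<in> NB. nm v \<le> e}"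
  proof (intro equalityI subsetI)
    fix v assume "v \<in> {v \<in> topspace V. nm v \<le> 1}"
    then have v: "v \<in> NB" "nm v \<le> 1" by (auto simp: topspace_V)
    then have "e * nm v \<le> e" using e(1) by (simp add: mult_left_le)
    then have "scale e v \<in> {v \<in> NB. nm v \<le> e}" using v e(1) by (simp add: scale_in norm_props)
    moreover have "v = scale (1 / e) (scale e v)" using e(1) by (simp add: scale_scale scale_1)
    ultimately show "v \<in> scale (1 / e) ` {v \<in> NB. nm v \<le> e}" by blast
  qed (use e(1) in \<open>auto simp: topspace_V scale_in norm_props field_simps\<close>)
  then show "compactin V {v \<in> topspace V. nm v \<le> 1}"
    using image_compactin[OF e(2) scale_continuous] by simp
qed

text \<open>Scaling shrinks a bounded orbit as a whole into the part of \<open>N\<close> that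
  \<open>\<psi>\<close> sends to the isolating neighbourhood. Its image is a full orbit there, hence
  in \<open>M\<close>, and only null vectors map into \<open>M\<close>.\<close>

lemma no_bounded_orbit:
  assumes v: "v \<in> topspace V" and bdd: "\<exists>R. \<forall>k::int. nm (\<Phi> (real_of_int k) v) \<le> R"
  shows "nm v = 0"
proof -
  obtain R where R: "\<And>k::int. nm (\<Phi> (real_of_int k) v) \<le> R" using bdd by blast
  obtain C where C: "1 \<le> C"
    "\<And>t v. t \<in> T \<Longrightarrow> \<bar>t\<bar> \<le> 1 \<Longrightarrow> v \<in> topspace V \<Longrightarrow> nm (\<Phi> t v) \<le> C * nm v"
    using nm_Phi_bound by blast
  have bound: "nm (\<Phi> t v) \<le> C * R" if t: "t \<in> T" for t
  proof -
    let ?k = "real_of_int \<lfloor>t\<rfloor>"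
    have k: "?k \<in> T" by (rule time_of_int[OF time])
    have "\<Phi> t v = \<Phi> (t - ?k) (\<Phi> ?k v)" using Phi_add[OF time_diff[OF time t k] k v] by simp
    moreover have "nm (\<Phi> (t - ?k) (\<Phi> ?k v)) \<le> C * nm (\<Phi> ?k v)"
      by (intro C(2) time_diff[OF time t k] Phi_in k v) linarith
    moreover have "C * nm (\<Phi> ?k v) \<le> C * R" using C(1) R by (intro mult_left_mono) auto
    ultimately show ?thesis by simp
  qed
  have "0 \<le> nm (\<Phi> (real_of_int 0) v)" by (rule nm_Phi_nonneg[OF time_of_int[OF time] v])
  then have "0 \<le> R" using R[of 0] by linarith
  obtain U where U: "openin X U" "M \<subseteq> U" "\<And>x. x \<in> U \<Longrightarrow> (\<forall>t\<in>T. \<phi> t x \<in> U) \<Longrightarrow> x \<in> M"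
    using isolated_M unfolding isolated_invariant_def by blast
  have "null_section M \<subseteq> {v \<in> N. \<psi> v \<in> U}" using null_N psi_null U(2) by blast
  then obtain e where e: "0 < e" "{v \<in> NB. nm v \<le> e} \<subseteq> {v \<in> N. \<psi> v \<in> U}"
    using small_vectors[OF psi_preimage_openin[OF U(1)]] by blast
  \<comment> \<open>\<open>C * R\<close> bounds the norm along the whole orbit at all times; adding
    1 avoids division by zero.\<close>
  define a where "a = e / (C * R + 1)"
  have CR: "0 \<le> C * R" using C(1) \<open>0 \<le> R\<close> by simp
  then have a: "0 < a" "a * (C * R) \<le> e" using e(1) by (auto simp: a_def field_simps)
  have vN: "v \<in> NB" using v topspace_V by simp
  define w where "w = scale a v"
  have wN: "w \<in> NB" unfolding w_def using scale_in[OF vN] .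
  have orbit: "\<Phi> t w \<in> N \<and> \<psi> (\<Phi> t w) \<in> U" if t: "t \<in> T" for t
  proof -
    have 1: "\<Phi> t v \<in> NB" using Phi_in[OF t v] topspace_V by simp
    have "nm (\<Phi> t w) = a * nm (\<Phi> t v)"
      using a(1) by (simp add: w_def flow_scale[OF t vN] norm_props(3)[OF 1])
    also have "\<dots> \<le> a * (C * R)" using bound[OF t] a(1) by (intro mult_left_mono) auto
    also have "\<dots> \<le> e" by (rule a(2))
    finally have "nm (\<Phi> t w) \<le> e" .
    moreover have "\<Phi> t w \<in> NB" using Phi_in[OF t, of w] wN topspace_V by simp
    ultimately show ?thesis using e(2) by blast
  qed
  have w0: "w \<in> N" "\<psi> w \<in> U" using orbit[OF time_zero[OF time]] Phi_zero[of w] wN topspace_V by auto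
  have "\<phi> t (\<psi> w) \<in> U" if "t \<in> T" for t
    using conj w0(1) orbit[OF that] that unfolding conjugates_on_def by fastforce
  then have "\<psi> w \<in> M" using U(3) w0(2) by blast
  then have "nm w = 0" using psi_in_M[OF w0(1)] norm_props(2)[OF wN] by simp
  then show ?thesis using a(1) by (simp add: w_def norm_props(3)[OF vN])
qed

lemma invariant_M: "t \<in> T \<Longrightarrow> \<phi> t ` M = M"
  using isolated_M unfolding isolated_invariant_def invariant_set_def by blast

lemma small_ball_closedin:
  assumes "0 < e" "{v \<in> NB. nm v \<le> e} \<subseteq> N" "compactin V {v \<in> NB. nm v \<le> e}" "r \<le> e"
  shows "closedin X (\<psi> ` {v \<in> NB. nm v \<le> r})"
proof -
  have "closedin V {v \<in> topspace V. nm v \<in> {..r}}"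
    by (rule closedin_continuous_map_preimage[OF norm_cont]) simp
  then have "compactin V {v \<in> NB. nm v \<le> r}"
    by (intro closed_compactin[OF assms(3)]) (use assms(4) in \<open>auto simp: topspace_V\<close>)
  then have "compactin (subtopology V N) {v \<in> NB. nm v \<le> r}"
    using assms(2,4) by (auto simp: compactin_subtopology)
  from image_compactin[OF this psi_continuous] show ?thesis
    by (rule compactin_imp_closedin[OF Hausdorff])
qed

text \<open>The vectors representing \<open>x\<close> for different radii coincide because
  \<open>\<psi>\<close> is injective on \<open>N\<close>, so their common norm is below every
  radius.\<close>

lemma in_M_if_in_small_balls:
  assumes e: "0 < e" "{v \<in> NB. nm v \<le> e} \<subseteq> N"
    and x: "\<And>r. 0 < r \<Longrightarrow> r \<le> e \<Longrightarrow> x \<in> \<psi> ` {v \<in> NB. nm v \<le> r}"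
  shows "x \<in> M"
proof -
  obtain v where v: "v \<in> NB" "nm v \<le> e" "x = \<psi> v" using x[OF e(1)] by auto
  then have vN: "v \<in> N" using e(2) by blast
  have "nm v = 0"
  proof (rule ccontr)
    assume "nm v \<noteq> 0"
    then have pos: "0 < nm v" using norm_props(1)[OF v(1)] by linarith
    then obtain w where w: "w \<in> NB" "nm w \<le> nm v / 2" "x = \<psi> w" using x[of "nm v / 2"] v by auto
    then have "w \<in> N" using e(2) v(2) pos by auto
    then have "w = v" using psi_inj vN v w by simp
    then show False using w pos by simp
  qed
  then show ?thesis using v psi_in_M[OF vN] norm_props(2)[OF v(1)] by simp
qed

lemma repeller_if_no_forward_bounded:
  assumes "\<And>v. forward_bounded v \<Longrightarrow> nm v = 0"
  shows "repeller T X \<phi> M"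
proof -
  obtain C :: real and n :: nat where C: "1 \<le> C" "1 \<le> n"
    "\<And>t m v. t \<in> T \<Longrightarrow> real (m * n) \<le> t \<Longrightarrow> v \<in> topspace V \<Longrightarrow> 2 ^ m * nm (\<Phi> (- t) v) \<le> C * nm v"
    using backward_contraction[OF assms] by blast
  obtain e where e: "0 < e" "{v \<in> NB. nm v \<le> e} \<subseteq> N" "compactin V {v \<in> NB. nm v \<le> e}"
    using small_vectors[OF N_openin null_N] by blast
  \<comment> \<open>Dividing by \<open>C\<close> compensates the constant of
    \<open>backward_contraction\<close>, so backward orbits from \<open>W\<close> never leave the
    ball of radius \<open>e\<close> inside \<open>N\<close>.\<close>
  define W where "W = {v \<in> NB. nm v < e / C}"
  have "0 < e / C" "e / C \<le> e" using e(1) C(1) by (simp_all add: field_simps)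
  note W = small_vectors_openin[OF \<open>0 < e / C\<close>, folded W_def]
  have WN: "W \<subseteq> N" using e(2) \<open>e / C \<le> e\<close> by (auto simp: W_def)
  define U where "U = \<psi> ` W"
  have U: "openin X U" "M \<subseteq> U"
    using psi_image_openin[OF W(1) WN] psi_null W(2) by (auto simp: U_def)
  let ?B = "\<lambda>s. \<Union>t\<in>{t \<in> T. s \<le> t}. \<phi> (- t) ` U"
  have contr: "?B (real (m * n)) \<subseteq> \<psi> ` {v \<in> NB. nm v \<le> e / 2 ^ m}" for m
  proof
    fix x assume "x \<in> ?B (real (m * n))"
    then obtain t v where t: "t \<in> T" "real (m * n) \<le> t" and v: "v \<in> W" "x = \<phi> (- t) (\<psi> v)"
      by (auto simp: U_def)
    have vV: "v \<in> topspace V" "nm v < e / C" using v by (auto simp: W_def topspace_V)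
    then have "C * nm v \<le> e" using C(1) by (simp add: field_simps)
    with C(3)[OF t vV(1)] have le: "nm (\<Phi> (- t) v) \<le> e / 2 ^ m" by (simp add: field_simps)
    also have "\<dots> \<le> e / 1" using e(1) by (intro divide_left_mono) auto
    finally have "nm (\<Phi> (- t) v) \<le> e" by simp
    moreover have NBt: "\<Phi> (- t) v \<in> NB" using Phi_in[OF time_uminus[OF time t(1)] vV(1)] topspace_V by simp
    ultimately have "\<Phi> (- t) v \<in> N" using e(2) by blast
    \<comment> \<open>Conjugacy asks only for the two endpoints in \<open>N\<close>, so it applies
      to the time \<open>- t\<close> in one stroke.\<close>
    then have "x = \<psi> (\<Phi> (- t) v)"
      using conj v WN time_uminus[OF time t(1)] unfolding conjugates_on_def by blast
    then show "x \<in> \<psi> ` {v \<in> NB. nm v \<le> e / 2 ^ m}" using le NBt by blast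
  qed
  have "(\<Inter>s\<in>T. X closure_of (?B s)) = M"
  proof (intro equalityI subsetI)
    fix x assume x: "x \<in> (\<Inter>s\<in>T. X closure_of (?B s))"
    have *: "x \<in> \<psi> ` {v \<in> NB. nm v \<le> e / 2 ^ m}" for m
    proof -
      have "e / 2 ^ m \<le> e / 1" using e(1) by (intro divide_left_mono) auto
      then have "closedin X (\<psi> ` {v \<in> NB. nm v \<le> e / 2 ^ m})"
        by (intro small_ball_closedin[OF e]) simp
      from closure_of_minimal[OF contr this] show ?thesis
        using x time_of_nat[OF time, of "m * n"] by blast
    qed
    show "x \<in> M"
    proof (rule in_M_if_in_small_balls[OF e(1,2)])
      fix r :: real assume "0 < r"
      have "(\<lambda>m. e * (1/2) ^ m) \<longlonglongrightarrow> e * 0" by (intro tendsto_intros) auto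
      then have "\<forall>\<^sub>F m in sequentially. e * (1/2) ^ m < r"
        using \<open>0 < r\<close> by (intro order_tendstoD(2)) auto
      then obtain m where "e * (1/2) ^ m < r" by (auto simp: eventually_sequentially)
      then show "x \<in> \<psi> ` {v \<in> NB. nm v \<le> r}" using *[of m] by (auto simp: power_one_over)
    qed
  next
    fix x assume "x \<in> M"
    show "x \<in> (\<Inter>s\<in>T. X closure_of (?B s))"
    proof
      fix s assume s: "s \<in> T"
      have "x \<in> \<phi> (- s) ` U"
        using invariant_M[OF time_uminus[OF time s]] \<open>x \<in> M\<close> U(2) by blast
      then have "x \<in> ?B s" using s by blast
      then show "x \<in> X closure_of (?B s)"
        using \<open>x \<in> M\<close> M_subset closure_of_subset_Int[of X "?B s"] by blast
    qed
  qed
  then show ?thesis unfolding repeller_def using U by blast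
qed

end

section \<open>Distance to the submanifold\<close>

context normal_conjugation
begin

lemma fst_continuous: "continuous_map V X fst"
  unfolding V_eq by (rule continuous_map_from_subtopology[OF tangent_fst_continuous])

lemma tchart_preimage_openin:
  assumes "(U, f) \<in> P" "open Q"
  shows "openin V {v \<in> NB. fst v \<in> U \<and> tchart U f v \<in> Q}"
proof -
  have "openin tangent.X {v \<in> Sigma U (tangent_space P). tchart U f v \<in> Q}"
    by (rule tangent.chart_preimage_openin[OF tchart_mem[OF assms(1)] assms(2)])
  moreover have "{v \<in> NB. fst v \<in> U \<and> tchart U f v \<in> Q} = {v \<in> Sigma U (tangent_space P). tchart U f v \<in> Q} \<inter> NB"
    by (auto simp: normal_bundle_iff)
  ultimately show ?thesis unfolding V_eq by (auto simp: openin_subtopology)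
qed

text \<open>Both norms are homogeneous on fibres, so it suffices to compare them on unit vectors,
  which form a compact set over a closed coordinate ball around \<open>p0\<close>.\<close>

lemma chart_norm_comparable:
  assumes c: "(U, f) \<in> P" and p0: "p0 \<in> U" "p0 \<in> M"
  obtains a b Q where "0 < a" "0 < b" "openin V Q" "(p0, \<lambda>_. 0) \<in> Q"
    "\<And>v. v \<in> Q \<Longrightarrow> fst v \<in> U"
    "\<And>v. v \<in> Q \<Longrightarrow> a * nm v \<le> norm (snd v (U, f))" "\<And>v. v \<in> Q \<Longrightarrow> norm (snd v (U, f)) \<le> b * nm v"
proof -
  obtain r where r: "0 < r" "cball (f p0) r \<subseteq> f ` U"
    using chart_image[OF c] p0 open_contains_cball by blast
  define C where "C = {p \<in> U. f p \<in> cball (f p0) r}"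
  have "closedin X C" unfolding C_def by (rule chart_preimage_closedin[OF c _ r(2)]) simp
  then have "closedin V {v \<in> topspace V. fst v \<in> C}"
    by (rule closedin_continuous_map_preimage[OF fst_continuous])
  then have "compactin V ({v \<in> topspace V. nm v = 1} \<inter> {v \<in> topspace V. fst v \<in> C})"
    using compact_Int_closedin[OF compact_sphere] by blast
  moreover define S where "S = {v \<in> NB. nm v = 1 \<and> fst v \<in> C}"
  moreover have "{v \<in> topspace V. nm v = 1} \<inter> {v \<in> topspace V. fst v \<in> C} = S"
    by (auto simp: S_def topspace_V)
  ultimately have "compactin tangent.X S" unfolding V_eq by (simp add: compactin_subtopology)
  moreover have "S \<subseteq> Sigma U (tangent_space P)" by (auto simp: S_def C_def normal_bundle_iff)
  ultimately have "compactin (subtopology tangent.X (Sigma U (tangent_space P))) S"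
    by (simp add: compactin_subtopology)
  from image_compactin[OF this tangent.chart_continuous_map[OF tchart_mem[OF c]]]
  have "compact (tchart U f ` S)" by simp
  then have "compact ((\<lambda>z. norm (snd z)) ` tchart U f ` S)"
    by (intro compact_continuous_image continuous_intros)
  moreover have "(\<lambda>z. norm (snd z)) ` tchart U f ` S = (\<lambda>v. norm (snd v (U, f))) ` S"
    by (simp add: image_image tchart_def split_beta)
  ultimately have cmp: "compact ((\<lambda>v. norm (snd v (U, f))) ` S)" by simp
  have pos: "0 < norm (snd v (U, f))" if v: "v \<in> S" for v
  proof -
    have "v \<in> NB" "nm v = 1" "fst v \<in> U" using v by (auto simp: S_def C_def)
    moreover have "snd v \<noteq> (\<lambda>_. 0)"
    proof
      assume "snd v = (\<lambda>_. 0)"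
      then have "v \<in> null_section M"
        using \<open>v \<in> NB\<close> by (cases v) (auto simp: null_section_def normal_bundle_iff)
      then show False using norm_props(2)[OF \<open>v \<in> NB\<close>] \<open>nm v = 1\<close> by simp
    qed
    moreover have "snd v \<in> tangent_space P (fst v)"
      using \<open>v \<in> NB\<close> by (cases v) (simp add: normal_bundle_iff)
    ultimately show ?thesis
      using tangent_space_eqI[OF _ tangent_space_zero c, of "snd v" "fst v"] by auto
  qed
  obtain a b where ab: "0 < a" "0 < b"
    "\<And>v. v \<in> S \<Longrightarrow> a \<le> norm (snd v (U, f))" "\<And>v. v \<in> S \<Longrightarrow> norm (snd v (U, f)) \<le> b"
  proof (cases "S = {}")
    case True
    then show thesis by (intro that[of 1 1]) auto
  next
    case False
    obtain v1 where v1: "v1 \<in> S" "\<And>v. v \<in> S \<Longrightarrow> norm (snd v1 (U, f)) \<le> norm (snd v (U, f))"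
      using compact_attains_inf[OF cmp] False by blast
    obtain v2 where v2: "v2 \<in> S" "\<And>v. v \<in> S \<Longrightarrow> norm (snd v (U, f)) \<le> norm (snd v2 (U, f))"
      using compact_attains_sup[OF cmp] False by blast
    show thesis using that[of "norm (snd v1 (U, f))" "norm (snd v2 (U, f))"] v1 v2 pos by blast
  qed
  define Q where "Q = {v \<in> topspace V. fst v \<in> {p \<in> U. f p \<in> ball (f p0) r}}"
  have bounds: "a * nm v \<le> norm (snd v (U, f)) \<and> norm (snd v (U, f)) \<le> b * nm v" if "v \<in> Q" for v
  proof (cases "nm v = 0")
    case True
    have "v \<in> NB" using that by (simp add: Q_def topspace_V)
    then have "v \<in> null_section M" using True norm_props(2) by simp
    then have "snd v (U, f) = 0" by (auto simp: null_section_def)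
    then show ?thesis using True by simp
  next
    case False
    have v: "v \<in> NB" "fst v \<in> C" using that by (auto simp: Q_def C_def topspace_V)
    then have n: "0 < nm v" using False norm_props(1)[OF v(1)] by linarith
    have "fst (unit v) = fst v" by (simp add: unit_def scale_def split_beta)
    then have "unit v \<in> S"
      using v n unit_in[of v] nm_unit[of v] by (simp add: S_def topspace_V)
    moreover have "norm (snd (unit v) (U, f)) = norm (snd v (U, f)) / nm v"
      using n by (simp add: unit_def scale_def split_beta)
    moreover from this have eq: "norm (snd v (U, f)) = norm (snd (unit v) (U, f)) * nm v" using n by simp
    ultimately show ?thesis using ab(3,4)[of "unit v"] n by (simp only: eq mult_right_mono less_imp_le)
  qed
  show thesis
  proof (rule that[OF ab(1,2), of Q])
    show "openin V Q" unfolding Q_def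
      by (rule openin_continuous_map_preimage[OF fst_continuous chart_preimage_openin[OF c]]) simp
    show "(p0, \<lambda>_. 0) \<in> Q"
      using p0 r null_section_subset by (auto simp: Q_def topspace_V null_section_def)
    show "fst v \<in> U" if "v \<in> Q" for v using that by (auto simp: Q_def)
  qed (use bounds in auto)
qed

text \<open>The path to \<open>M\<close> is the image under \<open>\<psi>\<close> of the segment
  from \<open>v\<close> to the null vector of its fibre; its length is at most a multiple of the
  fibre coordinate of \<open>v\<close>, hence of \<open>nm v\<close>.\<close>

lemma dist_to_M_le:
  assumes z: "z \<in> null_section M"
  obtains C Q where "0 < C" "openin V Q" "z \<in> Q" "Q \<subseteq> N"
    "\<And>v. v \<in> Q \<Longrightarrow> dist_to_set (riemannian_dist P g) (\<psi> v) M \<le> ennreal (C * nm v)"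
proof -
  obtain p0 where p0: "z = (p0, \<lambda>_. 0)" "p0 \<in> M" using z by (auto simp: null_section_def)
  have zN: "z \<in> N" using z null_N by blast
  obtain W F U f W0 H where WF: "(W, F) \<in> tangent_atlas P" and c: "(U, f) \<in> P"
    and zW: "z \<in> W" "\<psi> z \<in> U" and W0: "open W0" "F z \<in> W0" and H: "smooth_on W0 H"
    and loc: "\<And>q. q \<in> N \<Longrightarrow> q \<in> W \<Longrightarrow> F q \<in> W0 \<Longrightarrow> \<psi> q \<in> U \<and> f (\<psi> q) = H (F q)"
    using smooth_map_onD[OF psi_smooth zN] by (elim exE conjE) (rule that, assumption+, blast)
  obtain U1 f1 where c1: "(U1, f1) \<in> P" and W: "W = Sigma U1 (tangent_space P)" and F: "F = tchart U1 f1"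
    using WF unfolding tangent_atlas_iff by blast
  have p0U: "p0 \<in> U1" using zW p0 W by simp
  have Fz: "F z = (f1 p0, 0)" by (simp add: F p0 tchart_def)
  obtain N' where N': "openin tangent.X N'" "N = N' \<inter> NB"
    using N_openin unfolding V_eq openin_subtopology by blast
  \<comment> \<open>\<open>N\<close> need not be star-shaped, so the segment is kept in it by
    coordinates: a ball inside \<open>W1\<close> lies in the image of \<open>N'\<close> and in the
    domain of \<open>H\<close>, and \<open>H\<close> maps it into one chart of the manifold.\<close>
  define W1 where "W1 = F ` (N' \<inter> W) \<inter> (W0 \<inter> H -` (f ` U))"
  have "open W1" unfolding W1_def
    by (intro open_Int tangent.chart_image_openin[OF N'(1) WF]
        continuous_open_preimage[OF smooth_on_continuous[OF H] W0(1) chart_image[OF c]])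
  moreover have "F z \<in> W1"
    using zN N'(2) zW W0 loc[OF zN zW(1) W0(2)] unfolding W1_def by (auto intro: rev_image_eqI)
  ultimately obtain r where r: "0 < r" "cball (F z) r \<subseteq> W1" using open_contains_cball by blast
  define K where "K = H ` cball (F z) r"
  have rW0: "cball (F z) r \<subseteq> W0" using r(2) by (auto simp: W1_def)
  have K: "compact K" "K \<subseteq> f ` U"
  proof -
    show "compact K" unfolding K_def
      by (intro compact_continuous_image continuous_on_subset[OF smooth_on_continuous[OF H] rW0]) simp
    show "K \<subseteq> f ` U" using r(2) by (auto simp: K_def W1_def)
  qed
  obtain b where b: "0 < b"
    "\<And>p \<xi>. p \<in> U \<Longrightarrow> f p \<in> K \<Longrightarrow> \<xi> \<in> tangent_space P p \<Longrightarrow> sqrt (g p \<xi> \<xi>) \<le> b * norm (\<xi> (U, f))"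
    by (rule metric_chart_bounds[OF c K], rule that)
  obtain B where B: "0 < B" "\<And>y w. y \<in> cball (F z) r \<Longrightarrow> norm (frechet_derivative H (at y) w) \<le> B * norm w"
    using smooth_on_derivative_bound[OF H compact_cball rW0] by blast
  obtain a1 C1 Q1 where Q1': "0 < a1" "0 < C1" "openin V Q1" "(p0, \<lambda>_. 0) \<in> Q1"
    "\<And>v. v \<in> Q1 \<Longrightarrow> fst v \<in> U1"
    "\<And>v. v \<in> Q1 \<Longrightarrow> a1 * nm v \<le> norm (snd v (U1, f1))" "\<And>v. v \<in> Q1 \<Longrightarrow> norm (snd v (U1, f1)) \<le> C1 * nm v"
    by (rule chart_norm_comparable[OF c1 p0U p0(2)], rule that)
  note Q1 = Q1'(2,3) Q1'(4)[folded p0(1)] Q1'(7)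
  define Q where "Q = Q1 \<inter> {v \<in> NB. fst v \<in> U1 \<and> F v \<in> ball (F z) r}"
  have est: "v \<in> N \<and> dist_to_set (riemannian_dist P g) (\<psi> v) M \<le> ennreal (b * B * C1 * nm v)"
    if v: "v \<in> Q" for v
  proof -
    obtain p \<xi> where pv: "v = (p, \<xi>)" by (cases v)
    have vNB: "v \<in> NB" and pU: "p \<in> U1" and Fv: "F v \<in> ball (F z) r" and vQ1: "v \<in> Q1"
      using v by (auto simp: Q_def pv)
    have \<xi>: "\<xi> \<in> tangent_space P p" using vNB by (simp add: pv normal_bundle_iff)
    define u where "u = \<xi> (U1, f1)"
    have seg: "scale s v \<in> N \<and> F (scale s v) = (f1 p, s *\<^sub>R u) \<and> (f1 p, s *\<^sub>R u) \<in> cball (F z) r \<and>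
        \<psi> (scale s v) \<in> U \<and> f (\<psi> (scale s v)) = H (f1 p, s *\<^sub>R u)" if s: "s \<in> {0..1}" for s
    proof -
      have Fs: "F (scale s v) = (f1 p, s *\<^sub>R u)" by (simp add: F tchart_def scale_def pv u_def)
      have sW: "scale s v \<in> W" using pU \<xi> by (simp add: W scale_def pv tangent_space_scale)
      \<comment> \<open>The ball is centred at a null vector, so shrinking the fibre coordinate
        cannot leave it.\<close>
      have "dist (f1 p0, 0) (f1 p, s *\<^sub>R u) \<le> dist (f1 p0, 0) (f1 p, u)"
      proof -
        have "\<bar>s\<bar> * norm u \<le> 1 * norm u" using s by (intro mult_right_mono) auto
        then have "(norm (s *\<^sub>R u))\<^sup>2 \<le> (norm u)\<^sup>2" by (intro power_mono) auto
        then show ?thesis by (simp add: dist_Pair_Pair)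
      qed
      moreover have "dist (f1 p0, 0) (f1 p, u) < r"
        using Fv unfolding Fz by (simp add: F pv tchart_def u_def)
      ultimately have cb: "(f1 p, s *\<^sub>R u) \<in> cball (F z) r" by (simp add: Fz)
      then have "F (scale s v) \<in> F ` (N' \<inter> W)" using r(2) Fs unfolding W1_def by auto
      then obtain w where w: "w \<in> N'" "w \<in> W" "F (scale s v) = F w" by blast
      \<comment> \<open>Coordinates in \<open>W1\<close> come from \<open>N'\<close>; injectivity of
        the bundle chart returns this membership to the vector itself.\<close>
      then have sw: "scale s v = w" using tangent.chart_inj[OF WF] sW by (auto simp: inj_on_def)
      then have sN: "scale s v \<in> N" using w(1) N'(2) scale_in[OF vNB, of s] unfolding sw by blast
      have "\<psi> (scale s v) \<in> U \<and> f (\<psi> (scale s v)) = H (F (scale s v))"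
        using loc[OF sN sW] cb rW0 Fs by auto
      then show ?thesis using sN Fs cb by simp
    qed
    \<comment> \<open>The curve starts at \<open>v\<close> and reaches the null vector at time 1, so
      its fibre coordinate has derivative \<open>- u\<close>.\<close>
    define y where "y t = (f1 p, (1 - t) *\<^sub>R u)" for t :: real
    define \<sigma> where "\<sigma> t = H (y t)" for t
    define \<sigma>' where "\<sigma>' t = frechet_derivative H (at (y t)) (0, - u)" for t
    have y_in: "y t \<in> cball (F z) r" if "t \<in> {0..1}" for t
      using seg[of "1 - t"] that by (simp add: y_def)
    have y_cont: "continuous_on {0..1} y"
      unfolding y_def by (intro continuous_intros)
    have ends: "inv_into U f (\<sigma> 0) = \<psi> v" "inv_into U f (\<sigma> 1) = \<psi> (scale 0 v)"
    proof -
      have "inv_into U f (f (\<psi> (scale s v))) = \<psi> (scale s v)" if "s \<in> {0..1}" for s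
        using seg[OF that] by (intro inv_into_f_f[OF chart_inj[OF c]]) blast
      from this[of 1] this[of 0] show "inv_into U f (\<sigma> 0) = \<psi> v" "inv_into U f (\<sigma> 1) = \<psi> (scale 0 v)"
        using seg[of 1] seg[of 0] by (simp_all add: \<sigma>_def y_def scale_1)
    qed
    have "riemannian_dist P g (inv_into U f (\<sigma> 0)) (inv_into U f (\<sigma> 1)) \<le> ennreal (b * (B * norm u))"
    proof (rule riemannian_dist_le_chart[OF c K(2) b(2)])
      show "0 \<le> b" using b(1) by simp
      fix t :: real assume t: "t \<in> {0..1}"
      show "\<sigma> t \<in> K" using y_in[OF t] by (auto simp: \<sigma>_def K_def)
      have "(y has_vector_derivative (0, - u)) (at t within {0..1})"
        unfolding y_def by (auto intro!: derivative_eq_intros has_vector_derivative_Pair)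
      moreover have "(H has_derivative frechet_derivative H (at (y t))) (at (y t) within y ` {0..1})"
        using smooth_on_has_derivative[OF H] y_in[OF t] rW0 by (blast intro: has_derivative_at_withinI)
      ultimately have "(H \<circ> y has_vector_derivative \<sigma>' t) (at t within {0..1})"
        unfolding \<sigma>'_def by (rule vector_derivative_diff_chain_within)
      then show "(\<sigma> has_vector_derivative \<sigma>' t) (at t within {0..1})"
        by (simp add: \<sigma>_def[abs_def] o_def)
      show "norm (\<sigma>' t) \<le> B * norm u"
        using B(2)[OF y_in[OF t], of "(0, - u)"] by (simp add: \<sigma>'_def norm_Pair)
    next
      have "continuous_on {0..1} ((\<lambda>x. frechet_derivative H (at x) (0, - u)) \<circ> y)"
        by (intro continuous_on_compose y_cont continuous_on_subset[OF smooth_on_derivative_continuous[OF H]])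
          (use y_in rW0 in auto)
      then show "continuous_on {0..1} \<sigma>'" by (simp add: \<sigma>'_def[abs_def] o_def)
    qed
    also have "\<dots> \<le> ennreal (b * B * C1 * nm v)"
    proof (rule ennreal_leI)
      have "norm u \<le> C1 * nm v" using Q1(4)[OF vQ1] by (simp add: u_def pv)
      then have "b * B * norm u \<le> b * B * (C1 * nm v)" using b B by (intro mult_left_mono) auto
      then show "b * (B * norm u) \<le> b * B * C1 * nm v" by (simp add: mult.assoc)
    qed
    finally have "riemannian_dist P g (\<psi> v) (\<psi> (scale 0 v)) \<le> ennreal (b * B * C1 * nm v)"
      by (simp only: ends)
    moreover have "\<psi> (scale 0 v) \<in> M"
    proof -
      have "nm (scale 0 v) = 0" using norm_props(3)[OF vNB] by simp
      then show ?thesis using psi_in_M[of "scale 0 v"] seg[of 0] norm_props(2)[OF scale_in[OF vNB]] by simp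
    qed
    ultimately have "dist_to_set (riemannian_dist P g) (\<psi> v) M \<le> ennreal (b * B * C1 * nm v)"
      unfolding dist_to_set_def by (meson INF_lower order_trans)
    then show ?thesis using seg[of 1] by (simp add: scale_1)
  qed
  show thesis
  proof (rule that[of "b * B * C1" Q])
    show "0 < b * B * C1" using b B Q1 by simp
    show "openin V Q" unfolding Q_def F using Q1(2) tchart_preimage_openin[OF c1 open_ball] by blast
    show "z \<in> Q" using Q1(3) p0U null_section_subset z r(1) by (auto simp: Q_def p0(1))
  qed (use est in blast)+
qed

text \<open>In bundle coordinates the points of \<open>M\<close> have fibre part zero, and
  \<open>psi_inv\<close> is locally Lipschitz, so the fibre part of \<open>v\<close> is bounded by
  the coordinate distance to any nearby \<open>m\<close>. An \<open>m\<close> beyond the coordinate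
  ball is at least a fixed distance away.\<close>

lemma dist_to_M_ge:
  assumes z: "z \<in> null_section M"
  obtains C Q where "0 < C" "openin V Q" "z \<in> Q" "Q \<subseteq> N"
    "\<And>v. v \<in> Q \<Longrightarrow> ennreal (C * nm v) \<le> dist_to_set (riemannian_dist P g) (\<psi> v) M"
proof -
  obtain p0 where p0: "z = (p0, \<lambda>_. 0)" "p0 \<in> M" using z by (auto simp: null_section_def)
  have zN: "z \<in> N" using z null_N by blast
  obtain U f W F W0 H where c: "(U, f) \<in> P" and WF: "(W, F) \<in> tangent_atlas P"
    and zU: "\<psi> z \<in> U" "psi_inv (\<psi> z) \<in> W" and W0: "open W0" "f (\<psi> z) \<in> W0" and H: "smooth_on W0 H"
    and loc: "\<And>q. q \<in> A \<Longrightarrow> q \<in> U \<Longrightarrow> f q \<in> W0 \<Longrightarrow> psi_inv q \<in> W \<and> F (psi_inv q) = H (f q)"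
    using smooth_map_onD[OF psi_inv_smooth psi_in[OF zN]] by (elim exE conjE) (rule that, assumption+, blast)
  obtain U1 f1 where c1: "(U1, f1) \<in> P" and W: "W = Sigma U1 (tangent_space P)" and F: "F = tchart U1 f1"
    using WF unfolding tangent_atlas_iff by blast
  have p0U: "p0 \<in> U1" using zU(2)[unfolded psi_inv_psi[OF zN]] p0 W by simp
  let ?y = "f (\<psi> z)"
  have "open (f ` U \<inter> W0)" using chart_image[OF c] W0 by blast
  moreover have "?y \<in> f ` U \<inter> W0" using zU W0 by blast
  ultimately obtain r where r: "0 < r" "cball ?y r \<subseteq> f ` U \<inter> W0" using open_contains_cball by blast
  then have rU: "cball ?y r \<subseteq> f ` U" and rW0: "cball ?y r \<subseteq> W0" by auto
  obtain a where a: "0 < a"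
    "\<And>x m. x \<in> U \<Longrightarrow> f x \<in> ball ?y (r / 2) \<Longrightarrow> m \<in> U \<Longrightarrow> f m \<in> ball ?y r \<Longrightarrow>
      ennreal (a * norm (f m - f x)) \<le> riemannian_dist P g x m"
    "\<And>x m. x \<in> U \<Longrightarrow> f x \<in> ball ?y (r / 2) \<Longrightarrow> \<not> (m \<in> U \<and> f m \<in> ball ?y r) \<Longrightarrow>
      ennreal a \<le> riemannian_dist P g x m"
    by (rule riemannian_dist_ge_chart[OF c r(1) rU], rule that)
  obtain L where L: "0 < L" "\<And>x y. x \<in> cball ?y r \<Longrightarrow> y \<in> cball ?y r \<Longrightarrow> norm (H x - H y) \<le> L * norm (x - y)"
    using smooth_on_lipschitz[OF H compact_cball rW0 convex_cball] by blast
  obtain a1 C1 Q1 where Q1': "0 < a1" "0 < C1" "openin V Q1" "(p0, \<lambda>_. 0) \<in> Q1"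
    "\<And>v. v \<in> Q1 \<Longrightarrow> fst v \<in> U1"
    "\<And>v. v \<in> Q1 \<Longrightarrow> a1 * nm v \<le> norm (snd v (U1, f1))" "\<And>v. v \<in> Q1 \<Longrightarrow> norm (snd v (U1, f1)) \<le> C1 * nm v"
    by (rule chart_norm_comparable[OF c1 p0U p0(2)], rule that)
  note Q1 = Q1'(1,3) Q1'(4)[folded p0(1)] Q1'(6)
  \<comment> \<open>\<open>a\<close> serves the points \<open>m\<close> outside the ball, with
    \<open>nm v < 1\<close> in \<open>Q\<close>; \<open>a * a1 / L\<close> serves those
    inside.\<close>
  define C where "C = min a (a * a1 / L)"
  have C: "0 < C" "C \<le> a" "C \<le> a * a1 / L" using a Q1 L by (auto simp: C_def)
  define Q where "Q = Q1 \<inter> {v \<in> N. \<psi> v \<in> {x \<in> U. f x \<in> ball ?y (r / 2)}} \<inter> {v \<in> topspace V. nm v \<in> {..<1}}"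
  have est: "ennreal (C * nm v) \<le> riemannian_dist P g (\<psi> v) m" if v: "v \<in> Q" and m: "m \<in> M" for v m
  proof -
    have v': "v \<in> Q1" "v \<in> N" "\<psi> v \<in> U" "f (\<psi> v) \<in> ball ?y (r / 2)" "nm v < 1" using v by (auto simp: Q_def)
    have n: "0 \<le> nm v" using norm_props(1) v'(2) N_subset by blast
    show ?thesis
    proof (cases "m \<in> U \<and> f m \<in> ball ?y r")
      case False
      have "C * nm v \<le> a * 1" using C a v'(5) n by (intro mult_mono) auto
      then have "ennreal (C * nm v) \<le> ennreal a" by (intro ennreal_leI) simp
      also have "\<dots> \<le> riemannian_dist P g (\<psi> v) m" by (rule a(3)[OF v'(3,4) False])
      finally show ?thesis .
    next
      case True
      have mA: "m \<in> A" using m M_A by blast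
      have cb: "f m \<in> cball ?y r" "f (\<psi> v) \<in> cball ?y r" using True v'(4) r(1) by auto
      have Fm: "F (psi_inv m) = H (f m)" using loc[OF mA] True cb rW0 by blast
      have Fv: "F v = H (f (\<psi> v))"
        using loc[OF psi_in[OF v'(2)] v'(3)] cb rW0 psi_inv_psi[OF v'(2)] by auto
      have "psi_inv m \<in> null_section M"
        using psi_in_M[OF psi_inv_in[OF mA]] psi_psi_inv[OF mA] m by simp
      then have "snd (F (psi_inv m)) = 0" by (auto simp: F tchart_def null_section_def)
      then have "norm (snd v (U1, f1)) = norm (snd (F v - F (psi_inv m)))"
        by (simp add: F tchart_def split_beta)
      also have "\<dots> \<le> norm (F v - F (psi_inv m))" by (metis norm_snd_le prod.collapse)
      also have "\<dots> \<le> L * norm (f (\<psi> v) - f m)" unfolding Fm Fv by (rule L(2)[OF cb(2,1)])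
      finally have "a1 * nm v \<le> L * norm (f m - f (\<psi> v))"
        using Q1(4)[OF v'(1)] by (simp add: norm_minus_commute)
      then have "a / L * (a1 * nm v) \<le> a / L * (L * norm (f m - f (\<psi> v)))"
        using a(1) L(1) by (intro mult_left_mono) auto
      then have "a * a1 / L * nm v \<le> a * norm (f m - f (\<psi> v))" using L(1) by simp
      moreover have "C * nm v \<le> a * a1 / L * nm v" using C(3) n by (intro mult_right_mono) auto
      ultimately have "ennreal (C * nm v) \<le> ennreal (a * norm (f m - f (\<psi> v)))" by (intro ennreal_leI) simp
      also have "\<dots> \<le> riemannian_dist P g (\<psi> v) m" using a(2)[OF v'(3,4)] True by blast
      finally show ?thesis .
    qed
  qed
  show thesis
  proof (rule that[OF C(1), of Q])
    show "openin V Q" unfolding Q_def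
      by (intro openin_Int Q1(2) psi_preimage_openin chart_preimage_openin[OF c] open_ball
          openin_continuous_map_preimage[OF norm_cont]) simp
    have "nm z = 0" using norm_props(2)[of z] z null_section_subset by blast
    then show "z \<in> Q" using Q1(3) zN zU(1) r(1) N_subset topspace_V by (auto simp: Q_def)
    show "Q \<subseteq> N" by (auto simp: Q_def)
    show "ennreal (C * nm v) \<le> dist_to_set (riemannian_dist P g) (\<psi> v) M" if "v \<in> Q" for v
      unfolding dist_to_set_def using est[OF that] by (rule INF_greatest)
  qed
qed

lemma null_section_compact: "compactin V (null_section M)"
proof -
  have "closedin V {v \<in> topspace V. nm v \<in> {0}}"
    by (rule closedin_continuous_map_preimage[OF norm_cont]) simp
  moreover have "{v \<in> topspace V. nm v \<in> {0}} = null_section M"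
    using norm_props(2) null_section_subset by (auto simp: topspace_V)
  ultimately have "closedin V (null_section M)" by simp
  moreover have "null_section M \<subseteq> {v \<in> topspace V. nm v \<le> 1}"
    using small_vectors_openin(2)[of 1] topspace_V by auto
  ultimately show ?thesis using closed_compactin[OF compact_ball] by blast
qed

lemma dist_to_M_comparable:
  obtains c C W where "0 < c" "0 < C" "openin V W" "null_section M \<subseteq> W" "W \<subseteq> N"
    "\<And>v. v \<in> W \<Longrightarrow> ennreal (c * nm v) \<le> dist_to_set (riemannian_dist P g) (\<psi> v) M"
    "\<And>v. v \<in> W \<Longrightarrow> dist_to_set (riemannian_dist P g) (\<psi> v) M \<le> ennreal (C * nm v)"
proof -
  let ?D = "\<lambda>v. dist_to_set (riemannian_dist P g) (\<psi> v) M"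
  \<comment> \<open>One number \<open>n\<close> encodes the upper constant and the reciprocal of the
    lower one. Both estimates weaken as \<open>n\<close> grows, so finitely many neighbourhoods
    admit a common \<open>n\<close>.\<close>
  define good where "good n Q \<longleftrightarrow> openin V Q \<and> Q \<subseteq> N \<and>
    (\<forall>v\<in>Q. ennreal (1 / real (Suc n) * nm v) \<le> ?D v \<and> ?D v \<le> ennreal (real (Suc n) * nm v))" for n Q
  have ex: "\<exists>n Q. good n Q \<and> z \<in> Q" if z: "z \<in> null_section M" for z
  proof -
    obtain C1 Q1 where 1: "0 < C1" "openin V Q1" "z \<in> Q1" "Q1 \<subseteq> N" "\<And>v. v \<in> Q1 \<Longrightarrow> ?D v \<le> ennreal (C1 * nm v)"
      using dist_to_M_le[OF z] by blast
    obtain C2 Q2 where 2: "0 < C2" "openin V Q2" "z \<in> Q2" "Q2 \<subseteq> N" "\<And>v. v \<in> Q2 \<Longrightarrow> ennreal (C2 * nm v) \<le> ?D v"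
      using dist_to_M_ge[OF z] by blast
    obtain n :: nat where n: "max C1 (1 / C2) < real n" using reals_Archimedean2 by blast
    then have n1: "C1 \<le> real (Suc n)" by simp
    have "1 / C2 \<le> real (Suc n)" using n by simp
    then have n2: "1 / real (Suc n) \<le> C2" using 2(1) by (simp add: field_simps)
    have "good n (Q1 \<inter> Q2)"
      unfolding good_def
    proof (intro conjI ballI)
      fix v assume v: "v \<in> Q1 \<inter> Q2"
      then have "0 \<le> nm v" using norm_props(1)[of v] 1(4) N_subset by blast
      then have le: "1 / real (Suc n) * nm v \<le> C2 * nm v" "C1 * nm v \<le> real (Suc n) * nm v"
        using n1 n2 by (intro mult_right_mono; simp)+
      show "ennreal (1 / real (Suc n) * nm v) \<le> ?D v"
        using order_trans[OF ennreal_leI[OF le(1)] 2(5)] v by blast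
      show "?D v \<le> ennreal (real (Suc n) * nm v)"
        using order_trans[OF 1(5) ennreal_leI[OF le(2)]] v by blast
    qed (use 1 2 in auto)
    then show ?thesis using 1 2 by blast
  qed
  have mono: "good n Q" if g: "good m Q" and mn: "m \<le> n" for m n Q
    unfolding good_def
  proof (intro conjI ballI)
    fix v assume v: "v \<in> Q"
    then have "0 \<le> nm v" using norm_props(1)[of v] g N_subset unfolding good_def by blast
    then have le: "1 / real (Suc n) * nm v \<le> 1 / real (Suc m) * nm v" "real (Suc m) * nm v \<le> real (Suc n) * nm v"
      using mn by (intro mult_right_mono; simp add: frac_le)+
    show "ennreal (1 / real (Suc n) * nm v) \<le> ?D v"
      using order_trans[OF ennreal_leI[OF le(1)]] v g unfolding good_def by blast
    show "?D v \<le> ennreal (real (Suc n) * nm v)"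
      using order_trans[OF _ ennreal_leI[OF le(2)]] v g unfolding good_def by blast
  qed (use g in \<open>auto simp: good_def\<close>)
  have "\<exists>\<F>. finite \<F> \<and> \<F> \<subseteq> {Q. \<exists>n. good n Q} \<and> null_section M \<subseteq> \<Union>\<F>"
  proof (rule compactinD[OF null_section_compact])
    show "openin V Q" if "Q \<in> {Q. \<exists>n. good n Q}" for Q using that by (auto simp: good_def)
    show "null_section M \<subseteq> \<Union>{Q. \<exists>n. good n Q}"
    proof
      fix z :: "'x \<times> ('x, 'e) tvec" assume "z \<in> null_section M"
      from ex[OF this] show "z \<in> \<Union>{Q. \<exists>n. good n Q}" by blast
    qed
  qed
  then obtain \<F> where \<F>: "finite \<F>" "\<F> \<subseteq> {Q. \<exists>n. good n Q}" "null_section M \<subseteq> \<Union>\<F>" by blast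
  have "\<exists>n. \<forall>Q\<in>\<F>. good n Q"
    using \<F>(1,2)
  proof (induction \<F> rule: finite_induct)
    case (insert Q \<F>)
    then obtain m n where mn: "\<forall>Q\<in>\<F>. good m Q" "good n Q" by auto
    then have "\<forall>R\<in>insert Q \<F>. good (max m n) R"
      using mono[of m _ "max m n"] mono[of n _ "max m n"] by auto
    then show ?case by blast
  qed simp
  then obtain n where n: "\<And>Q. Q \<in> \<F> \<Longrightarrow> good n Q" by blast
  show thesis
  proof (rule that[of "1 / real (Suc n)" "real (Suc n)" "\<Union>\<F>"])
    show "openin V (\<Union>\<F>)" using n by (intro openin_Union) (auto simp: good_def)
  qed (use n \<F>(3) in \<open>auto simp: good_def\<close>)
qed

end

section \<open>Exponents and spectra\<close>

lemma metric_exponent_eq: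
  assumes "is_time T" "has_metric_exponent T d \<phi> M x l"
  shows "metric_exponent T d \<phi> M x = l"
  unfolding metric_exponent_def
proof (rule the_equality)
  fix l' assume "has_metric_exponent T d \<phi> M x l'"
  then show "l' = l"
    using tendsto_unique[OF at_top_in_time_neq_bot[OF assms(1)]] assms(2)
    unfolding has_metric_exponent_def by blast
qed (rule assms(2))

lemma lyapunov_exponent_eq:
  assumes "is_time T" "has_lyapunov_exponent T nm \<Phi> v l"
  shows "lyapunov_exponent T nm \<Phi> v = l"
  unfolding lyapunov_exponent_def
proof (rule the_equality)
  fix l' assume "has_lyapunov_exponent T nm \<Phi> v l'"
  then show "l' = l"
    using tendsto_unique[OF at_top_in_time_neq_bot[OF assms(1)]] assms(2)
    unfolding has_lyapunov_exponent_def by blast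
qed (rule assms(2))

text \<open>Compactness of \<open>X\<close> upgrades the condition on omega-limits to attraction:
  otherwise the closures of the tails would meet the complement of \<open>Q\<close> in a common
  point, an omega-limit point off \<open>M\<close>.\<close>

lemma stable_set_eventually:
  assumes "compact_space X" "is_time T" "x \<in> stable_set T X \<phi> M" "openin X Q" "M \<subseteq> Q"
    and orbit: "\<And>t. t \<in> T \<Longrightarrow> \<phi> t x \<in> topspace X"
  shows "\<forall>\<^sub>F t in at_top_in T. \<phi> t x \<in> Q"
proof -
  let ?R = "\<lambda>s. {\<phi> t x |t. t \<in> T \<and> s \<le> t}"
  have omega: "(\<Inter>s\<in>T. X closure_of ?R s) \<subseteq> M"
    using assms(3) by (simp add: stable_set_def omega_limit_def)
  define C where "C n = X closure_of ?R (real n) \<inter> (topspace X - Q)" for n :: nat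
  have "\<exists>n. C n = {}"
  proof (rule ccontr)
    assume no: "\<not> ?thesis"
    have "(\<Inter>n. C n) \<noteq> {}"
    proof (rule compact_space_imp_nest[OF assms(1)])
      show "closedin X (C n)" for n
        unfolding C_def using assms(4) by (intro closedin_Int closedin_closure_of closedin_diff closedin_topspace)
      show "C n \<noteq> {}" for n using no by blast
      show "decseq C"
        unfolding decseq_def C_def
        by (intro allI impI Int_mono closure_of_mono) auto
    qed
    then obtain y where y: "\<And>n. y \<in> C n" by blast
    have "y \<in> X closure_of ?R s" if "s \<in> T" for s
    proof -
      obtain n :: nat where "s \<le> real n" using real_arch_simple by blast
      then have "X closure_of ?R (real n) \<subseteq> X closure_of ?R s" by (intro closure_of_mono) auto
      then show ?thesis using y[of n] by (auto simp: C_def)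
    qed
    then have "y \<in> M" using omega by blast
    then show False using y[of 0] assms(5) by (auto simp: C_def)
  qed
  then obtain n where n: "C n = {}" by blast
  have "\<phi> t x \<in> Q" if "t \<in> T" "real n \<le> t" for t
  proof -
    have "\<phi> t x \<in> X closure_of ?R (real n)"
      using that orbit closure_of_subset_Int[of X "?R (real n)"] by blast
    then show ?thesis using n orbit[OF that(1)] by (auto simp: C_def)
  qed
  then show ?thesis unfolding eventually_at_top_in by blast
qed

section \<open>Stable points tracked by vectors of the null stable set\<close>

context normal_conjugation
begin

abbreviation S where "S \<equiv> null_stable_set T V \<Phi> M"
abbreviation d where "d \<equiv> riemannian_dist P g"

lemma conjugacy: "t \<in> T \<Longrightarrow> v \<in> N \<Longrightarrow> \<Phi> t v \<in> N \<Longrightarrow> \<phi> t (\<psi> v) = \<psi> (\<Phi> t v)"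
  using conj unfolding conjugates_on_def by blast

lemma S_subset: "S \<subseteq> NB"
  by (auto simp: null_stable_set_def topspace_V)

lemma S_eventually: "v \<in> S \<Longrightarrow> openin V W \<Longrightarrow> null_section M \<subseteq> W \<Longrightarrow> \<forall>\<^sub>F t in at_top_in T. \<Phi> t v \<in> W"
  unfolding null_stable_set_def by blast

lemma psi_in_X: "v \<in> N \<Longrightarrow> \<psi> v \<in> topspace X"
  using psi_in A_subset by blast

text \<open>Times form a group: if the orbits correspond at one time \<open>s\<close>, conjugacy for
  the possibly negative time \<open>t - s\<close> carries the correspondence to
  \<open>t\<close>.\<close>

lemma conjugate_orbit:
  assumes v: "v \<in> NB" and x: "x \<in> topspace X" and s: "s \<in> T" "\<Phi> s v \<in> N" "\<phi> s x = \<psi> (\<Phi> s v)"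
    and t: "t \<in> T" "\<Phi> t v \<in> N"
  shows "\<phi> t x = \<psi> (\<Phi> t v)"
proof -
  have ts: "t - s \<in> T" using time_diff[OF time t(1) s(1)] .
  have vV: "v \<in> topspace V" using v topspace_V by simp
  have "\<Phi> (t - s) (\<Phi> s v) = \<Phi> t v" using Phi_add[OF ts s(1) vV] by simp
  then have "\<phi> (t - s) (\<psi> (\<Phi> s v)) = \<psi> (\<Phi> t v)" using conjugacy[OF ts s(2)] t(2) by simp
  moreover have "\<phi> t x = \<phi> (t - s) (\<phi> s x)" using flow_add[OF flow ts s(1) x] by simp
  ultimately show ?thesis using s(3) by simp
qed

text \<open>Existence comes from pulling back along the invertible flow from a late time, when the
  linear orbit is in \<open>N\<close>; uniqueness from comparing two candidates at that
  time.\<close>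

lemma extended_conjugation_orbit:
  assumes v: "v \<in> S"
  defines "x \<equiv> extended_conjugation T X \<phi> \<Phi> N \<psi> v"
  shows "x \<in> topspace X" and "\<And>t. t \<in> T \<Longrightarrow> \<Phi> t v \<in> N \<Longrightarrow> \<phi> t x = \<psi> (\<Phi> t v)"
proof -
  have vNB: "v \<in> NB" using v S_subset by blast
  have "x \<in> topspace X \<and> (\<forall>t\<in>T. \<Phi> t v \<in> N \<longrightarrow> \<phi> t x = \<psi> (\<Phi> t v))"
  proof (cases "v \<in> N")
    case True
    then show ?thesis using conjugacy psi_in_X by (simp add: x_def extended_conjugation_def)
  next
    case False
    define R where "R y \<longleftrightarrow> y \<in> topspace X \<and> (\<exists>s\<in>T. 0 < s \<and> \<Phi> s v \<in> N \<and> \<phi> s y = \<psi> (\<Phi> s v))" for y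
    have R: "\<phi> t y = \<psi> (\<Phi> t v)" if "R y" "t \<in> T" "\<Phi> t v \<in> N" for y t
      using conjugate_orbit[OF vNB] that unfolding R_def by blast
    obtain s0 where s0: "\<And>t. t \<in> T \<Longrightarrow> s0 \<le> t \<Longrightarrow> \<Phi> t v \<in> N"
      using S_eventually[OF v N_openin null_N] unfolding eventually_at_top_in by blast
    \<comment> \<open>The definition of \<open>extended_conjugation\<close> demands a positive time,
      hence the 1.\<close>
    obtain n :: nat where "max s0 1 \<le> real n" using real_arch_simple by blast
    moreover define s where "s = real n"
    ultimately have s: "s \<in> T" "0 < s" "\<Phi> s v \<in> N" using s0[of s] time_of_nat[OF time, of n] by auto
    have "R (\<phi> (- s) (\<psi> (\<Phi> s v)))"
      unfolding R_def using s psi_in_X[OF s(3)] flow_inverse(2)[OF flow time s(1)]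
        flow_in[OF flow time_uminus[OF time s(1)]] by blast
    moreover have "y = y'" if "R y" "R y'" for y y'
    proof -
      have "\<phi> s y = \<phi> s y'" using R[OF that(1) s(1,3)] R[OF that(2) s(1,3)] by simp
      then have "\<phi> (- s) (\<phi> s y) = \<phi> (- s) (\<phi> s y')" by simp
      then show ?thesis
        using flow_inverse(1)[OF flow time s(1)] that unfolding R_def by simp
    qed
    ultimately have "R (THE y. R y)" by (metis theI)
    moreover have "x = (THE y. R y)" using False by (simp add: x_def extended_conjugation_def R_def)
    ultimately have "R x" by simp
    then show ?thesis using R unfolding R_def by blast
  qed
  then show "x \<in> topspace X" "\<And>t. t \<in> T \<Longrightarrow> \<Phi> t v \<in> N \<Longrightarrow> \<phi> t x = \<psi> (\<Phi> t v)" by blast+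
qed

text \<open>The orbit eventually stays in the closed image of each small ball, which therefore
  contains the omega-limit set.\<close>

lemma tracking_stable:
  assumes v: "v \<in> S" and x: "x \<in> topspace X"
    and track: "\<forall>\<^sub>F t in at_top_in T. \<phi> t x = \<psi> (\<Phi> t v)"
  shows "x \<in> stable_set T X \<phi> M"
proof -
  obtain e where e: "0 < e" "{v \<in> NB. nm v \<le> e} \<subseteq> N" "compactin V {v \<in> NB. nm v \<le> e}"
    using small_vectors[OF N_openin null_N] by blast
  have "omega_limit T X \<phi> x \<subseteq> M"
  proof
    fix y assume y: "y \<in> omega_limit T X \<phi> x"
    show "y \<in> M"
    proof (rule in_M_if_in_small_balls[OF e(1,2)])
      fix r assume r: "0 < r" "r \<le> e"
      let ?B = "{v \<in> NB. nm v \<le> r}"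
      have "\<forall>\<^sub>F t in at_top_in T. \<Phi> t v \<in> {v \<in> NB. nm v < r}"
        by (rule S_eventually[OF v small_vectors_openin[OF r(1)]])
      with track have "\<forall>\<^sub>F t in at_top_in T. \<phi> t x \<in> \<psi> ` ?B"
        by eventually_elim auto
      then obtain s where s: "\<And>t. t \<in> T \<Longrightarrow> s \<le> t \<Longrightarrow> \<phi> t x \<in> \<psi> ` ?B"
        unfolding eventually_at_top_in by blast
      obtain n :: nat where n: "s \<le> real n" using real_arch_simple by blast
      have "X closure_of {\<phi> t x |t. t \<in> T \<and> real n \<le> t} \<subseteq> \<psi> ` ?B"
        by (rule closure_of_minimal[OF _ small_ball_closedin[OF e r(2)]]) (use s n in fastforce)
      then show "y \<in> \<psi> ` ?B"
        using y time_of_nat[OF time, of n] unfolding omega_limit_def by blast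
    qed
  qed
  then show ?thesis using x by (simp add: stable_set_def)
qed

lemma tracking_exponent:
  assumes v: "v \<in> S" and track: "\<forall>\<^sub>F t in at_top_in T. \<phi> t x = \<psi> (\<Phi> t v)"
  shows "has_metric_exponent T d \<phi> M x l \<longleftrightarrow> has_lyapunov_exponent T nm \<Phi> v l"
proof -
  obtain c C W where W: "0 < c" "0 < C" "openin V W" "null_section M \<subseteq> W" "W \<subseteq> N"
    "\<And>v. v \<in> W \<Longrightarrow> ennreal (c * nm v) \<le> dist_to_set d (\<psi> v) M"
    "\<And>v. v \<in> W \<Longrightarrow> dist_to_set d (\<psi> v) M \<le> ennreal (C * nm v)"
    by (rule dist_to_M_comparable, rule that)
  define D where "D t = enn2real (dist_to_set d (\<phi> t x) M)" for t
  have "\<forall>\<^sub>F t in at_top_in T. ennreal (D t) = dist_to_set d (\<phi> t x) M \<and>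
      c * nm (\<Phi> t v) \<le> D t \<and> D t \<le> C * nm (\<Phi> t v)"
    using S_eventually[OF v W(3,4)] track
  proof eventually_elim
    case (elim t)
    have n: "0 \<le> nm (\<Phi> t v)" using elim(1) W(5) N_subset norm_props(1) by blast
    have lower: "ennreal (c * nm (\<Phi> t v)) \<le> dist_to_set d (\<phi> t x) M"
      and upper: "dist_to_set d (\<phi> t x) M \<le> ennreal (C * nm (\<Phi> t v))"
      using W(6,7)[OF elim(1)] elim(2) by simp_all
    \<comment> \<open>Distances may be infinite in general; the upper estimate makes them finite
      here, so real logarithms apply.\<close>
    have fin: "ennreal (D t) = dist_to_set d (\<phi> t x) M"
      unfolding D_def using upper by (metis ennreal_enn2real_if ennreal_less_top less_irrefl order_le_less_trans infinity_ennreal_def)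
    have "c * nm (\<Phi> t v) \<le> D t" "D t \<le> C * nm (\<Phi> t v)"
      using lower upper n W(1,2) unfolding fin[symmetric] by (simp_all add: D_def)
    then show ?case using fin by simp
  qed
  then have fin: "\<forall>\<^sub>F t in at_top_in T. elog (dist_to_set d (\<phi> t x) M) / ereal t = elog (ennreal (D t)) / ereal t"
    and cmp: "\<forall>\<^sub>F t in at_top_in T. c * nm (\<Phi> t v) \<le> D t \<and> D t \<le> C * nm (\<Phi> t v)"
    by (eventually_elim, simp)+
  \<comment> \<open>Comparability is symmetric, which gives both directions of the
    equivalence.\<close>
  have cmp': "\<forall>\<^sub>F t in at_top_in T. 1 / C * D t \<le> nm (\<Phi> t v) \<and> nm (\<Phi> t v) \<le> 1 / c * D t"
    using cmp by eventually_elim (use W(1,2) in \<open>simp add: field_simps\<close>)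
  have "has_metric_exponent T d \<phi> M x l \<longleftrightarrow>
      ((\<lambda>t. elog (ennreal (D t)) / ereal t) \<longlongrightarrow> ereal l) (at_top_in T)"
    unfolding has_metric_exponent_def by (rule tendsto_cong[OF fin])
  also have "\<dots> \<longleftrightarrow> has_lyapunov_exponent T nm \<Phi> v l"
    unfolding has_lyapunov_exponent_def
    using elog_rate_comparable[OF cmp W(1)] elog_rate_comparable[OF cmp'] W(2) by auto
  finally show ?thesis .
qed

text \<open>Conjugacy applies only if the linear orbit is known to be in \<open>N\<close>, while
  attraction speaks about \<open>\<phi>\<close> alone. The lift therefore proceeds by unit time
  steps, each too short to leave \<open>N\<close>.\<close>

lemma stable_set_tracked:
  assumes x: "x \<in> stable_set T X \<phi> M"
  obtains v where "v \<in> S" "\<forall>\<^sub>F t in at_top_in T. \<phi> t x = \<psi> (\<Phi> t v)"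
proof -
  have xX: "x \<in> topspace X" using x by (simp add: stable_set_def)
  have orbit: "\<phi> t x \<in> topspace X" if "t \<in> T" for t using flow_in[OF flow that xX] .
  obtain e where e: "0 < e" "{v \<in> NB. nm v \<le> e} \<subseteq> N"
    using small_vectors[OF N_openin null_N] by blast
  obtain C where C: "1 \<le> C"
    "\<And>t v. t \<in> T \<Longrightarrow> \<bar>t\<bar> \<le> 1 \<Longrightarrow> v \<in> topspace V \<Longrightarrow> nm (\<Phi> t v) \<le> C * nm v"
    using nm_Phi_bound by blast
  \<comment> \<open>A vector of \<open>N1\<close> cannot leave the ball of radius \<open>e\<close>,
    inside \<open>N\<close>, within one time unit.\<close>
  define N1 where "N1 = {v \<in> NB. nm v < e / C}"
  have "0 < e / C" "e / C \<le> e" using e(1) C(1) by (simp_all add: field_simps)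
  note N1 = small_vectors_openin[OF \<open>0 < e / C\<close>, folded N1_def]
  have N1N: "N1 \<subseteq> N" using e(2) \<open>e / C \<le> e\<close> by (auto simp: N1_def)
  have step: "\<Phi> t v \<in> N" if "t \<in> T" "\<bar>t\<bar> \<le> 1" "v \<in> N1" for t v
  proof -
    have v: "v \<in> topspace V" "nm v \<le> e / C" using that(3) by (auto simp: N1_def topspace_V)
    have "nm (\<Phi> t v) \<le> C * nm v" by (rule C(2)[OF that(1,2) v(1)])
    also have "\<dots> \<le> C * (e / C)" using C(1) v(2) by (intro mult_left_mono) auto
    finally have "nm (\<Phi> t v) \<le> e" using C(1) by simp
    then show ?thesis using Phi_in[OF that(1) v(1)] e(2) topspace_V by auto
  qed
  have "M \<subseteq> \<psi> ` N1" using psi_null N1(2) by blast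
  from stable_set_eventually[OF compact_X time x psi_image_openin[OF N1(1) N1N] this orbit]
  obtain s0 where s0: "\<And>t. t \<in> T \<Longrightarrow> s0 \<le> t \<Longrightarrow> \<phi> t x \<in> \<psi> ` N1"
    unfolding eventually_at_top_in by blast
  obtain n :: nat where n: "s0 \<le> real n" using real_arch_simple by blast
  define s where "s = real n"
  have s: "s \<in> T" unfolding s_def by (rule time_of_nat[OF time])
  have in_N1: "\<phi> t x \<in> \<psi> ` N1" if "t \<in> T" "s \<le> t" for t using s0 that n by (simp add: s_def)
  define w where "w = psi_inv (\<phi> s x)"
  have w: "w \<in> N1" "\<psi> w = \<phi> s x"
    using in_N1[OF s order_refl] N1N psi_inv_psi by (auto simp: w_def)
  have wV: "w \<in> topspace V" using w(1) by (simp add: N1_def topspace_V)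
  have nat: "\<Phi> (real k) w \<in> N1 \<and> \<psi> (\<Phi> (real k) w) = \<phi> (s + real k) x" for k
  proof (induction k)
    case 0
    then show ?case using w Phi_zero[OF wV] by simp
  next
    case (Suc k)
    have one: "(1::real) \<in> T" using time_of_nat[OF time, of 1] by simp
    have k: "real k \<in> T" "s + real k \<in> T" using time_of_nat[OF time] time_add[OF time s] by auto
    have eq: "\<Phi> (real (Suc k)) w = \<Phi> 1 (\<Phi> (real k) w)" using Phi_add[OF one k(1) wV] by simp
    have in_N: "\<Phi> (real (Suc k)) w \<in> N" unfolding eq using step[OF one] Suc by simp
    have "\<psi> (\<Phi> (real (Suc k)) w) = \<phi> 1 (\<psi> (\<Phi> (real k) w))"
      using conjugacy[OF one, of "\<Phi> (real k) w"] Suc N1N in_N unfolding eq by auto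
    also have "\<dots> = \<phi> (1 + (s + real k)) x" using Suc flow_add[OF flow one k(2) xX] by simp
    also have "1 + (s + real k) = s + real (Suc k)" by simp
    finally have psi: "\<psi> (\<Phi> (real (Suc k)) w) = \<phi> (s + real (Suc k)) x" .
    \<comment> \<open>Attraction gives a preimage in \<open>N1\<close>; injectivity of
      \<open>\<psi>\<close> on \<open>N\<close> identifies it with the lifted vector, so the
      induction returns from \<open>N\<close> to \<open>N1\<close>.\<close>
    have "\<phi> (s + real (Suc k)) x \<in> \<psi> ` N1"
      by (intro in_N1 time_add[OF time s] time_of_nat[OF time]) simp
    then obtain w' where "w' \<in> N1" "\<psi> w' = \<psi> (\<Phi> (real (Suc k)) w)" unfolding psi[symmetric] by force
    moreover from this have "w' = \<Phi> (real (Suc k)) w" using psi_inj in_N N1N by blast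
    ultimately have "\<Phi> (real (Suc k)) w \<in> N1" by (simp only:)
    then show ?case using psi by blast
  qed
  have real: "\<Phi> t w \<in> N \<and> \<psi> (\<Phi> t w) = \<phi> (s + t) x" if t: "t \<in> T" "0 \<le> t" for t
  proof -
    define k where "k = nat \<lfloor>t\<rfloor>"
    define r where "r = t - real k"
    have k: "real k \<in> T" by (rule time_of_nat[OF time])
    have r: "r \<in> T" "\<bar>r\<bar> \<le> 1" "t = r + real k"
      using time_diff[OF time t(1) k] t(2) by (auto simp: r_def k_def; linarith)+
    have eq: "\<Phi> t w = \<Phi> r (\<Phi> (real k) w)" using Phi_add[OF r(1) k wV] r(3) by simp
    have in_N: "\<Phi> t w \<in> N" unfolding eq using step[OF r(1,2)] nat by blast
    have "\<psi> (\<Phi> t w) = \<phi> r (\<psi> (\<Phi> (real k) w))"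
      using conjugacy[OF r(1), of "\<Phi> (real k) w"] nat[of k] N1N in_N unfolding eq by auto
    also have "\<dots> = \<phi> (r + (s + real k)) x"
      using nat[of k] flow_add[OF flow r(1) time_add[OF time s k] xX] by simp
    also have "r + (s + real k) = s + t" using r(3) by simp
    finally show ?thesis using in_N by simp
  qed
  \<comment> \<open>Shifting back by \<open>s\<close> aligns the time of the lifted orbit with that
    of \<open>x\<close>.\<close>
  define v where "v = \<Phi> (- s) w"
  have vV: "v \<in> topspace V" unfolding v_def by (rule Phi_in[OF time_uminus[OF time s] wV])
  have v: "\<Phi> t v \<in> N \<and> \<phi> t x = \<psi> (\<Phi> t v)" if "t \<in> T" "s \<le> t" for t
  proof -
    have "\<Phi> t v = \<Phi> (t - s) w"
      unfolding v_def using Phi_add[OF that(1) time_uminus[OF time s] wV] by simp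
    then show ?thesis using real[OF time_diff[OF time that(1) s]] that(2) by simp
  qed
  have "v \<in> S"
    unfolding null_stable_set_def
  proof (intro CollectI conjI allI impI; (elim conjE)?)
    show "v \<in> topspace V" by (rule vV)
    fix W assume W: "openin V W" "null_section M \<subseteq> W"
    \<comment> \<open>Convergence is transferred back: the image of \<open>W \<inter> N\<close> is a
      neighbourhood of \<open>M\<close> that attracts \<open>x\<close>, and injectivity returns the
      linear orbit to \<open>W\<close>.\<close>
    have "openin V (W \<inter> N)" "M \<subseteq> \<psi> ` (W \<inter> N)" using W N_openin null_N psi_null by blast+
    from stable_set_eventually[OF compact_X time x psi_image_openin[OF this(1)] this(2) orbit]
    obtain s1 where s1: "\<And>t. t \<in> T \<Longrightarrow> s1 \<le> t \<Longrightarrow> \<phi> t x \<in> \<psi> ` (W \<inter> N)"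
      unfolding eventually_at_top_in by blast
    have "\<Phi> t v \<in> W" if t: "t \<in> T" "max s s1 \<le> t" for t
    proof -
      obtain w' where w': "w' \<in> W" "w' \<in> N" "\<phi> t x = \<psi> w'" using s1[of t] t by auto
      then have "w' = \<Phi> t v" using v[of t] t psi_inj by auto
      then show ?thesis using w' by simp
    qed
    then show "\<forall>\<^sub>F t in at_top_in T. \<Phi> t v \<in> W" unfolding eventually_at_top_in by blast
  qed
  moreover have "\<forall>\<^sub>F t in at_top_in T. \<phi> t x = \<psi> (\<Phi> t v)"
    unfolding eventually_at_top_in using v by blast
  ultimately show thesis using that by blast
qed

lemma extended_conjugation_tracks:
  assumes "v \<in> S"
  shows "\<forall>\<^sub>F t in at_top_in T. \<phi> t (extended_conjugation T X \<phi> \<Phi> N \<psi> v) = \<psi> (\<Phi> t v)"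
  using S_eventually[OF assms N_openin null_N] extended_conjugation_orbit(2)[OF assms]
  unfolding eventually_at_top_in by blast

lemma extended_conjugation_exponent:
  assumes v: "v \<in> S" and l: "has_lyapunov_exponent T nm \<Phi> v l"
  defines "x \<equiv> extended_conjugation T X \<phi> \<Phi> N \<psi> v"
  shows "metric_regular T X d \<phi> M x" "metric_exponent T d \<phi> M x = l" "lyapunov_exponent T nm \<Phi> v = l"
proof -
  note track = extended_conjugation_tracks[OF v, folded x_def]
  have m: "has_metric_exponent T d \<phi> M x l" using tracking_exponent[OF v track] l by blast
  have "x \<in> stable_set T X \<phi> M"
    using tracking_stable[OF v _ track] extended_conjugation_orbit(1)[OF v] by (simp add: x_def)
  then show "metric_regular T X d \<phi> M x" using m by (auto simp: metric_regular_def)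
  show "metric_exponent T d \<phi> M x = l" by (rule metric_exponent_eq[OF time m])
  show "lyapunov_exponent T nm \<Phi> v = l" by (rule lyapunov_exponent_eq[OF time l])
qed

text \<open>The extended conjugation carries exponents from vectors to points; conversely
  \<open>stable_set_tracked\<close> lifts every stable point to a vector of \<open>S\<close> with
  the same exponent.\<close>

lemma metric_spectrum_eq: "metric_spectrum T X d \<phi> M = lyapunov_spectrum T nm \<Phi> S"
proof (intro equalityI subsetI)
  fix l assume "l \<in> metric_spectrum T X d \<phi> M"
  then obtain x l' where x: "x \<in> stable_set T X \<phi> M" "has_metric_exponent T d \<phi> M x l'" "l = metric_exponent T d \<phi> M x"
    unfolding metric_spectrum_def metric_regular_def by blast
  then have l: "l = l'" using metric_exponent_eq[OF time] by simp
  obtain v where v: "v \<in> S" "\<forall>\<^sub>F t in at_top_in T. \<phi> t x = \<psi> (\<Phi> t v)" using stable_set_tracked[OF x(1)] by blast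
  then have "has_lyapunov_exponent T nm \<Phi> v l" using tracking_exponent x(2) l by blast
  from lyapunov_exponent_eq[OF time this] this have "l = lyapunov_exponent T nm \<Phi> v" "lyapunov_regular T nm \<Phi> v"
    by (auto simp: lyapunov_regular_def)
  then show "l \<in> lyapunov_spectrum T nm \<Phi> S"
    using v(1) unfolding lyapunov_spectrum_def by blast
next
  fix l assume "l \<in> lyapunov_spectrum T nm \<Phi> S"
  then obtain v l' where v: "v \<in> S" "has_lyapunov_exponent T nm \<Phi> v l'" "l = lyapunov_exponent T nm \<Phi> v"
    unfolding lyapunov_spectrum_def lyapunov_regular_def by blast
  note x = extended_conjugation_exponent[OF v(1,2)]
  have "l = metric_exponent T d \<phi> M (extended_conjugation T X \<phi> \<Phi> N \<psi> v)"
    using x(2,3) v(3) by simp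
  then show "l \<in> metric_spectrum T X d \<phi> M"
    using x(1) unfolding metric_spectrum_def by blast
qed

text \<open>Without nonzero forward bounded vectors \<open>M\<close> would be a repeller. The
  forward bounded vector with an exact exponent lies in \<open>S\<close> because every neighbourhood
  of the null section contains a small ball.\<close>

lemma lyapunov_spectrum_nonempty:
  assumes "\<not> repeller T X \<phi> M"
  shows "lyapunov_spectrum T nm \<Phi> S \<noteq> {}"
proof -
  obtain v0 where "forward_bounded v0" "nm v0 \<noteq> 0"
    using repeller_if_no_forward_bounded assms by blast
  then obtain v \<beta> where v: "forward_bounded v" "0 < nm v"
    and \<beta>: "((\<lambda>t. ln (nm (\<Phi> t v)) / t) \<longlongrightarrow> \<beta>) (at_top_in T)"
    using exponent_exists[OF no_bounded_orbit] by blast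
  have vV: "v \<in> topspace V" using v(1) by (simp add: forward_bounded_def)
  have "v \<in> S"
    unfolding null_stable_set_def
  proof (intro CollectI conjI allI impI; (elim conjE)?)
    show "v \<in> topspace V" by (rule vV)
    fix W assume "openin V W" "null_section M \<subseteq> W"
    then obtain e where e: "0 < e" "{v \<in> NB. nm v \<le> e} \<subseteq> W" using small_vectors by blast
    obtain s where s: "\<And>t. t \<in> T \<Longrightarrow> s \<le> t \<Longrightarrow> nm (\<Phi> t v) < e"
      using forward_bounded_tendsto[OF no_bounded_orbit v(1) e(1)] unfolding eventually_at_top_in by blast
    have "\<Phi> t v \<in> W" if "t \<in> T" "s \<le> t" for t
      using s[OF that] Phi_in[OF that(1) vV] e(2) topspace_V by auto
    then show "\<forall>\<^sub>F t in at_top_in T. \<Phi> t v \<in> W" unfolding eventually_at_top_in by blast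
  qed
  moreover have pos: "\<forall>\<^sub>F t in at_top_in T. 0 < nm (\<Phi> t v)"
    unfolding eventually_at_top_in using nm_Phi_pos[OF _ vV] v(2) by blast
  have "has_lyapunov_exponent T nm \<Phi> v \<beta>"
    unfolding has_lyapunov_exponent_def by (rule iffD2[OF elog_rate_iff[OF pos] \<beta>])
  ultimately show ?thesis unfolding lyapunov_spectrum_def lyapunov_regular_def by blast
qed

end

theorem proposition3p3:
  fixes P :: "('x, 'e::euclidean_space) chart set"
    and g :: "'x \<Rightarrow> ('x, 'e) tvec \<Rightarrow> ('x, 'e) tvec \<Rightarrow> real"
    and T :: "real set"
    and \<phi> :: "real \<Rightarrow> 'x \<Rightarrow> 'x"
    and M A :: "'x set"
    and nm :: "'x \<times> ('x, 'e) tvec \<Rightarrow> real"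
    and \<Phi> :: "real \<Rightarrow> 'x \<times> ('x, 'e) tvec \<Rightarrow> 'x \<times> ('x, 'e) tvec"
    and N :: "('x \<times> ('x, 'e) tvec) set"
    and \<psi> :: "'x \<times> ('x, 'e) tvec \<Rightarrow> 'x"
  defines "X \<equiv> manifold_topology P"
    and "d \<equiv> riemannian_dist P g"
    and "V \<equiv> normal_bundle_topology P g M"
    and "S \<equiv> null_stable_set T (normal_bundle_topology P g M) \<Phi> M"
  assumes "smooth_manifold P" and "compact_space X" and "riemannian_metric P g"
    and "is_time T" and "flow_on T X \<phi>"
    and "embedded_submanifold P M" and "compactin X M"
    and "isolated_invariant T X \<phi> M" and "\<not> repeller T X \<phi> M"
    and "bundle_norm V nm"
    and "openin V N" and "null_section M \<subseteq> N"
    and "openin X A" and "M \<subseteq> A"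
    and "diffeomorphism_between (tangent_atlas P) P N A \<psi>"
    and "\<psi> ` null_section M = M"
    and "linear_flow T V \<Phi>"
    and "conjugates_on T \<phi> \<Phi> N \<psi>"
  shows "(\<forall>v\<in>S. lyapunov_regular T nm \<Phi> v \<longrightarrow>
            metric_regular T X d \<phi> M (extended_conjugation T X \<phi> \<Phi> N \<psi> v) \<and>
            metric_exponent T d \<phi> M (extended_conjugation T X \<phi> \<Phi> N \<psi> v) = lyapunov_exponent T nm \<Phi> v)
       \<and> metric_spectrum T X d \<phi> M = lyapunov_spectrum T nm \<Phi> S
       \<and> metric_spectrum T X d \<phi> M \<noteq> {}"
proof -
  interpret normal_conjugation P g T \<phi> M A nm \<Phi> N \<psi>
    using assms
    by unfold_locales (simp_all add: smooth_manifold_def)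
  have "metric_regular T X d \<phi> M (extended_conjugation T X \<phi> \<Phi> N \<psi> v) \<and>
      metric_exponent T d \<phi> M (extended_conjugation T X \<phi> \<Phi> N \<psi> v) = lyapunov_exponent T nm \<Phi> v"
    if v: "v \<in> S" and reg: "lyapunov_regular T nm \<Phi> v" for v
  proof -
    obtain l where "has_lyapunov_exponent T nm \<Phi> v l" using reg unfolding lyapunov_regular_def by blast
    from extended_conjugation_exponent[OF v[unfolded S_def] this] show ?thesis
      by (simp add: X_def d_def)
  qed
  moreover have "metric_spectrum T X d \<phi> M = lyapunov_spectrum T nm \<Phi> S"
    unfolding X_def d_def S_def by (rule metric_spectrum_eq)
  moreover have "lyapunov_spectrum T nm \<Phi> S \<noteq> {}"
    unfolding S_def by (rule lyapunov_spectrum_nonempty) (use \<open>\<not> repeller T X \<phi> M\<close> in \<open>simp add: X_def\<close>)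
  ultimately show ?thesis by simp
qed

end
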